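(* Let $p,q\in\mathbb R$, and let $\sigma$ be a smooth section of $\mathcal E$ with $|\sigma(x)|=k$ for all $x\in M$, where $k>0$ is a constant. (a) If $p\neq 1+1/k^2$, then $\sigma$ is a $(p,q)$-harmonic section of $\mathcal E$ if and only if $\sigma$ is parallel ($\nabla\sigma=0$). (b) If $p=1+1/k^2$, then $\sigma$ is a $(p,q)$-harmonic section of $\mathcal E$ if and only if $\sigma$ is a harmonic section of the sphere bundle $S\mathcal E(k)$.
   Context: Setting: $(M,g)$ is a smooth, oriented, connected Riemannian manifold without boundary (not necessarily compact), and $\pi\colon\mathcal E\to M$ is a smooth oriented real vector bundle with a fibre metric $\langle\,,\rangle$ and a connection $\nabla$ for which the fibre metric is holonomy-invariant, i.e. $\nabla\langle\,,\rangle=0$. All sections are smooth. For a section $\sigma$, put $F=\tfrac12|\sigma|^2\colon M\to\mathbb R$, let $\nabla F$ be its gradient, and $|\nabla\sigma|^2=\sum_i|\nabla_{E_i}\sigma|^2$ for a local orthonormal tangent frame $\{E_i\}$. For $p,q\in\mathbb R$ define a symmetric 2-tensor on the total space $\mathcal E$ by $h_{p,q}(A,B)=g(d\pi(A),d\pi(B))+(1+|e|^2)^{-p}\big(\langle KA,KB\rangle+q\langle KA,e\rangle\langle KB,e\rangle\big)$ for $A,B\in T_e\mathcal E$, where $K\colon T\mathcal E\to\mathcal E$ is the connection map of $\nabla$. The vertical $(p,q)$-energy of $\sigma$ (half the integral of the $h_{p,q}$-square norm of the vertical part of $d\sigma$) is $$E^v_{p,q}(\sigma)=\frac12\int_M\frac{1}{(1+|\sigma|^2)^p}\big(|\nabla\sigma|^2+q|\nabla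 F|^2\big)\,\mathrm{vol}(g)$$ if $M$ is compact; if $M$ is non-compact the integral is taken over relatively compact domains. $\sigma$ is a $(p,q)$-harmonic section of $\mathcal E$ if $\frac{d}{dt}\big|_{t=0}E^v_{p,q}(\sigma_t)=0$ for every smooth variation $\sigma_t$ of $\sigma_0=\sigma$ through sections of $\mathcal E$ (for non-compact $M$: every variation that equals $\sigma$ outside a compact set independent of $t$, the energy being taken over a relatively compact domain containing that set). For $k>0$, $S\mathcal E(k)=\{e\in\mathcal E:|e|=k\}$. A section $\sigma$ with $|\sigma|=k$ is a harmonic section of $S\mathcal E(k)$ if it is a critical point of $\frac12\int_M|\nabla\sigma|^2\,\mathrm{vol}(g)$ with respect to smooth variations through sections of $S\mathcal E(k)$ (if $M$ is non-compact: variations that equal $\sigma$ outside a compact set independent of $t$, the integral being taken over a relatively compact domain containing that set); equivalently $\nabla^*\nabla\sigma=\frac1{k^2}|\nabla\sigma|^2\sigma$, where $\nabla^*\nabla=-\mathrm{Trace}\,\nabla^2$. (For sections of $S\mathcal E(k)$, $E^v_{p,q}$ is a constant multiple of this functional, so the notion does not depend on $(p,q)$.) *)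

theory Defs
  imports "HOL-Analysis.Analysis"
begin

section \<open>Smooth maps on open subsets of normed spaces\<close>

text \<open>Only meant for open \<open>S\<close>: the derivatives are not taken relative to \<open>S\<close>.  On a
  finite-dimensional domain, \<open>Ck_on n S f\<close> says that \<open>f\<close> has continuous partial derivatives up
  to order \<open>n\<close>.\<close>

primrec Ck_on ::
  "nat \<Rightarrow> 'a::real_normed_vector set \<Rightarrow> ('a \<Rightarrow> 'b::real_normed_vector) \<Rightarrow> bool" where
  "Ck_on 0 S f \<longleftrightarrow> continuous_on S f"
| "Ck_on (Suc n) S f \<longleftrightarrow>
     (\<forall>x\<in>S. f differentiable (at x)) \<and> (\<forall>v. Ck_on n S (\<lambda>x. frechet_derivative f (at x) v))"

definition smooth_on ::
  "'a::real_normed_vector set \<Rightarrow> ('a \<Rightarrow> 'b::real_normed_vector) \<Rightarrow> bool" where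
  "smooth_on S f \<longleftrightarrow> (\<forall>n. Ck_on n S f)"


section \<open>Connected oriented manifolds\<close>

text \<open>The points of the manifold are all elements of the type \<open>'a\<close>; the model space is
  \<open>real ^ 'm\<close>.  A chart is its domain together with the coordinate map, whose values outside
  the domain are irrelevant; its inverse is \<open>inv_into U c\<close>.  The atlas need not be maximal.
  It is an
  oriented atlas: all charts in it are positively oriented.\<close>

type_synonym ('a, 'm) chart = "'a set \<times> ('a \<Rightarrow> real ^ 'm)"

text \<open>A tangent vector is identified with the operator on smooth functions that it induces;
  on functions that are not smooth this operator is set to zero.\<close>

type_synonym 'a tangent = "('a \<Rightarrow> real) \<Rightarrow> real"

locale oriented_manifold =
  fixes A :: "('a::{t2_space, second_countable_topology}, 'm::finite) chart set"
  assumes connected_points: "connected (UNIV :: 'a set)"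
    and charts_cover: "\<exists>U c. (U, c) \<in> A \<and> x \<in> U"
    and chart_open: "(U, c) \<in> A \<Longrightarrow> open U \<and> open (c ` U)"
    and chart_homeomorphism: "(U, c) \<in> A \<Longrightarrow> homeomorphism U (c ` U) c (inv_into U c)"
    and transition_smooth:
      "(U, c) \<in> A \<Longrightarrow> (V, d) \<in> A \<Longrightarrow> smooth_on (c ` (U \<inter> V)) (d \<circ> inv_into U c)"
    and transition_oriented:
      "(U, c) \<in> A \<Longrightarrow> (V, d) \<in> A \<Longrightarrow> x \<in> U \<inter> V \<Longrightarrow>
        0 < det (matrix (frechet_derivative (d \<circ> inv_into U c) (at (c x))))"
begin

definition smooth_fun :: "('a \<Rightarrow> real) \<Rightarrow> bool" where
  "smooth_fun f \<longleftrightarrow> (\<forall>(U, c)\<in>A. smooth_on (c ` U) (f \<circ> inv_into U c))"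

text \<open>The tangent vector at \<open>x \<in> U\<close> with components \<open>v\<close> in the chart \<open>(U, c)\<close>; thus
  \<open>coord_vec U c x (axis i 1)\<close> is the \<open>i\<close>-th coordinate vector at \<open>x\<close>.\<close>

definition coord_vec :: "'a set \<Rightarrow> ('a \<Rightarrow> real ^ 'm) \<Rightarrow> 'a \<Rightarrow> real ^ 'm \<Rightarrow> 'a tangent" where
  "coord_vec U c x v =
     (\<lambda>f. if smooth_fun f then frechet_derivative (f \<circ> inv_into U c) (at (c x)) v else 0)"

definition tangent_space :: "'a \<Rightarrow> 'a tangent set" where
  "tangent_space x = {coord_vec U c x v | U c v. (U, c) \<in> A \<and> x \<in> U}"

text \<open>For compact \<open>M\<close> variations are unrestricted and energies are taken over all of \<open>M\<close>.  For
  non-compact \<open>M\<close> the variations are fixed outside a compact set \<open>K\<close>, and energies are taken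
  over relatively compact domains \<open>D\<close> containing \<open>K\<close>.\<close>

definition variation_domain :: "'a set \<Rightarrow> 'a set \<Rightarrow> bool" where
  "variation_domain K D \<longleftrightarrow>
     (if compact (UNIV :: 'a set) then K = UNIV \<and> D = UNIV
      else compact K \<and> K \<subseteq> D \<and> open D \<and> connected D \<and> compact (closure D))"

end


section \<open>Riemannian metric and volume measure\<close>

text \<open>The Riemannian volume measure is the Borel measure that is given by
  \<open>sqrt (det (g\<^sub>i\<^sub>j)) dy\<close> in every chart.  Covering the manifold by countably many charts shows
  that this determines it uniquely.\<close>

locale riemannian_manifold = oriented_manifold A
  for A :: "('a::{t2_space, second_countable_topology}, 'm::finite) chart set" +
  fixes g :: "'a \<Rightarrow> 'a tangent \<Rightarrow> 'a tangent \<Rightarrow> real"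
    and vol :: "'a measure"
  assumes g_linear:
      "\<xi> \<in> tangent_space x \<Longrightarrow> \<eta> \<in> tangent_space x \<Longrightarrow> \<zeta> \<in> tangent_space x \<Longrightarrow>
        g x (\<lambda>f. a * \<xi> f + b * \<eta> f) \<zeta> = a * g x \<xi> \<zeta> + b * g x \<eta> \<zeta>"
    and g_symmetric:
      "\<xi> \<in> tangent_space x \<Longrightarrow> \<eta> \<in> tangent_space x \<Longrightarrow> g x \<xi> \<eta> = g x \<eta> \<xi>"
    and g_positive: "\<xi> \<in> tangent_space x \<Longrightarrow> \<xi> \<noteq> (\<lambda>f. 0) \<Longrightarrow> 0 < g x \<xi> \<xi>"
    and g_smooth:
      "(U, c) \<in> A \<Longrightarrow> smooth_on (c ` U)
        (\<lambda>y. g (inv_into U c y)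
               (coord_vec U c (inv_into U c y) v) (coord_vec U c (inv_into U c y) w))"
    and sets_vol: "sets vol = sets borel"
    and emeasure_vol:
      "(U, c) \<in> A \<Longrightarrow> S \<in> sets borel \<Longrightarrow> S \<subseteq> U \<Longrightarrow>
        emeasure vol S =
          (\<integral>\<^sup>+y\<in>c ` S. ennreal (sqrt (det (\<chi> i j.
             g (inv_into U c y)
               (coord_vec U c (inv_into U c y) (axis i 1))
               (coord_vec U c (inv_into U c y) (axis j 1))))) \<partial>lborel)"
begin

definition orthonormal_basis :: "'a \<Rightarrow> ('m \<Rightarrow> 'a tangent) \<Rightarrow> bool" where
  "orthonormal_basis x b \<longleftrightarrow>
     (\<forall>i. b i \<in> tangent_space x) \<and> (\<forall>i j. g x (b i) (b j) = (if i = j then 1 else 0))"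

definition gradient :: "('a \<Rightarrow> real) \<Rightarrow> 'a \<Rightarrow> 'a tangent" where
  "gradient f x = (THE \<zeta>. \<zeta> \<in> tangent_space x \<and> (\<forall>\<xi>\<in>tangent_space x. g x \<zeta> \<xi> = \<xi> f))"

end


section \<open>Oriented vector bundles with fibre metric and metric connection\<close>

text \<open>The fibre over \<open>x\<close> is a subspace \<open>E x\<close> of a real vector space \<open>'v\<close>, so that the total
  space is \<open>Sigma UNIV E\<close>.  No topology on \<open>'v\<close> is involved and no relation between the
  positions of different fibres in \<open>'v\<close> is assumed, so this is no restriction: \<open>'v\<close> may be the
  direct sum of all the fibres.  The smooth structure comes from the local trivialisations
  \<open>(V, \<phi>) \<in> B\<close>, where \<open>\<phi> x\<close>, for \<open>x \<in> V\<close>, is a linear isomorphism from \<open>E x\<close> onto \<open>real ^ 'n\<close>;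
  its values outside \<open>E x\<close> are irrelevant.  The orientation is given by the trivialisations in
  \<open>B\<close>, all of which are positively oriented.\<close>

locale oriented_vector_bundle = oriented_manifold A
  for A :: "('a::{t2_space, second_countable_topology}, 'm::finite) chart set" +
  fixes E :: "'a \<Rightarrow> 'v::real_vector set"
    and B :: "('a set \<times> ('a \<Rightarrow> 'v \<Rightarrow> real ^ 'n::finite)) set"
  assumes fibre_subspace: "subspace (E x)"
    and trivialisations_cover: "\<exists>V \<phi>. (V, \<phi>) \<in> B \<and> x \<in> V"
    and trivialisation_open: "(V, \<phi>) \<in> B \<Longrightarrow> open V"
    and trivialisation_linear:
      "(V, \<phi>) \<in> B \<Longrightarrow> x \<in> V \<Longrightarrow> u \<in> E x \<Longrightarrow> w \<in> E x \<Longrightarrow>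
        \<phi> x (a *\<^sub>R u + b *\<^sub>R w) = a *\<^sub>R \<phi> x u + b *\<^sub>R \<phi> x w"
    and trivialisation_bij: "(V, \<phi>) \<in> B \<Longrightarrow> x \<in> V \<Longrightarrow> bij_betw (\<phi> x) (E x) UNIV"
    and bundle_transition_smooth:
      "(V, \<phi>) \<in> B \<Longrightarrow> (W, \<psi>) \<in> B \<Longrightarrow> (U, c) \<in> A \<Longrightarrow>
        smooth_on (c ` (U \<inter> V \<inter> W))
          (\<lambda>y. \<psi> (inv_into U c y) (inv_into (E (inv_into U c y)) (\<phi> (inv_into U c y)) z))"
    and bundle_transition_oriented:
      "(V, \<phi>) \<in> B \<Longrightarrow> (W, \<psi>) \<in> B \<Longrightarrow> x \<in> V \<inter> W \<Longrightarrow>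
        0 < det (matrix (\<lambda>z. \<psi> x (inv_into (E x) (\<phi> x) z)))"
begin

definition smooth_section :: "('a \<Rightarrow> 'v) \<Rightarrow> bool" where
  "smooth_section \<sigma> \<longleftrightarrow>
     (\<forall>x. \<sigma> x \<in> E x) \<and>
     (\<forall>(U, c)\<in>A. \<forall>(V, \<phi>)\<in>B.
        smooth_on (c ` (U \<inter> V)) (\<lambda>y. \<phi> (inv_into U c y) (\<sigma> (inv_into U c y))))"

text \<open>Variations \<open>\<sigma>\<^sub>t\<close> are defined for \<open>\<bar>t\<bar> < \<epsilon>\<close> and smooth jointly in \<open>t\<close> and the point of the
  manifold.\<close>

definition variation :: "'a set \<Rightarrow> real \<Rightarrow> ('a \<Rightarrow> 'v) \<Rightarrow> (real \<Rightarrow> 'a \<Rightarrow> 'v) \<Rightarrow> bool" where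
  "variation K \<epsilon> \<sigma> \<Sigma> \<longleftrightarrow>
     0 < \<epsilon> \<and> \<Sigma> 0 = \<sigma> \<and>
     (\<forall>t\<in>{-\<epsilon><..<\<epsilon>}. \<forall>x. \<Sigma> t x \<in> E x) \<and>
     (\<forall>(U, c)\<in>A. \<forall>(V, \<phi>)\<in>B.
        smooth_on ({-\<epsilon><..<\<epsilon>} \<times> c ` (U \<inter> V))
          (\<lambda>(t, y). \<phi> (inv_into U c y) (\<Sigma> t (inv_into U c y)))) \<and>
     (\<forall>t\<in>{-\<epsilon><..<\<epsilon>}. \<forall>x. x \<notin> K \<longrightarrow> \<Sigma> t x = \<sigma> x)"

end

text \<open>\<open>h x\<close> is the fibre metric on \<open>E x\<close>, and \<open>nab \<sigma> x \<xi>\<close> is the covariant derivative of the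
  smooth section \<open>\<sigma>\<close> in the direction of the tangent vector \<open>\<xi>\<close> at \<open>x\<close>.\<close>

locale riemannian_vector_bundle =
  riemannian_manifold A g vol + oriented_vector_bundle A E B
  for A :: "('a::{t2_space, second_countable_topology}, 'm::finite) chart set"
    and g :: "'a \<Rightarrow> 'a tangent \<Rightarrow> 'a tangent \<Rightarrow> real"
    and vol :: "'a measure"
    and E :: "'a \<Rightarrow> 'v::real_vector set"
    and B :: "('a set \<times> ('a \<Rightarrow> 'v \<Rightarrow> real ^ 'n::finite)) set" +
  fixes h :: "'a \<Rightarrow> 'v \<Rightarrow> 'v \<Rightarrow> real"
    and nab :: "('a \<Rightarrow> 'v) \<Rightarrow> 'a \<Rightarrow> 'a tangent \<Rightarrow> 'v"
  assumes h_linear: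
      "e \<in> E x \<Longrightarrow> e' \<in> E x \<Longrightarrow> e'' \<in> E x \<Longrightarrow>
        h x (a *\<^sub>R e + b *\<^sub>R e') e'' = a * h x e e'' + b * h x e' e''"
    and h_symmetric: "e \<in> E x \<Longrightarrow> e' \<in> E x \<Longrightarrow> h x e e' = h x e' e"
    and h_positive: "e \<in> E x \<Longrightarrow> e \<noteq> 0 \<Longrightarrow> 0 < h x e e"
    and h_smooth:
      "(V, \<phi>) \<in> B \<Longrightarrow> (U, c) \<in> A \<Longrightarrow>
        smooth_on (c ` (U \<inter> V))
          (\<lambda>y. h (inv_into U c y)
                 (inv_into (E (inv_into U c y)) (\<phi> (inv_into U c y)) z)
                 (inv_into (E (inv_into U c y)) (\<phi> (inv_into U c y)) z'))"
    and nab_in_fibre: "smooth_section \<sigma> \<Longrightarrow> \<xi> \<in> tangent_space x \<Longrightarrow> nab \<sigma> x \<xi> \<in> E x"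
    and nab_linear:
      "smooth_section \<sigma> \<Longrightarrow> \<xi> \<in> tangent_space x \<Longrightarrow> \<eta> \<in> tangent_space x \<Longrightarrow>
        nab \<sigma> x (\<lambda>f. a * \<xi> f + b * \<eta> f) = a *\<^sub>R nab \<sigma> x \<xi> + b *\<^sub>R nab \<sigma> x \<eta>"
    and nab_add:
      "smooth_section \<sigma> \<Longrightarrow> smooth_section \<tau> \<Longrightarrow> \<xi> \<in> tangent_space x \<Longrightarrow>
        nab (\<lambda>x. \<sigma> x + \<tau> x) x \<xi> = nab \<sigma> x \<xi> + nab \<tau> x \<xi>"
    and nab_Leibniz:
      "smooth_fun f \<Longrightarrow> smooth_section \<sigma> \<Longrightarrow> \<xi> \<in> tangent_space x \<Longrightarrow>
        nab (\<lambda>x. f x *\<^sub>R \<sigma> x) x \<xi> = \<xi> f *\<^sub>R \<sigma> x + f x *\<^sub>R nab \<sigma> x \<xi>"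
    and nab_smooth:
      "smooth_section \<sigma> \<Longrightarrow> (U, c) \<in> A \<Longrightarrow> (V, \<phi>) \<in> B \<Longrightarrow>
        smooth_on (c ` (U \<inter> V))
          (\<lambda>y. \<phi> (inv_into U c y)
                 (nab \<sigma> (inv_into U c y) (coord_vec U c (inv_into U c y) v)))"
    and nab_metric:
      "smooth_section \<sigma> \<Longrightarrow> smooth_section \<tau> \<Longrightarrow> \<xi> \<in> tangent_space x \<Longrightarrow>
        \<xi> (\<lambda>x. h x (\<sigma> x) (\<tau> x)) = h x (nab \<sigma> x \<xi>) (\<tau> x) + h x (\<sigma> x) (nab \<tau> x \<xi>)"
begin

definition fibre_norm :: "'a \<Rightarrow> 'v \<Rightarrow> real" where
  "fibre_norm x e = sqrt (h x e e)"

definition parallel :: "('a \<Rightarrow> 'v) \<Rightarrow> bool" where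
  "parallel \<sigma> \<longleftrightarrow> (\<forall>x. \<forall>\<xi>\<in>tangent_space x. nab \<sigma> x \<xi> = 0)"

text \<open>\<open>|\<nabla>\<sigma>|\<^sup>2\<close> at \<open>x\<close>; the sum does not depend on the orthonormal basis that is chosen.\<close>

definition nab_norm_sq :: "('a \<Rightarrow> 'v) \<Rightarrow> 'a \<Rightarrow> real" where
  "nab_norm_sq \<sigma> x =
     (let b = (SOME b. orthonormal_basis x b) in \<Sum>i\<in>UNIV. (fibre_norm x (nab \<sigma> x (b i)))\<^sup>2)"

definition half_norm_sq :: "('a \<Rightarrow> 'v) \<Rightarrow> 'a \<Rightarrow> real" where
  "half_norm_sq \<sigma> x = (fibre_norm x (\<sigma> x))\<^sup>2 / 2"

definition grad_norm_sq :: "('a \<Rightarrow> real) \<Rightarrow> 'a \<Rightarrow> real" where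
  "grad_norm_sq f x = g x (gradient f x) (gradient f x)"

definition vertical_energy :: "real \<Rightarrow> real \<Rightarrow> 'a set \<Rightarrow> ('a \<Rightarrow> 'v) \<Rightarrow> real" where
  "vertical_energy p q D \<sigma> =
     1 / 2 * (LINT x:D|vol. 1 / (1 + (fibre_norm x (\<sigma> x))\<^sup>2) powr p *
                (nab_norm_sq \<sigma> x + q * grad_norm_sq (half_norm_sq \<sigma>) x))"

definition dirichlet_energy :: "'a set \<Rightarrow> ('a \<Rightarrow> 'v) \<Rightarrow> real" where
  "dirichlet_energy D \<sigma> = 1 / 2 * (LINT x:D|vol. nab_norm_sq \<sigma> x)"

definition pq_harmonic_section :: "real \<Rightarrow> real \<Rightarrow> ('a \<Rightarrow> 'v) \<Rightarrow> bool" where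
  "pq_harmonic_section p q \<sigma> \<longleftrightarrow>
     smooth_section \<sigma> \<and>
     (\<forall>K D \<epsilon> \<Sigma>. variation_domain K D \<longrightarrow> variation K \<epsilon> \<sigma> \<Sigma> \<longrightarrow>
        ((\<lambda>t. vertical_energy p q D (\<Sigma> t)) has_real_derivative 0) (at 0))"

definition sphere_section :: "real \<Rightarrow> ('a \<Rightarrow> 'v) \<Rightarrow> bool" where
  "sphere_section k \<sigma> \<longleftrightarrow> (\<forall>x. \<sigma> x \<in> E x \<and> fibre_norm x (\<sigma> x) = k)"

definition sphere_harmonic_section :: "real \<Rightarrow> ('a \<Rightarrow> 'v) \<Rightarrow> bool" where
  "sphere_harmonic_section k \<sigma> \<longleftrightarrow>
     smooth_section \<sigma> \<and> sphere_section k \<sigma> \<and>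
     (\<forall>K D \<epsilon> \<Sigma>. variation_domain K D \<longrightarrow> variation K \<epsilon> \<sigma> \<Sigma> \<longrightarrow>
        (\<forall>t\<in>{-\<epsilon><..<\<epsilon>}. sphere_section k (\<Sigma> t)) \<longrightarrow>
        ((\<lambda>t. dirichlet_energy D (\<Sigma> t)) has_real_derivative 0) (at 0))"

end

end

theory Submission
  imports Defs
begin

text \<open>A nowhere vanishing section is written in polar form \<open>r \<theta>\<close> with \<open>|\<theta>| = k\<close>.  Since
  \<open>\<nabla>\<theta>\<close> is orthogonal to \<open>\<theta>\<close>, its energy density is
  \<open>(1 + k\<^sup>2 r\<^sup>2)\<^sup>-\<^sup>p (r\<^sup>2 |\<nabla>\<theta>|\<^sup>2 + (k\<^sup>2 + q k\<^sup>4 r\<^sup>2) |\<nabla>r|\<^sup>2)\<close>.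
  Along a variation that starts at \<open>r = 1\<close> the second term does not contribute to the first
  variation, as it has a minimum there, and the factor
  \<open>(1 + k\<^sup>2 r\<^sup>2)\<^sup>-\<^sup>p r\<^sup>2\<close> is stationary at \<open>r = 1\<close> exactly if
  \<open>p = 1 + 1 / k\<^sup>2\<close>.  For this \<open>p\<close> only the tangential part of the variation matters; for any
  other \<open>p\<close> the radial variations \<open>(1 + t f) \<sigma>\<close> force \<open>\<nabla>\<sigma> = 0\<close>.  Conversely, if
  \<open>\<nabla>\<sigma> = 0\<close>, then \<open>|\<nabla>\<sigma>\<^sub>t|\<^sup>2\<close> and \<open>|\<nabla>F\<^sub>t|\<^sup>2\<close> have a minimum at \<open>t = 0\<close>.\<close>


section \<open>Calculus of smooth maps\<close>

text \<open>The critical points are compared directly through derivatives of the energy in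
  \<open>t\<close>; no Euler-Lagrange equation and no integration by parts enters. The price is
  differentiation under the integral, for which the energy density of a variation must be smooth
  jointly in time and position. Two definitions obstruct this: \<open>nab_norm_sq\<close> picks an
  orthonormal basis at each point with no continuity in the point, and \<open>nab\<close> accepts
  only global sections, so a local frame cannot be differentiated as it stands. The first is met by
  writing traces with the inverse Gram matrix, the second by cutting frames off to global sections.
  The polar form is available only where the variation does not vanish: outside \<open>K\<close> it
  keeps the length \<open>k\<close>, and on the compact set \<open>K\<close> a Lipschitz bound in
  \<open>t\<close> keeps its length positive for small \<open>t\<close>. The critical exponent comes
  from the logarithmic derivative of
  \<open>r\<^sup>2 * (1 + k\<^sup>2 * r\<^sup>2) powr (- p)\<close> at \<open>r = 1\<close>, which
  is \<open>2 - 2 * p * k\<^sup>2 / (1 + k\<^sup>2)\<close>.\<close>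

lemma Ck_on_subset: "Ck_on n S f \<Longrightarrow> T \<subseteq> S \<Longrightarrow> Ck_on n T f"
  by (induction n arbitrary: f) (auto intro: continuous_on_subset)

lemma frechet_derivative_cong_open:
  assumes "open S" "x \<in> S" "\<And>y. y \<in> S \<Longrightarrow> f y = g y"
  shows "frechet_derivative f (at x) = frechet_derivative g (at x)"
proof -
  have "(f has_derivative D) (at x) \<longleftrightarrow> (g has_derivative D) (at x)" for D
    using assms has_derivative_transform_within_open[of f D x UNIV S g]
      has_derivative_transform_within_open[of g D x UNIV S f] by auto
  then show ?thesis unfolding frechet_derivative_def by simp
qed

lemma differentiable_cong_open:
  assumes "open S" "x \<in> S" "\<And>y. y \<in> S \<Longrightarrow> f y = g y" "f differentiable (at x)"
  shows "g differentiable (at x)"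
  using assms has_derivative_transform_within_open[of f _ x UNIV S g]
  unfolding differentiable_def by blast

text \<open>A derivative at a point depends on the values in a neighbourhood, so agreement on an
  open set passes to all derivatives.\<close>

lemma Ck_on_cong:
  "open S \<Longrightarrow> (\<And>x. x \<in> S \<Longrightarrow> f x = g x) \<Longrightarrow> Ck_on n S f \<Longrightarrow> Ck_on n S g"
proof (induction n arbitrary: f g)
  case 0
  then show ?case by (simp cong: continuous_on_cong)
next
  case (Suc n)
  have "frechet_derivative f (at x) = frechet_derivative g (at x)" if "x \<in> S" for x
    by (rule frechet_derivative_cong_open[OF Suc.prems(1) that Suc.prems(2)])
  moreover have "g differentiable (at x)" if "x \<in> S" for x
    using differentiable_cong_open[OF Suc.prems(1) that Suc.prems(2)] Suc.prems(3) that by auto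
  ultimately show ?case
    using Suc.IH[OF Suc.prems(1), of "\<lambda>x. frechet_derivative f (at x) v" "\<lambda>x. frechet_derivative g (at x) v" for v]
      Suc.prems(3) by auto
qed

text \<open>Lets every closure rule work with an explicit derivative: by uniqueness it agrees on
  \<open>S\<close> with the \<open>frechet_derivative\<close> that the definition demands.\<close>

lemma Ck_on_SucI:
  assumes "open S" "\<And>x. x \<in> S \<Longrightarrow> (f has_derivative f' x) (at x)"
    "\<And>v. Ck_on n S (\<lambda>x. f' x v)"
  shows "Ck_on (Suc n) S f"
proof -
  have "frechet_derivative f (at x) = f' x" if "x \<in> S" for x
    using assms(2)[OF that] frechet_derivative_at by metis
  then have "Ck_on n S (\<lambda>x. frechet_derivative f (at x) v)" for v
    by (intro Ck_on_cong[OF assms(1) _ assms(3)[of v]]) simp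
  then show ?thesis using assms(2) by (auto simp: differentiable_def)
qed

lemma Ck_on_SucD: "Ck_on (Suc n) S f \<Longrightarrow> Ck_on n S f"
proof (induction n arbitrary: f)
  case 0
  then show ?case
    by (auto intro!: continuous_at_imp_continuous_on differentiable_imp_continuous_within)
next
  case (Suc n)
  then show ?case by (metis Ck_on.simps(2))
qed

lemma Ck_on_has_derivative:
  "Ck_on (Suc n) S f \<Longrightarrow> x \<in> S \<Longrightarrow> (f has_derivative frechet_derivative f (at x)) (at x)"
  by (simp add: frechet_derivative_works[symmetric])

lemma Ck_on_const: "Ck_on n S (\<lambda>x. c)"
  by (induction n arbitrary: c) (auto intro: continuous_on_const)

lemma Ck_on_linear_comp:
  assumes "bounded_linear L" "open S"
  shows "Ck_on n S f \<Longrightarrow> Ck_on n S (\<lambda>x. L (f x))"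
proof (induction n arbitrary: f)
  case 0
  then show ?case by (simp add: assms(1) bounded_linear.continuous_on)
next
  case (Suc n)
  show ?case
  proof (rule Ck_on_SucI[OF assms(2)])
    show "((\<lambda>x. L (f x)) has_derivative (\<lambda>v. L (frechet_derivative f (at x) v))) (at x)"
      if "x \<in> S" for x
      using bounded_linear.has_derivative[OF assms(1) Ck_on_has_derivative[OF Suc.prems that]] .
    show "Ck_on n S (\<lambda>x. L (frechet_derivative f (at x) v))" for v
      using Suc by auto
  qed
qed

lemma Ck_on_add:
  assumes "open S"
  shows "Ck_on n S f \<Longrightarrow> Ck_on n S g \<Longrightarrow> Ck_on n S (\<lambda>x. f x + g x)"
proof (induction n arbitrary: f g)
  case 0
  then show ?case by (simp add: continuous_on_add)
next
  case (Suc n)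
  show ?case
  proof (rule Ck_on_SucI[OF assms])
    show "((\<lambda>x. f x + g x) has_derivative
        (\<lambda>v. frechet_derivative f (at x) v + frechet_derivative g (at x) v)) (at x)"
      if "x \<in> S" for x
      using Suc.prems[THEN Ck_on_has_derivative, OF that] by (rule has_derivative_add)
    show "Ck_on n S (\<lambda>x. frechet_derivative f (at x) v + frechet_derivative g (at x) v)" for v
      using Suc by auto
  qed
qed

text \<open>The product rule gives a sum of two terms of the form \<open>P (f x) (g x)\<close>
  again, so the induction closes once \<open>f\<close> and \<open>g\<close> are varied.\<close>

lemma Ck_on_bilinear:
  assumes "bounded_bilinear P" "open S"
  shows "Ck_on n S f \<Longrightarrow> Ck_on n S g \<Longrightarrow> Ck_on n S (\<lambda>x. P (f x) (g x))"
proof (induction n arbitrary: f g)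
  case 0
  then show ?case by (simp add: assms(1) bounded_bilinear.continuous_on)
next
  case (Suc n)
  show ?case
  proof (rule Ck_on_SucI[OF assms(2)])
    show "((\<lambda>x. P (f x) (g x)) has_derivative
        (\<lambda>v. P (f x) (frechet_derivative g (at x) v) + P (frechet_derivative f (at x) v) (g x))) (at x)"
      if "x \<in> S" for x
      using bounded_bilinear.FDERIV[OF assms(1) Suc.prems[THEN Ck_on_has_derivative, OF that]] .
    show "Ck_on n S (\<lambda>x. P (f x) (frechet_derivative g (at x) v) +
        P (frechet_derivative f (at x) v) (g x))" for v
      using Suc.prems Suc.prems[THEN Ck_on_SucD]
      by (intro Ck_on_add[OF assms(2)] Suc.IH) auto
  qed
qed

lemma Ck_on_sum:
  assumes "open S"
  shows "(\<And>i. i \<in> I \<Longrightarrow> Ck_on n S (f i)) \<Longrightarrow> Ck_on n S (\<lambda>x. \<Sum>i\<in>I. f i x)"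
  by (induction I rule: infinite_finite_induct) (auto intro: Ck_on_const Ck_on_add[OF assms])

text \<open>In the chain rule both the base point and the direction of the derivative of
  \<open>g\<close> move with \<open>x\<close>, while the induction hypothesis covers fixed
  directions only. Expanding the direction in \<open>Basis\<close> separates the two, which is why
  the intermediate space is Euclidean.\<close>

lemma Ck_on_compose:
  fixes f :: "'a::real_normed_vector \<Rightarrow> 'b::euclidean_space"
    and g :: "'b \<Rightarrow> 'c::real_normed_vector"
  assumes "open S" "open T" "f ` S \<subseteq> T"
  shows "Ck_on n S f \<Longrightarrow> Ck_on n T g \<Longrightarrow> Ck_on n S (\<lambda>x. g (f x))"
  using assms(3)
proof (induction n arbitrary: f g)
  case 0
  then show ?case by (auto intro: continuous_on_compose2)
next
  case (Suc n)
  let ?D = "\<lambda>x. frechet_derivative f (at x)" and ?G = "\<lambda>y. frechet_derivative g (at y)"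
  show ?case
  proof (rule Ck_on_SucI[OF assms(1)])
    fix x assume x: "x \<in> S"
    have df: "(f has_derivative ?D x) (at x)" by (rule Ck_on_has_derivative[OF Suc.prems(1) x])
    have dg: "(g has_derivative ?G (f x)) (at (f x))"
      using Ck_on_has_derivative[OF Suc.prems(2)] x Suc.prems(3) by auto
    have rep: "?G (f x) w = (\<Sum>b\<in>Basis. (w \<bullet> b) *\<^sub>R ?G (f x) b)" for w
    proof -
      have "linear (?G (f x))" using dg by (simp add: has_derivative_linear)
      then show ?thesis
        by (subst euclidean_representation[symmetric, of w])
           (simp only: linear_sum linear_cmul)
    qed
    have eq: "(\<lambda>v. ?G (f x) (?D x v)) = (\<lambda>v. \<Sum>b\<in>Basis. (?D x v \<bullet> b) *\<^sub>R ?G (f x) b)"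
      by (rule ext) (rule rep)
    show "((\<lambda>x. g (f x)) has_derivative (\<lambda>v. \<Sum>b\<in>Basis. (?D x v \<bullet> b) *\<^sub>R ?G (f x) b)) (at x)"
      using has_derivative_compose[OF df dg] unfolding eq .
  next
    fix v
    have "Ck_on n S (\<lambda>x. ?G (f x) b)" for b
      using Suc.prems Ck_on_SucD[OF Suc.prems(1)] by (intro Suc.IH) auto
    moreover have "Ck_on n S (\<lambda>x. ?D x v \<bullet> b)" for b
      using Suc.prems by (intro Ck_on_linear_comp[OF bounded_linear_inner_left assms(1)]) auto
    ultimately show "Ck_on n S (\<lambda>x. \<Sum>b\<in>Basis. (?D x v \<bullet> b) *\<^sub>R ?G (f x) b)"
      by (intro Ck_on_sum[OF assms(1)] Ck_on_bilinear[OF bounded_bilinear_scaleR assms(1)])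
  qed
qed

lemma smooth_on_subset: "smooth_on S f \<Longrightarrow> T \<subseteq> S \<Longrightarrow> smooth_on T f"
  unfolding smooth_on_def by (meson Ck_on_subset)

lemma smooth_on_cong:
  "open S \<Longrightarrow> smooth_on S f \<Longrightarrow> (\<And>x. x \<in> S \<Longrightarrow> f x = g x) \<Longrightarrow> smooth_on S g"
  unfolding smooth_on_def using Ck_on_cong by blast

lemma smooth_on_const: "smooth_on S (\<lambda>x. c)"
  unfolding smooth_on_def by (simp add: Ck_on_const)

lemma smooth_on_linear_comp:
  "bounded_linear L \<Longrightarrow> open S \<Longrightarrow> smooth_on S f \<Longrightarrow> smooth_on S (\<lambda>x. L (f x))"
  unfolding smooth_on_def using Ck_on_linear_comp by blast

lemma smooth_on_id: "open S \<Longrightarrow> smooth_on S (\<lambda>x. x)"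
  unfolding smooth_on_def
proof
  fix n assume "open S"
  then show "Ck_on n S (\<lambda>x. x)"
    by (cases n) (auto intro!: Ck_on_SucI[OF _ has_derivative_ident] Ck_on_const continuous_on_id)
qed

lemma smooth_on_linear: "bounded_linear L \<Longrightarrow> open S \<Longrightarrow> smooth_on S L"
  using smooth_on_linear_comp[of L S "\<lambda>x. x"] smooth_on_id by blast

lemma smooth_on_add:
  "open S \<Longrightarrow> smooth_on S f \<Longrightarrow> smooth_on S g \<Longrightarrow> smooth_on S (\<lambda>x. f x + g x)"
  unfolding smooth_on_def using Ck_on_add by blast

lemma smooth_on_bilinear:
  "bounded_bilinear P \<Longrightarrow> open S \<Longrightarrow> smooth_on S f \<Longrightarrow> smooth_on S g \<Longrightarrow>
    smooth_on S (\<lambda>x. P (f x) (g x))"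
  unfolding smooth_on_def using Ck_on_bilinear by blast

lemmas smooth_on_scaleR = smooth_on_bilinear[OF bounded_bilinear_scaleR]
lemmas smooth_on_mult = smooth_on_bilinear[OF bounded_bilinear_mult]
lemmas smooth_on_inner = smooth_on_bilinear[OF bounded_bilinear_inner]
lemmas smooth_on_vec_nth = smooth_on_linear_comp[OF bounded_linear_vec_nth]

lemma smooth_on_diff:
  "open S \<Longrightarrow> smooth_on S f \<Longrightarrow> smooth_on S g \<Longrightarrow> smooth_on S (\<lambda>x. f x - g x)"
  using smooth_on_add[where f = f and g = "\<lambda>x. - g x"]
    smooth_on_linear_comp[OF bounded_linear_minus[OF bounded_linear_ident], where f = g] by simp

lemma smooth_on_sum:
  "open S \<Longrightarrow> (\<And>i. i \<in> I \<Longrightarrow> smooth_on S (f i)) \<Longrightarrow> smooth_on S (\<lambda>x. \<Sum>i\<in>I. f i x)"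
  unfolding smooth_on_def by (simp add: Ck_on_sum)

lemma smooth_on_prod:
  fixes f :: "'i \<Rightarrow> 'a::real_normed_vector \<Rightarrow> real"
  assumes "open S"
  shows "(\<And>i. i \<in> I \<Longrightarrow> smooth_on S (f i)) \<Longrightarrow> smooth_on S (\<lambda>x. \<Prod>i\<in>I. f i x)"
  by (induction I rule: infinite_finite_induct)
     (auto intro: smooth_on_const smooth_on_mult[OF assms])

lemma smooth_on_compose:
  fixes f :: "'a::real_normed_vector \<Rightarrow> 'b::euclidean_space"
  assumes "open S" "open T" "f ` S \<subseteq> T" "smooth_on S f" "smooth_on T g"
  shows "smooth_on S (\<lambda>x. g (f x))"
  using assms Ck_on_compose unfolding smooth_on_def by blast

lemma smooth_on_differentiable: "smooth_on S f \<Longrightarrow> x \<in> S \<Longrightarrow> f differentiable (at x)"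
  unfolding smooth_on_def by (metis Ck_on.simps(2))

lemma smooth_on_has_derivative:
  "smooth_on S f \<Longrightarrow> x \<in> S \<Longrightarrow> (f has_derivative frechet_derivative f (at x)) (at x)"
  using smooth_on_differentiable frechet_derivative_works by blast

lemma smooth_on_continuous_on: "smooth_on S f \<Longrightarrow> continuous_on S f"
  unfolding smooth_on_def by (metis Ck_on.simps(1))

lemma smooth_on_frechet_derivative:
  "smooth_on S f \<Longrightarrow> smooth_on S (\<lambda>x. frechet_derivative f (at x) v)"
  unfolding smooth_on_def by (metis Ck_on.simps(2))

text \<open>Continuity and differentiability are tested at the points of \<open>S\<close> with
  derivatives of the ambient space, so any open neighbourhood decides. This glues smoothness on
  overlaps of charts and trivialisations to smoothness on a whole chart domain.\<close>

lemma smooth_on_local: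
  assumes "\<And>x. x \<in> S \<Longrightarrow> \<exists>T. open T \<and> x \<in> T \<and> smooth_on T f"
  shows "smooth_on S f"
proof -
  have "Ck_on n S f" if "\<And>x. x \<in> S \<Longrightarrow> \<exists>T. open T \<and> x \<in> T \<and> Ck_on n T f" for n
    using that
  proof (induction n arbitrary: f)
    case 0
    have "isCont f x" if x: "x \<in> S" for x
      using 0[OF x] continuous_on_eq_continuous_at by auto
    then show ?case by (simp add: continuous_at_imp_continuous_on)
  next
    case (Suc n)
    have "Ck_on n S (\<lambda>x. frechet_derivative f (at x) v)" for v
      by (rule Suc.IH) (use Suc.prems in fastforce)
    then show ?case using Suc.prems by fastforce
  qed
  then show ?thesis using assms unfolding smooth_on_def by meson
qed

lemma smooth_on_det:
  fixes M :: "'a::real_normed_vector \<Rightarrow> real ^ 'n ^ 'n"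
  assumes "open S" "\<And>i j. smooth_on S (\<lambda>x. M x $ i $ j)"
  shows "smooth_on S (\<lambda>x. det (M x))"
  unfolding det_def
  by (intro smooth_on_sum smooth_on_mult smooth_on_prod smooth_on_const assms)

text \<open>Up to constant factors, differentiation only shifts the exponent, so the induction has
  to run over all exponents at once.\<close>

lemma smooth_on_powr: "smooth_on {0<..} (\<lambda>x::real. x powr a)"
proof -
  have "Ck_on n {0<..} (\<lambda>x::real. x powr a)" for n
  proof (induction n arbitrary: a)
    case 0
    then show ?case by (auto intro!: continuous_intros)
  next
    case (Suc n)
    show ?case
    proof (rule Ck_on_SucI)
      show "((\<lambda>x. x powr a) has_derivative (\<lambda>v. v * (a * x powr (a - 1)))) (at x)"
        if "x \<in> {0<..}" for x :: real
        using has_real_derivative_powr[of x a] that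
        by (simp add: has_field_derivative_def mult_commute_abs)
      show "Ck_on n {0<..} (\<lambda>x::real. v * (a * x powr (a - 1)))" for v
        by (intro Ck_on_bilinear[OF bounded_bilinear_mult] Ck_on_const Suc.IH open_greaterThan)
    qed simp
  qed
  then show ?thesis by (simp add: smooth_on_def)
qed

lemma smooth_on_powr_comp:
  fixes f :: "'a::real_normed_vector \<Rightarrow> real"
  assumes "open S" "smooth_on S f" "\<And>x. x \<in> S \<Longrightarrow> 0 < f x"
  shows "smooth_on S (\<lambda>x. f x powr a)"
  by (rule smooth_on_compose[OF assms(1) _ _ assms(2) smooth_on_powr]) (use assms(3) in auto)

lemma smooth_on_inverse:
  fixes f :: "'a::real_normed_vector \<Rightarrow> real"
  assumes "open S" "smooth_on S f" "\<And>x. x \<in> S \<Longrightarrow> 0 < f x"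
  shows "smooth_on S (\<lambda>x. inverse (f x))"
  by (rule smooth_on_cong[OF assms(1) smooth_on_powr_comp[OF assms, of "-1"]])
     (simp_all add: powr_minus less_imp_le assms(3))

section \<open>A smooth step function on the real line\<close>

text \<open>The function \<open>flat 0\<close> is the classical \<open>exp (- 1 / x)\<close>
  continued by zero. The negative powers are included because its derivatives are linear
  combinations of these functions, which makes the whole family closed under
  differentiation.\<close>

definition flat :: "nat \<Rightarrow> real \<Rightarrow> real" where
  "flat j x = (if 0 < x then inverse x ^ j * exp (- inverse x) else 0)"

lemma flat_tendsto: "(flat j \<longlongrightarrow> 0) (at 0)"
proof -
  have "((\<lambda>x. inverse x ^ j * exp (- inverse x)) \<longlongrightarrow> (0::real)) (at_right 0)"
    using filterlim_compose[OF tendsto_power_div_exp_0 filterlim_inverse_at_top_right, of j]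
    by (simp add: exp_minus divide_inverse)
  then have "(flat j \<longlongrightarrow> 0) (at_right 0)"
    by (rule Lim_transform_eventually)
       (auto simp: flat_def eventually_at_filter)
  moreover have "(flat j \<longlongrightarrow> 0) (at_left 0)"
    by (rule Lim_transform_eventually[OF tendsto_const])
       (auto simp: flat_def eventually_at_filter)
  ultimately show ?thesis by (simp add: filterlim_split_at)
qed

lemma flat_has_derivative:
  "(flat j has_real_derivative flat (j + 2) x - real j * flat (j + 1) x) (at x)"
proof (rule linorder_cases[of x 0])
  assume x: "x < 0"
  have "((\<lambda>x. 0) has_real_derivative 0) (at x)" by simp
  then have "(flat j has_real_derivative 0) (at x)"
    by (rule has_field_derivative_transform_within_open[of _ _ _ "{..<0}"])
       (use x in \<open>auto simp: flat_def\<close>)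
  then show ?thesis using x by (simp add: flat_def)
next
  assume x: "x = 0"
  \<comment> \<open>The difference quotient of \<open>flat j\<close> at 0 is
    \<open>flat (j + 1)\<close>, whose limit there is already known.\<close>
  have "((\<lambda>h. (flat j (0 + h) - flat j 0) / h) \<longlongrightarrow> 0) (at 0)"
    by (rule Lim_transform_eventually[OF flat_tendsto[of "Suc j"]])
       (auto simp: flat_def eventually_at_filter divide_simps)
  then show ?thesis using x by (simp add: DERIV_def flat_def)
next
  assume x: "0 < x"
  have "((\<lambda>x. inverse x ^ j * exp (- inverse x)) has_real_derivative
      real j * inverse x ^ (j - 1) * (- (inverse x ^ 2)) * exp (- inverse x)
      + inverse x ^ j * (exp (- inverse x) * inverse x ^ 2)) (at x)"
    using x by (auto intro!: derivative_eq_intros simp: power2_eq_square)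
  also have "real j * inverse x ^ (j - 1) * (- (inverse x ^ 2)) * exp (- inverse x)
      + inverse x ^ j * (exp (- inverse x) * inverse x ^ 2)
      = flat (j + 2) x - real j * flat (j + 1) x"
    using x by (cases j) (simp_all add: flat_def power2_eq_square)
  finally show ?thesis
    by (rule has_field_derivative_transform_within_open[of _ _ _ "{0<..}"])
       (use x in \<open>auto simp: flat_def\<close>)
qed

lemma smooth_on_flat: "smooth_on UNIV (flat j)"
proof -
  have "Ck_on n UNIV (flat j)" for n
  proof (induction n arbitrary: j)
    case 0
    show ?case
      using flat_has_derivative by (auto intro!: continuous_at_imp_continuous_on DERIV_isCont)
  next
    case (Suc n)
    show ?case
    proof (rule Ck_on_SucI[OF open_UNIV])
      show "(flat j has_derivative (\<lambda>v. v * (flat (j + 2) x + (- real j) * flat (j + 1) x))) (at x)"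
        for x
        using flat_has_derivative[of j x]
        by (simp add: has_field_derivative_def mult_commute_abs)
      show "Ck_on n UNIV (\<lambda>x. v * (flat (j + 2) x + (- real j) * flat (j + 1) x))" for v
        by (intro Ck_on_bilinear[OF bounded_bilinear_mult] Ck_on_const Ck_on_add Suc.IH open_UNIV)
    qed
  qed
  then show ?thesis by (simp add: smooth_on_def)
qed

text \<open>The two summands of the denominator are positive for \<open>x < 2\<close> and for
  \<open>x > 1\<close> respectively, so the denominator never vanishes. There is no lower threshold
  because the argument will be a squared distance.\<close>

definition plateau :: "real \<Rightarrow> real" where
  "plateau x = flat 0 (2 - x) * inverse (flat 0 (2 - x) + flat 0 (x - 1))"

lemma plateau_eq_1: "x \<le> 1 \<Longrightarrow> plateau x = 1"
  and plateau_eq_0: "2 \<le> x \<Longrightarrow> plateau x = 0"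
  and plateau_nonneg: "0 \<le> plateau x"
  by (auto simp: plateau_def flat_def)

lemma smooth_on_plateau: "smooth_on UNIV plateau"
proof -
  have "smooth_on UNIV (\<lambda>x::real. 2 - x)" "smooth_on UNIV (\<lambda>x::real. x - 1)"
    by (intro smooth_on_diff smooth_on_const smooth_on_id open_UNIV)+
  then have "smooth_on UNIV (\<lambda>x. flat 0 (2 - x))" "smooth_on UNIV (\<lambda>x. flat 0 (x - 1))"
    using smooth_on_compose[OF open_UNIV open_UNIV subset_UNIV _ smooth_on_flat] by blast+
  then show ?thesis unfolding plateau_def
    by (intro smooth_on_mult smooth_on_inverse smooth_on_add open_UNIV)
       (auto simp: flat_def add_pos_nonneg)
qed

lemma smooth_on_snd:
  fixes f :: "'b::euclidean_space \<Rightarrow> 'c::real_normed_vector"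
    and T :: "'a::real_normed_vector set"
  assumes "open T" "open S" "smooth_on S f"
  shows "smooth_on (T \<times> S) (\<lambda>(t, y). f y)"
proof -
  have "smooth_on (T \<times> S) (\<lambda>p. f (snd p))"
    by (rule smooth_on_compose[OF open_Times[OF assms(1,2)] assms(2) _
          smooth_on_linear[OF bounded_linear_snd open_Times[OF assms(1,2)]] assms(3)]) auto
  then show ?thesis by (simp add: case_prod_beta')
qed

lemma smooth_on_slice:
  fixes f :: "'a::euclidean_space \<times> 'b::euclidean_space \<Rightarrow> 'c::real_normed_vector"
  assumes "open T" "open S" "smooth_on (T \<times> S) f" "t \<in> T"
  shows "smooth_on S (\<lambda>y. f (t, y))"
proof (rule smooth_on_compose[OF assms(2) open_Times[OF assms(1,2)] _ _ assms(3)])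
  have "smooth_on S (\<lambda>y. (t, 0) + (0, y) :: 'a \<times> 'b)"
    by (intro smooth_on_add smooth_on_const assms(2) smooth_on_linear
        bounded_linear_Pair bounded_linear_zero bounded_linear_ident)
  then show "smooth_on S (\<lambda>y. (t, y))" by simp
qed (use assms(4) in auto)

text \<open>A finite subcover leaves finitely many local constants. The sum of their absolute values
  dominates each of them and also makes sense for the empty cover, where a maximum would
  not.\<close>

lemma compact_local_bound:
  fixes P :: "real \<Rightarrow> 'a::topological_space \<Rightarrow> bool"
  assumes "compact K"
    and local: "\<And>x. x \<in> K \<Longrightarrow> \<exists>N C. open N \<and> x \<in> N \<and> (\<forall>y\<in>N. P C y)"
    and mono: "\<And>C C' y. P C y \<Longrightarrow> C \<le> C' \<Longrightarrow> P C' y"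
  shows "\<exists>C\<ge>0. \<forall>y\<in>K. P C y"
proof -
  obtain N C where NC: "\<And>x. x \<in> K \<Longrightarrow> open (N x) \<and> x \<in> N x \<and> (\<forall>y\<in>N x. P (C x) y)"
    using local by metis
  obtain F where F: "F \<subseteq> K" "finite F" "K \<subseteq> (\<Union>x\<in>F. N x)"
    using compactE_image[OF assms(1), of K N] NC by (metis (no_types, lifting) UN_I subsetI)
  have "P (\<Sum>x\<in>F. \<bar>C x\<bar>) y" if y: "y \<in> K" for y
  proof -
    obtain x where x: "x \<in> F" "y \<in> N x" using F(3) y by blast
    have "C x \<le> (\<Sum>x\<in>F. \<bar>C x\<bar>)"
      using member_le_sum[OF x(1), of "\<lambda>x. \<bar>C x\<bar>"] F(2) by simp
    then show ?thesis using mono NC x F(1) by blast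
  qed
  then show ?thesis by (intro exI[of _ "\<Sum>x\<in>F. \<bar>C x\<bar>"]) (simp add: sum_nonneg)
qed


section \<open>Positive definite matrices\<close>

definition posdef :: "real ^ 'm ^ 'm \<Rightarrow> bool" where
  "posdef G \<longleftrightarrow> (\<forall>v w. v \<bullet> (G *v w) = w \<bullet> (G *v v)) \<and> (\<forall>v. v \<noteq> 0 \<longrightarrow> 0 < v \<bullet> (G *v v))"

text \<open>The inverse matrix in the form of Cramer's rule: its entries are quotients of
  determinants, hence visibly smooth in the entries of \<open>G\<close>.\<close>

definition cramer_inv :: "real ^ 'm ^ 'm \<Rightarrow> real ^ 'm ^ 'm" where
  "cramer_inv G = (\<chi> j k. det (\<chi> i l. if l = j then axis k 1 $ i else G $ i $ l) / det G)"

definition orthonormalises :: "real ^ 'm ^ 'm \<Rightarrow> real ^ 'm ^ 'm \<Rightarrow> bool" where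
  "orthonormalises G P \<longleftrightarrow> (\<forall>i j. P $ i \<bullet> (G *v (P $ j)) = (if i = j then 1 else 0))"

lemma orthonormalises_iff: "orthonormalises G P \<longleftrightarrow> P ** G ** transpose P = mat 1"
proof -
  have "(P ** G ** transpose P) $ i $ j = P $ i \<bullet> (G *v (P $ j))" for i j
  proof -
    have "(P ** G ** transpose P) $ i $ j = (P ** (G ** transpose P)) $ i $ j"
      by (simp add: matrix_mul_assoc)
    also have "\<dots> = P $ i \<bullet> (G *v (P $ j))"
      by (simp add: matrix_matrix_mult_def matrix_vector_mult_def inner_vec_def transpose_def)
    finally show ?thesis .
  qed
  then show ?thesis by (simp add: orthonormalises_def vec_eq_iff mat_def)
qed

text \<open>Gram-Schmidt for the form of \<open>G\<close>. The induction builds orthonormal sets of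
  every size up to the dimension; a set that is still too small cannot span, so a further vector is
  always available.\<close>

lemma orthonormalises_exists:
  fixes G :: "real ^ 'm ^ 'm"
  assumes "posdef G"
  shows "\<exists>P. orthonormalises G P"
proof -
  let ?b = "\<lambda>v w. v \<bullet> (G *v w)"
  have sym: "?b v w = ?b w v" and pos: "v \<noteq> 0 \<Longrightarrow> 0 < ?b v v" for v w
    using assms by (auto simp: posdef_def)
  have ladd: "?b w (u - v) = ?b w u - ?b w v" for u v w
    by (simp add: matrix_vector_mult_diff_distrib inner_diff_right)
  have lsum: "?b w (\<Sum>u\<in>S. a u *\<^sub>R u) = (\<Sum>u\<in>S. a u * ?b w u)" for w S a
    by (induction S rule: infinite_finite_induct)
       (simp_all add: matrix_vector_right_distrib inner_add_right matrix_vector_mult_scaleR)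
  have "\<exists>S. finite S \<and> card S = n \<and> (\<forall>u\<in>S. \<forall>v\<in>S. ?b u v = (if u = v then 1 else 0))"
    if "n \<le> CARD('m)" for n
    using that
  proof (induction n)
    case 0
    then show ?case by (intro exI[of _ "{}"]) auto
  next
    case (Suc n)
    then obtain S where S: "finite S" "card S = n"
      "\<And>u v. u \<in> S \<Longrightarrow> v \<in> S \<Longrightarrow> ?b u v = (if u = v then 1 else 0)" by force
    have "span S \<noteq> UNIV"
    proof
      assume "span S = UNIV"
      then have "dim (UNIV :: (real ^ 'm) set) \<le> card S"
        using dim_le_card[of UNIV S] S(1) by simp
      then show False using S(2) Suc.prems by simp
    qed
    then obtain w where w: "w \<notin> span S" by auto
    \<comment> \<open>Subtracting the projection of \<open>w\<close> onto \<open>span S\<close>; the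
      difference is nonzero because \<open>w\<close> lies outside that span.\<close>
    define w' where "w' = w - (\<Sum>u\<in>S. ?b u w *\<^sub>R u)"
    have "w' \<noteq> 0"
    proof
      assume "w' = 0"
      then have "w = (\<Sum>u\<in>S. ?b u w *\<^sub>R u)" by (simp add: w'_def)
      then show False using w by (metis (no_types, lifting) span_base span_scale span_sum)
    qed
    have orth: "?b u w' = 0" if "u \<in> S" for u
    proof -
      have "?b u w' = ?b u w - (\<Sum>v\<in>S. ?b v w * ?b u v)" by (simp add: w'_def ladd lsum)
      also have "(\<Sum>v\<in>S. ?b v w * ?b u v) = (\<Sum>v\<in>S. if v = u then ?b u w else 0)"
        by (rule sum.cong) (auto simp: S(3) that)
      also have "\<dots> = ?b u w" using S(1) that by simp
      finally show ?thesis by simp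
    qed
    define z where "z = (1 / sqrt (?b w' w')) *\<^sub>R w'"
    have zz: "?b z z = 1"
      using pos[OF \<open>w' \<noteq> 0\<close>] by (simp add: z_def matrix_vector_mult_scaleR)
    have uz: "?b u z = 0" if "u \<in> S" for u
      using orth[OF that] by (simp add: z_def matrix_vector_mult_scaleR)
    have "z \<notin> S" using zz uz by force
    then show ?case using S zz uz sym by (intro exI[of _ "insert z S"]) auto
  qed
  from this[OF order_refl] obtain S where S: "finite S" "card S = CARD('m)"
    and orth: "\<forall>u\<in>S. \<forall>v\<in>S. ?b u v = (if u = v then 1 else 0)" by (elim exE conjE)
  obtain f where f: "bij_betw f (UNIV :: 'm set) S"
    using finite_same_card_bij[of "UNIV :: 'm set" S] S by auto
  then have f: "f i \<in> S" "f i = f j \<longleftrightarrow> i = j" for i j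
    by (auto simp: bij_betw_def inj_on_def)
  have "orthonormalises G (\<chi> i. f i)"
    unfolding orthonormalises_def vec_lambda_beta using orth f by metis
  then show ?thesis by blast
qed

text \<open>With \<open>P ** G ** transpose P = mat 1\<close> everything follows from matrix
  algebra: determinants give \<open>(det P)\<^sup>2 * det G = 1\<close>, and moving \<open>P\<close>
  to the other side identifies \<open>transpose P ** P\<close> as the inverse of \<open>G\<close>.
  The last claim is the Fourier expansion of \<open>v\<close> in the rows of
  \<open>P\<close>.\<close>

lemma
  assumes "orthonormalises G P"
  shows orthonormalises_det_pos: "0 < det G"
    and orthonormalises_cramer_inv: "transpose P ** P = cramer_inv G"
    and orthonormalises_expansion: "(\<Sum>i\<in>UNIV. (P $ i \<bullet> (G *v v)) *\<^sub>R P $ i) = v"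
proof -
  have PGP: "P ** G ** transpose P = mat 1" using assms by (simp add: orthonormalises_iff)
  then have "det P * det G * det P = 1" by (metis det_I det_mul det_transpose)
  then have "(det P)\<^sup>2 * det G = 1" by (simp add: power2_eq_square mult_ac)
  then show pos: "0 < det G"
    using zero_le_power2[of "det P"] by (smt (verit) mult_nonneg_nonpos)
  have "P ** (G ** transpose P) = mat 1" using PGP by (simp add: matrix_mul_assoc)
  then have "(G ** transpose P) ** P = mat 1" using matrix_left_right_inverse by blast
  then have GI: "G ** (transpose P ** P) = mat 1" by (simp add: matrix_mul_assoc)
  then have IG: "(transpose P ** P) ** G = mat 1" using matrix_left_right_inverse by blast
  show "transpose P ** P = cramer_inv G"
  proof -
    let ?H = "transpose P ** P"
    have "G *v column k ?H = axis k 1" for k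
    proof -
      have "G *v column k ?H = column k (G ** ?H)"
        by (simp add: vec_eq_iff column_def matrix_matrix_mult_def matrix_vector_mult_def)
      then show ?thesis by (simp add: GI vec_eq_iff column_def mat_def axis_def)
    qed
    then have "column k ?H = (\<chi> j. det (\<chi> i l. if l = j then axis k 1 $ i else G $ i $ l) / det G)"
      for k using cramer[of G "column k ?H" "axis k 1"] pos by simp
    then show ?thesis by (simp add: vec_eq_iff cramer_inv_def column_def)
  qed
  have "v = (transpose P ** P) *v (G *v v)" unfolding matrix_vector_mul_assoc IG by simp
  also have "\<dots> = transpose P *v (P *v (G *v v))"
    by (simp only: matrix_vector_mul_assoc matrix_mul_assoc)
  also have "\<dots> = (\<Sum>i\<in>UNIV. (P $ i \<bullet> (G *v v)) *\<^sub>R P $ i)"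
    by (simp add: vec_eq_iff matrix_vector_mult_def transpose_def inner_vec_def mult.commute)
  finally show "(\<Sum>i\<in>UNIV. (P $ i \<bullet> (G *v v)) *\<^sub>R P $ i) = v" by simp
qed

text \<open>The right-hand side no longer mentions \<open>P\<close>. A trace computed in an
  arbitrarily chosen orthonormal basis is thus independent of the choice and given by a formula
  smooth in \<open>G\<close>.\<close>

lemma orthonormalises_trace:
  assumes "orthonormalises G P"
  shows "(\<Sum>i\<in>UNIV. \<Sum>j\<in>UNIV. \<Sum>k\<in>UNIV. P $ i $ j * P $ i $ k * Q j k) =
    (\<Sum>j\<in>UNIV. \<Sum>k\<in>UNIV. cramer_inv G $ j $ k * Q j k)"
proof -
  have "cramer_inv G $ j $ k = (\<Sum>i\<in>UNIV. P $ i $ j * P $ i $ k)" for j k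
    unfolding orthonormalises_cramer_inv[OF assms, symmetric]
    by (simp add: matrix_matrix_mult_def transpose_def)
  then have "(\<Sum>j\<in>UNIV. \<Sum>k\<in>UNIV. cramer_inv G $ j $ k * Q j k)
    = (\<Sum>j\<in>UNIV. \<Sum>k\<in>UNIV. \<Sum>i\<in>UNIV. P $ i $ j * P $ i $ k * Q j k)"
    by (simp add: sum_distrib_right)
  also have "\<dots> = (\<Sum>j\<in>UNIV. \<Sum>i\<in>UNIV. \<Sum>k\<in>UNIV. P $ i $ j * P $ i $ k * Q j k)"
    by (rule sum.cong[OF refl], rule sum.swap)
  also have "\<dots> = (\<Sum>i\<in>UNIV. \<Sum>j\<in>UNIV. \<Sum>k\<in>UNIV. P $ i $ j * P $ i $ k * Q j k)"
    by (rule sum.swap)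
  finally show ?thesis by simp
qed

lemma smooth_on_cramer_inv:
  assumes "open S" "\<And>i j. smooth_on S (\<lambda>x. M x $ i $ j)" "\<And>x. x \<in> S \<Longrightarrow> 0 < det (M x)"
  shows "smooth_on S (\<lambda>x. cramer_inv (M x) $ j $ k)"
proof -
  have "smooth_on S (\<lambda>x. (\<chi> i l. if l = j then axis k 1 $ i else M x $ i $ l) $ a $ b)" for a b
    using assms(2) by (cases "b = j") (simp_all add: smooth_on_const)
  then have "smooth_on S (\<lambda>x. det (\<chi> i l. if l = j then axis k 1 $ i else M x $ i $ l))"
    by (rule smooth_on_det[OF assms(1)])
  then show ?thesis unfolding cramer_inv_def
    by (simp add: divide_inverse smooth_on_mult smooth_on_inverse smooth_on_det assms)
qed

section \<open>Charts, cutoff functions and tangent vectors\<close>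

context oriented_manifold
begin

lemma
  assumes "(U, c) \<in> A"
  shows chart_inv: "x \<in> U \<Longrightarrow> inv_into U c (c x) = x"
    and chart_inv_right: "y \<in> c ` U \<Longrightarrow> c (inv_into U c y) = y"
    and chart_inv_in: "y \<in> c ` U \<Longrightarrow> inv_into U c y \<in> U"
    and continuous_on_chart: "continuous_on U c"
    and continuous_on_chart_inv: "continuous_on (c ` U) (inv_into U c)"
  using chart_homeomorphism[OF assms]
  by (auto simp: homeomorphism_def f_inv_into_f inv_into_into)

lemma open_chart_image:
  assumes "(U, c) \<in> A" "open W" "W \<subseteq> U"
  shows "open (c ` W)"
proof -
  have "c ` W = inv_into U c -` W \<inter> c ` U"
    using assms chart_inv[OF assms(1)] by (force simp: subset_iff)
  then show ?thesis
    using continuous_on_chart_inv[OF assms(1)] chart_open[OF assms(1)] assms(2)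
    by (simp add: continuous_open_preimage Int_commute)
qed

lemma open_chart_preimage:
  assumes "(U, c) \<in> A" "open T"
  shows "open (U \<inter> c -` T)"
  using continuous_on_chart[OF assms(1)] chart_open[OF assms(1)] assms(2)
  by (simp add: continuous_open_preimage)

lemma chart_preimage_eq_image:
  assumes "(U, c) \<in> A" "T \<subseteq> c ` U"
  shows "U \<inter> c -` T = inv_into U c ` T"
proof (intro set_eqI iffI)
  fix x assume "x \<in> U \<inter> c -` T"
  then show "x \<in> inv_into U c ` T"
    by (intro image_eqI[of _ _ "c x"]) (simp_all add: chart_inv[OF assms(1)])
next
  fix x assume "x \<in> inv_into U c ` T"
  then obtain y where y: "y \<in> T" "x = inv_into U c y" by blast
  then have "y \<in> c ` U" using assms(2) by blast
  from chart_inv_right[OF assms(1) this] chart_inv_in[OF assms(1) this]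
  show "x \<in> U \<inter> c -` T" using y by simp
qed

lemma smooth_funD: "smooth_fun f \<Longrightarrow> (U, c) \<in> A \<Longrightarrow> smooth_on (c ` U) (f \<circ> inv_into U c)"
  unfolding smooth_fun_def by auto

lemma smooth_on_chart_change:
  assumes "(U, c) \<in> A" "(V, d) \<in> A" "open W" "W \<subseteq> U"
    and "smooth_on (c ` W) (f \<circ> inv_into U c)"
  shows "smooth_on (d ` (V \<inter> W)) (f \<circ> inv_into V d)"
proof (rule smooth_on_cong)
  have o: "open V" using chart_open assms by auto
  show op: "open (d ` (V \<inter> W))" using open_chart_image[OF assms(2)] o assms by auto
  have "smooth_on (d ` (V \<inter> W)) (c \<circ> inv_into V d)"
    using transition_smooth[OF assms(2,1)] assms(4) by (auto elim!: smooth_on_subset)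
  moreover have "(c \<circ> inv_into V d) ` d ` (V \<inter> W) \<subseteq> c ` W"
    using chart_inv[OF assms(2)] by auto
  ultimately show "smooth_on (d ` (V \<inter> W)) (\<lambda>y. (f \<circ> inv_into U c) ((c \<circ> inv_into V d) y))"
    using assms open_chart_image by (intro smooth_on_compose[OF op _ _ _ assms(5)]) (auto simp: comp_def)
  show "(f \<circ> inv_into U c) ((c \<circ> inv_into V d) y) = (f \<circ> inv_into V d) y"
    if "y \<in> d ` (V \<inter> W)" for y
    using that chart_inv[OF assms(2)] chart_inv[OF assms(1)] assms(4) by auto
qed

text \<open>\<open>W\<close> and the complement of \<open>S\<close> are open and cover the manifold;
  \<open>f\<close> is smooth on the first by change of charts and zero on the second. Such
  extensions are indispensable because tangent vectors act only on globally smooth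
  functions.\<close>

lemma smooth_fun_extend:
  assumes "(U, c) \<in> A" "open W" "W \<subseteq> U" "closed S" "S \<subseteq> W"
    and f: "smooth_on (c ` W) (f \<circ> inv_into U c)" and 0: "\<And>x. x \<notin> S \<Longrightarrow> f x = 0"
  shows "smooth_fun f"
  unfolding smooth_fun_def
proof clarify
  fix V d assume Vd: "(V, d) \<in> A"
  show "smooth_on (d ` V) (f \<circ> inv_into V d)"
  proof (rule smooth_on_local)
    fix y assume "y \<in> d ` V"
    then obtain x where x: "x \<in> V" "y = d x" by auto
    have o: "open V" using chart_open Vd by auto
    show "\<exists>T. open T \<and> y \<in> T \<and> smooth_on T (f \<circ> inv_into V d)"
    proof (cases "x \<in> W")
      case True
      then show ?thesis
        using smooth_on_chart_change[OF assms(1) Vd assms(2,3) f] x o assms(2)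
          open_chart_image[OF Vd, of "V \<inter> W"] by blast
    next
      case False
      have op: "open (d ` (V - S))" using open_chart_image[OF Vd] o assms(4) by auto
      have "smooth_on (d ` (V - S)) (f \<circ> inv_into V d)"
        by (rule smooth_on_cong[OF op smooth_on_const[of _ 0]])
           (use chart_inv[OF Vd] 0 in auto)
      then show ?thesis using op x False assms(5) by blast
    qed
  qed
qed

lemma smooth_fun_mult_extend:
  assumes "(U, c) \<in> A" "open W" "W \<subseteq> U" "closed S" "S \<subseteq> W"
    and "smooth_fun \<rho>" "\<And>x. x \<notin> S \<Longrightarrow> \<rho> x = 0" "smooth_on (c ` W) (f \<circ> inv_into U c)"
  shows "smooth_fun (\<lambda>x. \<rho> x * f x)"
proof (rule smooth_fun_extend[OF assms(1-5)])
  have "smooth_on (c ` W) (\<rho> \<circ> inv_into U c)"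
    using smooth_funD[OF assms(6,1)] assms(3) by (auto elim!: smooth_on_subset)
  then show "smooth_on (c ` W) ((\<lambda>x. \<rho> x * f x) \<circ> inv_into U c)"
    using smooth_on_mult[OF open_chart_image[OF assms(1-3)] _ assms(8)] by (simp add: comp_def)
qed (use assms(7) in auto)

text \<open>Three concentric coordinate balls do the work: on the inner one \<open>W\<close> the
  function is 1, outside the middle one \<open>S\<close> it is 0, and the outer one \<open>D\<close>
  is a connected relatively compact domain of the kind that \<open>variation_domain\<close> asks for
  in the non-compact case.\<close>

lemma cutoff:
  assumes Uc: "(U, c) \<in> A" and x: "x \<in> U" "x \<in> N" "open N"
  obtains \<rho> W S D where "smooth_fun \<rho>" "open W" "x \<in> W" "W \<subseteq> S" "compact S" "S \<subseteq> D"
    "open D" "connected D" "compact (closure D)" "D \<subseteq> U \<inter> N"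
    "\<And>y. y \<in> W \<Longrightarrow> \<rho> y = 1" "\<And>y. y \<notin> S \<Longrightarrow> \<rho> y = 0" "\<And>y. (0::real) \<le> \<rho> y"
proof -
  let ?j = "inv_into U c"
  have oU: "open U" using chart_open Uc by auto
  have "open (c ` (U \<inter> N))" using open_chart_image[OF Uc, of "U \<inter> N"] oU x by auto
  then obtain e where e: "0 < e" "cball (c x) e \<subseteq> c ` (U \<inter> N)"
    using open_contains_cball x by (metis IntI imageI)
  \<comment> \<open>The closed ball of the largest radius \<open>3 * r\<close> must still lie in the
    image of \<open>U \<inter> N\<close>, so that its preimage is compact.\<close>
  define r where "r = e / 3"
  have r: "0 < r" "cball (c x) (3 * r) \<subseteq> c ` (U \<inter> N)" using e by (auto simp: r_def)
  have sub: "cball (c x) (s * r) \<subseteq> c ` U" if "s \<le> 3" for s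
  proof -
    have "s * r \<le> 3 * r" using that r(1) by simp
    then have "cball (c x) (s * r) \<subseteq> cball (c x) (3 * r)" by (rule subset_cball)
    then show ?thesis using r(2) by blast
  qed
  have bsub: "ball (c x) (s * r) \<subseteq> c ` U" if "s \<le> 3" for s
    using sub[OF that] ball_subset_cball by blast
  define W where "W = U \<inter> c -` ball (c x) (1 * r)"
  define S where "S = U \<inter> c -` cball (c x) (2 * r)"
  define D where "D = U \<inter> c -` ball (c x) (3 * r)"
  \<comment> \<open>As preimages under the chart the sets are seen to be open; as images of balls
    under its inverse they inherit compactness and connectedness.\<close>
  have Seq: "S = ?j ` cball (c x) (2 * r)"
    unfolding S_def by (rule chart_preimage_eq_image[OF Uc sub]) simp
  have Deq: "D = ?j ` ball (c x) (3 * r)"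
    unfolding D_def by (rule chart_preimage_eq_image[OF Uc bsub]) simp
  have cont: "continuous_on T ?j" if "T \<subseteq> c ` U" for T
    using continuous_on_chart_inv[OF Uc] that continuous_on_subset by blast
  have cS: "compact S" unfolding Seq
    by (rule compact_continuous_image[OF cont[OF sub]]) auto
  have cD: "compact (?j ` cball (c x) (3 * r))"
    by (rule compact_continuous_image[OF cont[OF sub]]) auto
  have "closure D \<subseteq> ?j ` cball (c x) (3 * r)"
    unfolding Deq using compact_imp_closed[OF cD] by (intro closure_minimal) auto
  then have clD: "compact (closure D)"
    using cD compact_Int_closed[of _ "closure D"] closed_closure by (metis inf.absorb2)
  have conD: "connected D" unfolding Deq
    by (rule connected_continuous_image[OF cont[OF bsub]]) auto
  have DN: "D \<subseteq> U \<inter> N"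
  proof
    fix z assume z: "z \<in> D"
    then have "c z \<in> c ` (U \<inter> N)" using r(2) ball_subset_cball by (auto simp: D_def)
    then obtain w where w: "w \<in> U \<inter> N" "c z = c w" by auto
    have "z = w" using chart_inv[OF Uc] w z unfolding D_def by (metis IntD1)
    then show "z \<in> U \<inter> N" using w by simp
  qed
  \<comment> \<open>The squared distance is used because it is smooth at the centre as well. The
    step ends at squared ratio 2, well inside the squared ratio 4 on the boundary of
    \<open>S\<close>.\<close>
  define b where "b y = plateau ((y - c x) \<bullet> (y - c x) * inverse (r\<^sup>2))" for y
  define \<rho> where "\<rho> z = (if z \<in> U then b (c z) else 0)" for z
  have arg: "(y - c x) \<bullet> (y - c x) = (dist (c x) y)\<^sup>2" for y
    by (simp add: dist_norm power2_norm_eq_inner norm_minus_commute flip: power2_norm_eq_inner)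
  have \<rho>0: "\<rho> z = 0" if "z \<notin> S" for z
  proof (cases "z \<in> U")
    case True
    then have "2 * r \<le> dist (c x) (c z)" using that by (simp add: S_def)
    then have "(2 * r)\<^sup>2 \<le> (dist (c x) (c z))\<^sup>2" using r(1) by (intro power_mono) auto
    then have "4 * r\<^sup>2 \<le> (dist (c x) (c z))\<^sup>2" by (simp add: power_mult_distrib)
    then have "2 * r\<^sup>2 \<le> (dist (c x) (c z))\<^sup>2" using zero_le_power2[of r] by linarith
    then have "2 \<le> (dist (c x) (c z))\<^sup>2 * inverse (r\<^sup>2)"
      using r(1) by (simp add: field_simps)
    then show ?thesis by (simp add: \<rho>_def b_def arg plateau_eq_0)
  qed (simp add: \<rho>_def)
  have \<rho>1: "\<rho> z = 1" if "z \<in> W" for z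
  proof -
    have "(dist (c x) (c z))\<^sup>2 \<le> r\<^sup>2" using that by (intro power_mono) (auto simp: W_def)
    then have "(dist (c x) (c z))\<^sup>2 * inverse (r\<^sup>2) \<le> 1" using r(1) by (simp add: field_simps)
    then show ?thesis using that by (simp add: W_def \<rho>_def b_def arg plateau_eq_1)
  qed
  have sb: "smooth_on UNIV b"
  proof -
    have "smooth_on UNIV (\<lambda>y. (y - c x) \<bullet> (y - c x) * inverse (r\<^sup>2))"
      by (intro smooth_on_mult smooth_on_inner smooth_on_diff smooth_on_id smooth_on_const open_UNIV)
    from smooth_on_compose[OF open_UNIV open_UNIV subset_UNIV this smooth_on_plateau]
    show ?thesis by (simp add: b_def[abs_def])
  qed
  have "smooth_fun \<rho>"
  proof (rule smooth_fun_extend[OF Uc oU order_refl compact_imp_closed[OF cS]])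
    show "smooth_on (c ` U) (\<rho> \<circ> ?j)"
    proof (rule smooth_on_cong[OF _ smooth_on_subset[OF sb subset_UNIV]])
      show "open (c ` U)" using chart_open Uc by auto
      show "b y = (\<rho> \<circ> ?j) y" if "y \<in> c ` U" for y
        using chart_inv_right[OF Uc that] chart_inv_in[OF Uc that] by (simp add: \<rho>_def)
    qed
  qed (use \<rho>0 in \<open>auto simp: S_def\<close>)
  moreover have "open W" "open D" unfolding W_def D_def
    by (rule open_chart_preimage[OF Uc]; simp)+
  moreover have "x \<in> W" "W \<subseteq> S" "S \<subseteq> D" using r(1) x by (auto simp: W_def S_def D_def)
  moreover have "0 \<le> \<rho> z" for z by (simp add: \<rho>_def b_def plateau_nonneg)
  ultimately show ?thesis using that cS conD clD DN \<rho>0 \<rho>1 by blast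
qed

lemma coord_vec_apply:
  "smooth_fun f \<Longrightarrow> coord_vec U c x v f = frechet_derivative (f \<circ> inv_into U c) (at (c x)) v"
  by (simp add: coord_vec_def)

lemma smooth_fun_has_derivative:
  assumes "smooth_fun f" "(U, c) \<in> A" "x \<in> U"
  shows "((f \<circ> inv_into U c) has_derivative (\<lambda>v. coord_vec U c x v f)) (at (c x))"
  using smooth_on_has_derivative[OF smooth_funD[OF assms(1,2)], of "c x"] assms
  by (simp add: coord_vec_apply)

lemma coord_vec_linear:
  assumes "(U, c) \<in> A" "x \<in> U"
  shows "coord_vec U c x (a *\<^sub>R v + b *\<^sub>R w) = (\<lambda>f. a * coord_vec U c x v f + b * coord_vec U c x w f)"
proof
  fix f show "coord_vec U c x (a *\<^sub>R v + b *\<^sub>R w) f = a * coord_vec U c x v f + b * coord_vec U c x w f"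
  proof (cases "smooth_fun f")
    case True
    have "linear (\<lambda>v. coord_vec U c x v f)"
      using smooth_fun_has_derivative[OF True assms] has_derivative_linear by blast
    from linear_add[OF this] linear_cmul[OF this] show ?thesis by simp
  qed (simp add: coord_vec_def)
qed

lemma coord_vec_sum:
  assumes "(U, c) \<in> A" "x \<in> U" "finite I"
  shows "coord_vec U c x (\<Sum>i\<in>I. a i *\<^sub>R v i) = (\<lambda>f. \<Sum>i\<in>I. a i * coord_vec U c x (v i) f)"
  using assms(3)
proof (induction I)
  case empty
  then show ?case using coord_vec_linear[OF assms(1,2), of 0 0 0 0] by simp
next
  case (insert i I)
  then show ?case
    using coord_vec_linear[OF assms(1,2), of "a i" "v i" 1 "\<Sum>i\<in>I. a i *\<^sub>R v i"] by simp
qed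

lemma coord_vec_tangent: "(U, c) \<in> A \<Longrightarrow> x \<in> U \<Longrightarrow> coord_vec U c x v \<in> tangent_space x"
  unfolding tangent_space_def by blast

text \<open>The chain rule for the transition map; on functions that are not smooth both sides are
  zero by convention. It lets every tangent vector at \<open>x\<close> be written in any chart
  around \<open>x\<close>.\<close>

lemma coord_vec_change:
  assumes "(U, c) \<in> A" "(V, d) \<in> A" "x \<in> U \<inter> V"
  shows "coord_vec V d x v =
    coord_vec U c x (frechet_derivative (c \<circ> inv_into V d) (at (d x)) v)"
proof
  fix f
  let ?\<tau> = "c \<circ> inv_into V d"
  show "coord_vec V d x v f = coord_vec U c x (frechet_derivative ?\<tau> (at (d x)) v) f"
  proof (cases "smooth_fun f")
    case True
    have o: "open (d ` (V \<inter> U))"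
      using open_chart_image[OF assms(2), of "V \<inter> U"] chart_open assms by auto
    have "(?\<tau> has_derivative frechet_derivative ?\<tau> (at (d x))) (at (d x))"
      using smooth_on_has_derivative[OF transition_smooth[OF assms(2,1)], of "d x"] assms(3) by auto
    moreover have "((f \<circ> inv_into U c) has_derivative (\<lambda>v. coord_vec U c x v f)) (at (?\<tau> (d x)))"
      using smooth_fun_has_derivative[OF True assms(1)] chart_inv[OF assms(2)] assms(3) by auto
    ultimately have "((\<lambda>y. (f \<circ> inv_into U c) (?\<tau> y)) has_derivative
        (\<lambda>v. coord_vec U c x (frechet_derivative ?\<tau> (at (d x)) v) f)) (at (d x))"
      by (rule has_derivative_compose)
    then have "((f \<circ> inv_into V d) has_derivative
        (\<lambda>v. coord_vec U c x (frechet_derivative ?\<tau> (at (d x)) v) f)) (at (d x))"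
    proof (rule has_derivative_transform_within_open[OF _ o])
      show "d x \<in> d ` (V \<inter> U)" using assms(3) by auto
    qed (use chart_inv[OF assms(2)] chart_inv[OF assms(1)] in auto)
    moreover have "((f \<circ> inv_into V d) has_derivative (\<lambda>v. coord_vec V d x v f)) (at (d x))"
      using smooth_fun_has_derivative[OF True assms(2)] assms(3) by auto
    ultimately have "(\<lambda>v. coord_vec U c x (frechet_derivative ?\<tau> (at (d x)) v) f) =
        (\<lambda>v. coord_vec V d x v f)"
      by (rule has_derivative_unique)
    from fun_cong[OF this, of v] show ?thesis by (rule sym)
  qed (simp add: coord_vec_def)
qed

lemma tangent_spaceE:
  assumes "\<xi> \<in> tangent_space x" "(U, c) \<in> A" "x \<in> U"
  obtains v where "\<xi> = coord_vec U c x v"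
  using assms coord_vec_change[OF assms(2)] unfolding tangent_space_def by blast

text \<open>The tangent vector is tested on the \<open>i\<close>-th coordinate function, cut off to
  a global smooth function without being changed near \<open>x\<close>; this returns
  \<open>v $ i\<close>. The injectivity is what makes the Gram matrix positive definite.\<close>

lemma coord_vec_eq_0_imp:
  assumes Uc: "(U, c) \<in> A" "x \<in> U" and 0: "coord_vec U c x v = (\<lambda>f. 0)"
  shows "v = 0"
proof (rule vec_eq_iff[THEN iffD2], rule allI)
  fix i
  obtain \<rho> W S D where \<rho>: "smooth_fun \<rho>" "open W" "x \<in> W" "W \<subseteq> S" "compact S" "S \<subseteq> D"
    "D \<subseteq> U \<inter> UNIV" "\<And>y. y \<in> W \<Longrightarrow> \<rho> y = 1" "\<And>y. y \<notin> S \<Longrightarrow> \<rho> y = 0"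
    using cutoff[OF Uc UNIV_I open_UNIV] by metis
  have oc: "open U" "open (c ` U)" using chart_open[OF Uc(1)] by auto
  have "smooth_on (c ` U) ((\<lambda>z. c z $ i) \<circ> inv_into U c)"
  proof (rule smooth_on_cong[OF oc(2) smooth_on_linear[OF bounded_linear_vec_nth oc(2)]])
    show "y $ i = ((\<lambda>z. c z $ i) \<circ> inv_into U c) y" if "y \<in> c ` U" for y
      using chart_inv_right[OF Uc(1) that] by simp
  qed
  then have sm: "smooth_fun (\<lambda>z. \<rho> z * c z $ i)" (is "smooth_fun ?f")
    using \<rho>(7,9)  \<open>S \<subseteq> D\<close>
    by (intro smooth_fun_mult_extend[OF Uc(1) oc(1) order_refl compact_imp_closed[OF \<rho>(5)] _ \<rho>(1)]) auto
  have "((\<lambda>y. y $ i) has_derivative (\<lambda>v. v $ i)) (at (c x))"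
    by (rule bounded_linear_imp_has_derivative[OF bounded_linear_vec_nth])
  then have "((?f \<circ> inv_into U c) has_derivative (\<lambda>v. v $ i)) (at (c x))"
  proof (rule has_derivative_transform_within_open)
    show "open (c ` W)" using \<rho> open_chart_image[OF Uc(1)] by auto
    show "y $ i = (?f \<circ> inv_into U c) y" if "y \<in> c ` W" for y
      using that \<rho> chart_inv[OF Uc(1)] by (auto simp: subset_iff)
  qed (use \<rho> in auto)
  then have "(\<lambda>v. coord_vec U c x v ?f) = (\<lambda>v. v $ i)"
    by (rule has_derivative_unique[OF smooth_fun_has_derivative[OF sm Uc]])
  then have "coord_vec U c x v ?f = v $ i" by (rule fun_cong)
  then show "v $ i = 0 $ i" using 0 by simp
qed


section \<open>Smooth one-parameter families of functions\<close>

text \<open>Joint smoothness on the product of an interval with the manifold, tested in charts of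
  the second factor. Smoothness in each variable separately would not yield time derivatives that
  are locally bounded.\<close>

definition smooth_family :: "real \<Rightarrow> (real \<Rightarrow> 'a \<Rightarrow> real) \<Rightarrow> bool" where
  "smooth_family \<epsilon> f \<longleftrightarrow>
     (\<forall>(U, c)\<in>A. smooth_on ({-\<epsilon><..<\<epsilon>} \<times> c ` U) (\<lambda>(t, y). f t (inv_into U c y)))"

lemma open_time_chart:
  "(U, c) \<in> A \<Longrightarrow> open W \<Longrightarrow> W \<subseteq> U \<Longrightarrow> open ({-\<epsilon><..<\<epsilon>::real} \<times> c ` W)"
  by (intro open_Times open_chart_image) auto

lemma smooth_familyD:
  "smooth_family \<epsilon> f \<Longrightarrow> (U, c) \<in> A \<Longrightarrow>
    smooth_on ({-\<epsilon><..<\<epsilon>} \<times> c ` U) (\<lambda>(t, y). f t (inv_into U c y))"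
  unfolding smooth_family_def by auto

lemma smooth_familyI:
  "(\<And>U c. (U, c) \<in> A \<Longrightarrow> open ({-\<epsilon><..<\<epsilon>} \<times> c ` U) \<Longrightarrow>
      smooth_on ({-\<epsilon><..<\<epsilon>} \<times> c ` U) (\<lambda>p. f (fst p) (inv_into U c (snd p)))) \<Longrightarrow>
    smooth_family \<epsilon> f"
  unfolding smooth_family_def using open_time_chart chart_open
  by (fastforce simp: case_prod_beta')

lemma smooth_familyD':
  "smooth_family \<epsilon> f \<Longrightarrow> (U, c) \<in> A \<Longrightarrow>
    smooth_on ({-\<epsilon><..<\<epsilon>} \<times> c ` U) (\<lambda>p. f (fst p) (inv_into U c (snd p)))"
  using smooth_familyD[of \<epsilon> f U c] by (simp add: case_prod_beta')

lemma smooth_family_mono: "smooth_family \<epsilon> f \<Longrightarrow> \<delta> \<le> \<epsilon> \<Longrightarrow> smooth_family \<delta> f"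
  unfolding smooth_family_def by (fastforce elim!: smooth_on_subset)

lemma smooth_family_cong:
  assumes "smooth_family \<epsilon> f" "\<And>t x. \<bar>t\<bar> < \<epsilon> \<Longrightarrow> f t x = f' t x"
  shows "smooth_family \<epsilon> f'"
proof (rule smooth_familyI)
  fix U c assume Uc: "(U, c) \<in> A" and op: "open ({-\<epsilon><..<\<epsilon>} \<times> c ` U)"
  show "smooth_on ({-\<epsilon><..<\<epsilon>} \<times> c ` U) (\<lambda>p. f' (fst p) (inv_into U c (snd p)))"
    by (rule smooth_on_cong[OF op smooth_familyD'[OF assms(1) Uc]]) (auto intro!: assms(2))
qed

lemma smooth_family_static: "smooth_fun f \<Longrightarrow> smooth_family \<epsilon> (\<lambda>t. f)"
proof (rule smooth_familyI)
  fix U c assume f: "smooth_fun f" and Uc: "(U, c) \<in> A"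
  have "open (c ` U)" using chart_open[OF Uc] by simp
  from smooth_on_snd[OF open_greaterThanLessThan this smooth_funD[OF f Uc]]
  show "smooth_on ({-\<epsilon><..<\<epsilon>} \<times> c ` U) (\<lambda>p. f (inv_into U c (snd p)))"
    by (simp add: case_prod_beta')
qed

lemma smooth_family_time: "smooth_family \<epsilon> (\<lambda>t x. t)"
  by (rule smooth_familyI) (rule smooth_on_linear[OF bounded_linear_fst])

lemma smooth_family_const: "smooth_family \<epsilon> (\<lambda>t x. a)"
  by (rule smooth_familyI) (rule smooth_on_const)

lemma smooth_family_add:
  "smooth_family \<epsilon> f \<Longrightarrow> smooth_family \<epsilon> f' \<Longrightarrow> smooth_family \<epsilon> (\<lambda>t x. f t x + f' t x)"
  by (rule smooth_familyI) (intro smooth_on_add smooth_familyD')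

lemma smooth_family_mult:
  "smooth_family \<epsilon> f \<Longrightarrow> smooth_family \<epsilon> f' \<Longrightarrow> smooth_family \<epsilon> (\<lambda>t x. f t x * f' t x)"
  by (rule smooth_familyI) (intro smooth_on_mult smooth_familyD')

lemma smooth_family_powr:
  assumes "smooth_family \<epsilon> f" "\<And>t x. \<bar>t\<bar> < \<epsilon> \<Longrightarrow> 0 < f t x"
  shows "smooth_family \<epsilon> (\<lambda>t x. f t x powr a)"
  by (rule smooth_familyI)
     (auto intro!: smooth_on_powr_comp[OF _ smooth_familyD'] assms)

lemma smooth_family_slice:
  assumes "smooth_family \<epsilon> f" "\<bar>t\<bar> < \<epsilon>"
  shows "smooth_fun (f t)"
  unfolding smooth_fun_def
proof clarify
  fix U c assume Uc: "(U, c) \<in> A"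
  show "smooth_on (c ` U) (f t \<circ> inv_into U c)"
    using smooth_on_slice[OF open_greaterThanLessThan _ smooth_familyD[OF assms(1) Uc], of t]
      chart_open[OF Uc] assms(2) by (auto simp: comp_def abs_less_iff)
qed

lemma smooth_fun_mult: "smooth_fun f \<Longrightarrow> smooth_fun f' \<Longrightarrow> smooth_fun (\<lambda>x. f x * f' x)"
  using smooth_family_mult[of 1 "\<lambda>t. f" "\<lambda>t. f'", THEN smooth_family_slice, of 0]
    smooth_family_static by auto

lemma smooth_fun_const: "smooth_fun (\<lambda>x. a)"
  using smooth_family_const[THEN smooth_family_slice, of 0 1] by simp

text \<open>The spatial derivative of a time slice is the joint derivative in the direction
  \<open>(0, v)\<close>. Derivatives of a family along coordinate vectors are therefore again smooth
  in time and position.\<close>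

lemma coord_vec_joint:
  fixes t \<epsilon> :: real
  assumes Uc: "(U, c) \<in> A" and W: "open W" "W \<subseteq> U" "x \<in> W" and t: "\<bar>t\<bar> < \<epsilon>"
    and F: "smooth_on ({-\<epsilon><..<\<epsilon>} \<times> c ` W) F" and f: "smooth_fun f"
    and eq: "\<And>y. y \<in> c ` W \<Longrightarrow> f (inv_into U c y) = F (t, y)"
  shows "coord_vec U c x v f = frechet_derivative F (at (t, c x)) (0, v)"
proof -
  have "(F has_derivative frechet_derivative F (at (t, c x))) (at (t, c x))"
    using t W by (intro smooth_on_has_derivative[OF F]) auto
  then have "((\<lambda>y. F (t, y)) has_derivative (\<lambda>v. frechet_derivative F (at (t, c x)) (0, v))) (at (c x))"
    by (rule has_derivative_compose[rotated]) (auto intro!: derivative_eq_intros)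
  then have "((f \<circ> inv_into U c) has_derivative (\<lambda>v. frechet_derivative F (at (t, c x)) (0, v))) (at (c x))"
    by (rule has_derivative_transform_within_open[OF _ open_chart_image[OF Uc W(1,2)]])
       (use W(3) eq in auto)
  from has_derivative_unique[OF smooth_fun_has_derivative[OF f Uc] this] W(2,3)
  show ?thesis by (auto dest: fun_cong)
qed

lemma coord_vec_family:
  assumes "smooth_family \<epsilon> f" "(U, c) \<in> A" "x \<in> U" "\<bar>t\<bar> < \<epsilon>"
  shows "coord_vec U c x v (f t) =
    frechet_derivative (\<lambda>(t, y). f t (inv_into U c y)) (at (t, c x)) (0, v)"
  using chart_open[OF assms(2)]
  by (intro coord_vec_joint[OF assms(2) _ order_refl assms(3,4) smooth_familyD[OF assms(1,2)]
        smooth_family_slice[OF assms(1,4)]]) auto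

lemma tangent_mult:
  assumes "\<xi> \<in> tangent_space x" "smooth_fun f" "smooth_fun f'"
  shows "\<xi> (\<lambda>x. f x * f' x) = f x * \<xi> f' + f' x * \<xi> f"
proof -
  obtain U c where Uc: "(U, c) \<in> A" "x \<in> U" using charts_cover by blast
  obtain v where v: "\<xi> = coord_vec U c x v" by (rule tangent_spaceE[OF assms(1) Uc])
  have "((\<lambda>y. (f \<circ> inv_into U c) y * (f' \<circ> inv_into U c) y) has_derivative
      (\<lambda>v. (f \<circ> inv_into U c) (c x) * coord_vec U c x v f' + coord_vec U c x v f * (f' \<circ> inv_into U c) (c x)))
      (at (c x))"
    by (rule has_derivative_mult[OF smooth_fun_has_derivative[OF assms(2) Uc]
          smooth_fun_has_derivative[OF assms(3) Uc]])
  then have "(((\<lambda>x. f x * f' x) \<circ> inv_into U c) has_derivative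
      (\<lambda>v. f x * coord_vec U c x v f' + coord_vec U c x v f * f' x)) (at (c x))"
    by (simp add: comp_def chart_inv[OF Uc])
  from fun_cong[OF has_derivative_unique[OF
        smooth_fun_has_derivative[OF smooth_fun_mult[OF assms(2,3)] Uc] this], of v]
  show ?thesis by (simp add: v mult.commute)
qed

lemma tangent_const:
  assumes "\<xi> \<in> tangent_space x"
  shows "\<xi> (\<lambda>x. a) = 0"
proof -
  obtain U c where Uc: "(U, c) \<in> A" "x \<in> U" using charts_cover by blast
  obtain v where v: "\<xi> = coord_vec U c x v" by (rule tangent_spaceE[OF assms(1) Uc])
  have "(((\<lambda>x. a) \<circ> inv_into U c) has_derivative (\<lambda>v. 0)) (at (c x))"
    by (simp add: comp_def)
  from has_derivative_unique[OF smooth_fun_has_derivative[OF smooth_fun_const Uc] this]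
  show ?thesis unfolding v by (rule fun_cong)
qed

lemma smooth_on_coord_vec_family:
  assumes "smooth_family \<epsilon> f" "(U, c) \<in> A"
  shows "smooth_on ({-\<epsilon><..<\<epsilon>} \<times> c ` U)
    (\<lambda>p. coord_vec U c (inv_into U c (snd p)) v (f (fst p)))"
proof (rule smooth_on_cong[OF _ smooth_on_frechet_derivative[OF smooth_familyD[OF assms], of "(0, v)"]])
  show "open ({-\<epsilon><..<\<epsilon>} \<times> c ` U)" using open_time_chart[OF assms(2)] chart_open assms by auto
qed (use chart_inv_in[OF assms(2)] chart_inv_right[OF assms(2)] coord_vec_family[OF assms] in auto)

lemma smooth_fun_continuous:
  assumes "smooth_fun f"
  shows "continuous_on UNIV f"
proof (rule continuous_at_imp_continuous_on, rule ballI)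
  fix x
  obtain U c where Uc: "(U, c) \<in> A" "x \<in> U" using charts_cover by blast
  have "continuous_on U (\<lambda>z. (f \<circ> inv_into U c) (c z))"
    by (rule continuous_on_compose2[OF smooth_on_continuous_on[OF smooth_funD[OF assms Uc(1)]]
          continuous_on_chart[OF Uc(1)]]) auto
  then have "continuous_on U f"
    by (rule continuous_on_eq) (simp add: chart_inv[OF Uc(1)])
  then show "isCont f x" using Uc chart_open continuous_on_eq_continuous_at by blast
qed

lemma smooth_family_has_derivative:
  assumes "smooth_family \<epsilon> f" "\<bar>t\<bar> < \<epsilon>" "(U, c) \<in> A" "x \<in> U"
  shows "((\<lambda>t. f t x) has_real_derivative
    frechet_derivative (\<lambda>(t, y). f t (inv_into U c y)) (at (t, c x)) (1, 0)) (at t)"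
proof -
  let ?F = "\<lambda>(t, y). f t (inv_into U c y)" and ?D = "\<lambda>t. frechet_derivative (\<lambda>(t, y). f t (inv_into U c y)) (at (t, c x))"
  have d: "(?F has_derivative ?D t) (at (t, c x))"
    using smooth_on_has_derivative[OF smooth_familyD[OF assms(1,3)], of "(t, c x)"] assms
    by (auto simp: abs_less_iff)
  then have "((\<lambda>s. ?F (s, c x)) has_derivative (\<lambda>s. ?D t (s, 0))) (at t)"
    by (rule has_derivative_compose[rotated]) (auto intro!: derivative_eq_intros)
  then have "((\<lambda>s. f s x) has_derivative (\<lambda>s. ?D t (s, 0))) (at t)"
    by (simp add: chart_inv[OF assms(3,4)])
  moreover have eq: "(\<lambda>s. ?D t (s, 0)) = (*) (?D t (1, 0))"
  proof
    fix s show "?D t (s, 0) = ?D t (1, 0) * s"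
      using linear_cmul[OF has_derivative_linear[OF d], of s "(1, 0)"] by simp
  qed
  ultimately show ?thesis unfolding has_field_derivative_def by (simp only: eq)
qed

text \<open>The time derivative is continuous, hence bounded on a compact box in time and position,
  and the mean value inequality applies in \<open>t\<close>. The constant serves twice: it dominates
  difference quotients under the integral, and it keeps the length of a variation away from
  zero.\<close>

lemma smooth_family_lipschitz:
  assumes f: "smooth_family \<epsilon> f" and "\<delta> < \<epsilon>" "compact K"
  shows "\<exists>C\<ge>0. \<forall>x\<in>K. \<forall>t. \<bar>t\<bar> \<le> \<delta> \<longrightarrow> \<bar>f t x - f 0 x\<bar> \<le> C * \<bar>t\<bar>"
proof (rule compact_local_bound[OF assms(3)])
  fix x
  obtain U c where Uc: "(U, c) \<in> A" "x \<in> U" using charts_cover by blast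
  let ?D = "\<lambda>p. frechet_derivative (\<lambda>(t, y). f t (inv_into U c y)) (at p) (1, 0)"
  have "open (c ` U)" using chart_open Uc by auto
  then obtain r where r: "0 < r" "cball (c x) r \<subseteq> c ` U" using open_contains_cball Uc by blast
  have "continuous_on ({-\<epsilon><..<\<epsilon>} \<times> c ` U) ?D"
    by (intro smooth_on_continuous_on smooth_on_frechet_derivative smooth_familyD[OF f Uc(1)])
  then have "continuous_on ({-\<delta>..\<delta>} \<times> cball (c x) r) ?D"
    by (rule continuous_on_subset) (use r assms(2) in auto)
  then have "bounded (?D ` ({-\<delta>..\<delta>} \<times> cball (c x) r))"
    by (intro compact_imp_bounded compact_continuous_image) (auto intro: compact_Times)
  then obtain C where C: "\<forall>z\<in>?D ` ({-\<delta>..\<delta>} \<times> cball (c x) r). norm z \<le> C"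
    unfolding bounded_iff ..
  have "\<bar>f t z - f 0 z\<bar> \<le> C * \<bar>t\<bar>" if z: "z \<in> U" "c z \<in> cball (c x) r" and t: "\<bar>t\<bar> \<le> \<delta>" for z t
  proof -
    have "norm (f t z - f 0 z) \<le> C * norm (t - 0)"
    proof (rule field_differentiable_bound[of "{-\<delta>..\<delta>}"])
      fix s assume s: "s \<in> {-\<delta>..\<delta>}"
      then have "\<bar>s\<bar> < \<epsilon>" using assms(2) by auto
      from has_field_derivative_at_within[OF smooth_family_has_derivative[OF f this Uc(1) z(1)]]
      show "((\<lambda>t. f t z) has_field_derivative ?D (s, c z)) (at s within {-\<delta>..\<delta>})" .
      have "(s, c z) \<in> {-\<delta>..\<delta>} \<times> cball (c x) r" using s z(2) by simp
      from bspec[OF C imageI[OF this]] show "norm (?D (s, c z)) \<le> C" .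
    qed (use t in auto)
    then show ?thesis by simp
  qed
  then show "\<exists>N C. open N \<and> x \<in> N \<and> (\<forall>z\<in>N. \<forall>t. \<bar>t\<bar> \<le> \<delta> \<longrightarrow> \<bar>f t z - f 0 z\<bar> \<le> C * \<bar>t\<bar>)"
    using open_chart_preimage[OF Uc(1) open_ball[of "c x" r]] Uc(2) r(1)
    by (intro exI[of _ "U \<inter> c -` ball (c x) r"] exI[of _ C]) auto
qed (meson abs_ge_zero mult_right_mono order_trans)

lemma variation_domainD:
  assumes "variation_domain K D"
  shows "D \<in> sets borel" "compact (closure D)" "compact K"
  using assms by (auto simp: variation_domain_def split: if_splits)

end

section \<open>Metric, gradient and volume in coordinates\<close>

context riemannian_manifold
begin

definition gram :: "'a set \<Rightarrow> ('a \<Rightarrow> real ^ 'm) \<Rightarrow> 'a \<Rightarrow> real ^ 'm ^ 'm" where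
  "gram U c x = (\<chi> i j. g x (coord_vec U c x (axis i 1)) (coord_vec U c x (axis j 1)))"

lemma g_coord_linear:
  assumes "(U, c) \<in> A" "x \<in> U"
  shows "linear (\<lambda>v. g x (coord_vec U c x v) (coord_vec U c x w))"
proof (rule linearI)
  have t: "coord_vec U c x v \<in> tangent_space x" for v by (rule coord_vec_tangent[OF assms])
  show "g x (coord_vec U c x (a + b)) (coord_vec U c x w) =
      g x (coord_vec U c x a) (coord_vec U c x w) + g x (coord_vec U c x b) (coord_vec U c x w)" for a b
    using g_linear[OF t t t, of 1 a 1 b w] coord_vec_linear[OF assms, of 1 a 1 b] by simp
  show "g x (coord_vec U c x (r *\<^sub>R a)) (coord_vec U c x w) =
      r *\<^sub>R g x (coord_vec U c x a) (coord_vec U c x w)" for r a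
    using g_linear[OF t t t, of r a 0 0 w] coord_vec_linear[OF assms, of r a 0 0] by simp
qed

lemma g_coord:
  assumes "(U, c) \<in> A" "x \<in> U"
  shows "g x (coord_vec U c x v) (coord_vec U c x w) = v \<bullet> (gram U c x *v w)"
proof -
  let ?b = "\<lambda>v w. g x (coord_vec U c x v) (coord_vec U c x w)"
  have rep: "?b v w = (\<Sum>i\<in>UNIV. v $ i * ?b (axis i 1) w)" for v w
  proof -
    have "?b v w = ?b (\<Sum>i\<in>UNIV. v $ i *\<^sub>R axis i 1) w"
      by (simp add: basis_expansion scalar_mult_eq_scaleR[symmetric])
    also have "\<dots> = (\<Sum>i\<in>UNIV. ?b (v $ i *\<^sub>R axis i 1) w)"
      by (rule linear_sum[OF g_coord_linear[OF assms]])
    also have "\<dots> = (\<Sum>i\<in>UNIV. v $ i * ?b (axis i 1) w)"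
      by (rule sum.cong[OF refl]) (simp add: linear_cmul[OF g_coord_linear[OF assms]])
    finally show ?thesis .
  qed
  have sym: "?b v w = ?b w v" for v w by (intro g_symmetric coord_vec_tangent assms)
  have "?b (axis i 1) w = (\<Sum>j\<in>UNIV. gram U c x $ i $ j * w $ j)" for i
    unfolding sym[of "axis i 1" w] rep[of w "axis i 1"] gram_def vec_lambda_beta
    by (rule sum.cong[OF refl]) (simp add: sym mult.commute)
  with rep[of v w] show ?thesis by (simp add: inner_vec_def matrix_vector_mult_def)
qed

lemma posdef_gram:
  assumes "(U, c) \<in> A" "x \<in> U"
  shows "posdef (gram U c x)"
  unfolding posdef_def g_coord[OF assms, symmetric]
  using g_symmetric g_positive coord_vec_tangent[OF assms] coord_vec_eq_0_imp[OF assms] by blast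

lemma gram_det_pos: "(U, c) \<in> A \<Longrightarrow> x \<in> U \<Longrightarrow> 0 < det (gram U c x)"
  using orthonormalises_exists[OF posdef_gram] orthonormalises_det_pos by blast

lemma smooth_on_gram:
  "(U, c) \<in> A \<Longrightarrow> smooth_on (c ` U) (\<lambda>y. gram U c (inv_into U c y) $ i $ j)"
  unfolding gram_def vec_lambda_beta by (rule g_smooth)

lemma smooth_on_cramer_inv_gram:
  assumes "(U, c) \<in> A"
  shows "smooth_on (c ` U) (\<lambda>y. cramer_inv (gram U c (inv_into U c y)) $ i $ j)"
proof (rule smooth_on_cramer_inv[OF _ smooth_on_gram[OF assms]])
  show "open (c ` U)" using chart_open[OF assms] by simp
  show "0 < det (gram U c (inv_into U c y))" if "y \<in> c ` U" for y
    by (rule gram_det_pos[OF assms chart_inv_in[OF assms that]])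
qed

lemma orthonormal_basis_coord:
  assumes "(U, c) \<in> A" "x \<in> U"
  shows "orthonormal_basis x (\<lambda>i. coord_vec U c x (P $ i)) \<longleftrightarrow> orthonormalises (gram U c x) P"
  unfolding orthonormal_basis_def orthonormalises_def g_coord[OF assms]
  using coord_vec_tangent[OF assms] by simp

lemma orthonormal_basisE:
  assumes "orthonormal_basis x b" "(U, c) \<in> A" "x \<in> U"
  obtains P where "b = (\<lambda>i. coord_vec U c x (P $ i))" "orthonormalises (gram U c x) P"
proof -
  have "\<exists>v. b i = coord_vec U c x v" for i
    using assms tangent_spaceE[OF _ assms(2,3)] unfolding orthonormal_basis_def by metis
  then obtain v where v: "\<And>i. b i = coord_vec U c x (v i)" by metis
  then have "b = (\<lambda>i. coord_vec U c x ((\<chi> i. v i) $ i))" by (simp add: fun_eq_iff)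
  then show ?thesis using that orthonormal_basis_coord[OF assms(2,3)] assms(1) by metis
qed

lemma orthonormal_basis_tangent: "orthonormal_basis x b \<Longrightarrow> b i \<in> tangent_space x"
  by (simp add: orthonormal_basis_def)

lemma orthonormal_basis_exists: "\<exists>b. orthonormal_basis x b"
  using charts_cover[of x] orthonormalises_exists[OF posdef_gram] orthonormal_basis_coord by metis

text \<open>Here \<open>Q\<close> is the coordinate matrix of a quadratic form \<open>q\<close> on
  the tangent space. The cases of interest are the squared derivative of a function and the squared
  norm of a covariant derivative.\<close>

lemma orthonormal_basis_trace:
  assumes "orthonormal_basis x b" "(U, c) \<in> A" "x \<in> U"
    and q: "\<And>v. q (coord_vec U c x v) = (\<Sum>j\<in>UNIV. \<Sum>k\<in>UNIV. v $ j * v $ k * Q j k)"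
  shows "(\<Sum>i\<in>UNIV. q (b i)) =
    (\<Sum>j\<in>UNIV. \<Sum>k\<in>UNIV. cramer_inv (gram U c x) $ j $ k * Q j k)"
proof -
  obtain P where P: "b = (\<lambda>i. coord_vec U c x (P $ i))" "orthonormalises (gram U c x) P"
    by (rule orthonormal_basisE[OF assms(1-3)])
  show ?thesis unfolding P(1) q by (rule orthonormalises_trace[OF P(2)])
qed

lemma orthonormal_basis_expansion:
  assumes "orthonormal_basis x b" "\<xi> \<in> tangent_space x"
  obtains a where "\<xi> = (\<lambda>f. \<Sum>i\<in>UNIV. a i * b i f)"
proof -
  obtain U c where Uc: "(U, c) \<in> A" "x \<in> U" using charts_cover by blast
  obtain P where P: "b = (\<lambda>i. coord_vec U c x (P $ i))" "orthonormalises (gram U c x) P"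
    by (rule orthonormal_basisE[OF assms(1) Uc])
  obtain v where v: "\<xi> = coord_vec U c x v" by (rule tangent_spaceE[OF assms(2) Uc])
  show ?thesis
    by (rule that[of "\<lambda>i. P $ i \<bullet> (gram U c x *v v)"])
       (simp add: v P(1) coord_vec_sum[OF Uc, symmetric] orthonormalises_expansion[OF P(2)])
qed

text \<open>The gradient is a definite description, so a representing vector has to be produced and
  shown unique. It is the sum of the vectors \<open>b i\<close> with weights
  \<open>b i f\<close>.\<close>

lemma gradient_norm_sq:
  assumes f: "smooth_fun f" and b: "orthonormal_basis x b"
  shows "g x (gradient f x) (gradient f x) = (\<Sum>i\<in>UNIV. (b i f)\<^sup>2)"
proof -
  obtain U c where Uc: "(U, c) \<in> A" "x \<in> U" using charts_cover by blast
  obtain P where P: "b = (\<lambda>i. coord_vec U c x (P $ i))" "orthonormalises (gram U c x) P"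
    by (rule orthonormal_basisE[OF b Uc])
  define v where "v = (\<Sum>i\<in>UNIV. b i f *\<^sub>R P $ i)"
  let ?G = "gram U c x"
  have inner: "v \<bullet> u = (\<Sum>i\<in>UNIV. b i f * (P $ i \<bullet> u))" for u
    by (simp add: v_def inner_sum_left)
  have app: "coord_vec U c x w f = v \<bullet> (?G *v w)" for w
  proof -
    have "coord_vec U c x w f = coord_vec U c x (\<Sum>i\<in>UNIV. (P $ i \<bullet> (?G *v w)) *\<^sub>R P $ i) f"
      by (simp add: orthonormalises_expansion[OF P(2)])
    also have "\<dots> = (\<Sum>i\<in>UNIV. (P $ i \<bullet> (?G *v w)) * b i f)"
      by (simp add: coord_vec_sum[OF Uc] P(1))
    also have "\<dots> = v \<bullet> (?G *v w)" by (simp add: inner mult.commute)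
    finally show ?thesis .
  qed
  have "gradient f x = coord_vec U c x v"
    unfolding gradient_def
  proof (rule the_equality)
    show "coord_vec U c x v \<in> tangent_space x \<and>
        (\<forall>\<xi>\<in>tangent_space x. g x (coord_vec U c x v) \<xi> = \<xi> f)"
    proof (intro conjI ballI)
      fix \<xi> assume "\<xi> \<in> tangent_space x"
      then obtain w where "\<xi> = coord_vec U c x w" by (rule tangent_spaceE[OF _ Uc])
      then show "g x (coord_vec U c x v) \<xi> = \<xi> f" by (simp add: g_coord[OF Uc] app)
    qed (rule coord_vec_tangent[OF Uc])
    fix \<zeta> assume \<zeta>: "\<zeta> \<in> tangent_space x \<and> (\<forall>\<xi>\<in>tangent_space x. g x \<zeta> \<xi> = \<xi> f)"
    then obtain w where w: "\<zeta> = coord_vec U c x w" using tangent_spaceE[OF _ Uc] by blast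
    have "w \<bullet> (?G *v u) = v \<bullet> (?G *v u)" for u
      using bspec[OF conjunct2[OF \<zeta>] coord_vec_tangent[OF Uc, of u]]
      by (simp add: w g_coord[OF Uc] app)
    \<comment> \<open>Two representing vectors are compared by testing on their own difference;
      positive definiteness then forces them to agree.\<close>
    then have "(w - v) \<bullet> (?G *v (w - v)) = 0" by (simp add: inner_diff_left)
    then have "w - v = 0" using posdef_gram[OF Uc] unfolding posdef_def by (metis less_irrefl)
    then show "\<zeta> = coord_vec U c x v" by (simp add: w)
  qed
  moreover have "coord_vec U c x v f = (\<Sum>i\<in>UNIV. b i f * b i f)"
    by (simp add: coord_vec_sum[OF Uc] v_def P(1))
  ultimately show ?thesis by (simp add: g_coord[OF Uc] app[symmetric] power2_eq_square)
qed

lemma gradient_norm_sq_coord: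
  assumes f: "smooth_fun f" and Uc: "(U, c) \<in> A" "x \<in> U"
  shows "g x (gradient f x) (gradient f x) = (\<Sum>j\<in>UNIV. \<Sum>k\<in>UNIV.
    cramer_inv (gram U c x) $ j $ k * (coord_vec U c x (axis j 1) f * coord_vec U c x (axis k 1) f))"
proof -
  obtain b where b: "orthonormal_basis x b" using orthonormal_basis_exists by blast
  have eq: "coord_vec U c x v f = (\<Sum>j\<in>UNIV. v $ j * coord_vec U c x (axis j 1) f)" for v
  proof -
    have "coord_vec U c x (\<Sum>j\<in>UNIV. v $ j *\<^sub>R axis j 1) f =
        (\<Sum>j\<in>UNIV. v $ j * coord_vec U c x (axis j 1) f)"
      by (simp add: coord_vec_sum[OF Uc])
    then show ?thesis by (simp add: basis_expansion scalar_mult_eq_scaleR[symmetric])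
  qed
  have "(coord_vec U c x v f)\<^sup>2 = (\<Sum>j\<in>UNIV. \<Sum>k\<in>UNIV. v $ j * v $ k *
      (coord_vec U c x (axis j 1) f * coord_vec U c x (axis k 1) f))" for v
    unfolding eq[of v] by (simp add: power2_eq_square sum_product mult_ac)
  from orthonormal_basis_trace[OF b Uc this] show ?thesis by (simp add: gradient_norm_sq[OF f b])
qed

lemma smooth_family_gradient_norm_sq:
  assumes f: "smooth_family \<epsilon> f"
  shows "smooth_family \<epsilon> (\<lambda>t x. g x (gradient (f t) x) (gradient (f t) x))"
proof (rule smooth_familyI)
  fix U c assume Uc: "(U, c) \<in> A" and op: "open ({-\<epsilon><..<\<epsilon>} \<times> c ` U)"
  let ?x = "\<lambda>p. inv_into U c (snd p)"
  have G: "smooth_on ({-\<epsilon><..<\<epsilon>} \<times> c ` U) (\<lambda>p. cramer_inv (gram U c (?x p)) $ j $ k)" for j k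
    using smooth_on_snd[OF open_greaterThanLessThan _ smooth_on_cramer_inv_gram[OF Uc]]
      chart_open[OF Uc] by (simp add: case_prod_beta')
  show "smooth_on ({-\<epsilon><..<\<epsilon>} \<times> c ` U)
    (\<lambda>p. g (?x p) (gradient (f (fst p)) (?x p)) (gradient (f (fst p)) (?x p)))"
  proof (rule smooth_on_cong[OF op])
    show "smooth_on ({-\<epsilon><..<\<epsilon>} \<times> c ` U) (\<lambda>p. \<Sum>j\<in>UNIV. \<Sum>k\<in>UNIV.
      cramer_inv (gram U c (?x p)) $ j $ k *
        (coord_vec U c (?x p) (axis j 1) (f (fst p)) * coord_vec U c (?x p) (axis k 1) (f (fst p))))"
      by (intro smooth_on_sum[OF op] smooth_on_mult[OF op] G smooth_on_coord_vec_family[OF f Uc])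
    fix p assume p: "p \<in> {-\<epsilon><..<\<epsilon>} \<times> c ` U"
    then have "smooth_fun (f (fst p))" by (intro smooth_family_slice[OF f]) auto
    moreover have "?x p \<in> U" using p by (intro chart_inv_in[OF Uc]) auto
    ultimately show "(\<Sum>j\<in>UNIV. \<Sum>k\<in>UNIV. cramer_inv (gram U c (?x p)) $ j $ k *
        (coord_vec U c (?x p) (axis j 1) (f (fst p)) * coord_vec U c (?x p) (axis k 1) (f (fst p))))
      = g (?x p) (gradient (f (fst p)) (?x p)) (gradient (f (fst p)) (?x p))"
      by (intro gradient_norm_sq_coord[OF _ Uc, symmetric])
  qed
qed

section \<open>The volume measure and differentiation under the integral\<close>

lemma sqrt_det_gram_continuous:
  assumes "(U, c) \<in> A"
  shows "continuous_on (c ` U) (\<lambda>y. sqrt (det (gram U c (inv_into U c y))))"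
proof -
  have "open (c ` U)" using chart_open[OF assms] by simp
  then show ?thesis
    by (intro continuous_on_real_sqrt smooth_on_continuous_on smooth_on_det smooth_on_gram assms)
qed

lemma emeasure_vol_gram:
  assumes "(U, c) \<in> A" "S \<in> sets borel" "S \<subseteq> U"
  shows "emeasure vol S = (\<integral>\<^sup>+y\<in>c ` S. ennreal (sqrt (det (gram U c (inv_into U c y)))) \<partial>lborel)"
  using emeasure_vol[OF assms] unfolding gram_def .

text \<open>The volume density is bounded on closed coordinate balls, so every point has a
  neighbourhood of finite volume, and finitely many of these cover \<open>K\<close>.\<close>

lemma emeasure_vol_compact:
  assumes "compact K"
  shows "emeasure vol K < \<infinity>"
proof -
  have "\<exists>N. open N \<and> x \<in> N \<and> emeasure vol N < \<infinity>" for x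
  proof -
    obtain U c where Uc: "(U, c) \<in> A" "x \<in> U" using charts_cover by blast
    let ?s = "\<lambda>y. sqrt (det (gram U c (inv_into U c y)))"
    have "open (c ` U)" using chart_open[OF Uc(1)] by simp
    then obtain r where r: "0 < r" "cball (c x) r \<subseteq> c ` U" using open_contains_cball Uc by blast
    have "bounded (?s ` cball (c x) r)"
      by (intro compact_imp_bounded compact_continuous_image
          continuous_on_subset[OF sqrt_det_gram_continuous[OF Uc(1)] r(2)] compact_cball)
    then obtain C where C: "\<forall>z\<in>?s ` cball (c x) r. norm z \<le> C" unfolding bounded_iff ..
    define N where "N = U \<inter> c -` ball (c x) r"
    have N: "open N" "N \<subseteq> U" "x \<in> N" "c ` N \<subseteq> cball (c x) r"
      unfolding N_def using open_chart_preimage[OF Uc(1) open_ball] Uc(2) r(1) by auto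
    have "emeasure vol N = (\<integral>\<^sup>+y\<in>c ` N. ennreal (?s y) \<partial>lborel)"
      by (rule emeasure_vol_gram[OF Uc(1)]) (use N in auto)
    also have "\<dots> \<le> (\<integral>\<^sup>+y. ennreal C * indicator (cball (c x) r) y \<partial>lborel)"
    proof (rule nn_integral_mono)
      fix y
      show "ennreal (?s y) * indicator (c ` N) y \<le> ennreal C * indicator (cball (c x) r) y"
      proof (cases "y \<in> c ` N")
        case True
        then have y: "y \<in> cball (c x) r" using N by blast
        from bspec[OF C imageI[OF this]] have "?s y \<le> C" by simp
        with y True show ?thesis by (simp add: ennreal_leI)
      qed simp
    qed
    also have "\<dots> = ennreal C * emeasure lborel (cball (c x) r)"
      by (simp add: nn_integral_cmult_indicator)
    also have "\<dots> < \<infinity>" by (simp add: ennreal_mult_less_top emeasure_lborel_cball_finite[simplified])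
    finally show ?thesis using N by blast
  qed
  then obtain N where N: "\<And>x. open (N x) \<and> x \<in> N x \<and> emeasure vol (N x) < \<infinity>" by metis
  obtain F where F: "F \<subseteq> K" "finite F" "K \<subseteq> (\<Union>x\<in>F. N x)"
    using compactE_image[OF assms, of K N] N by (metis (no_types, lifting) UN_I subsetI)
  have "emeasure vol K \<le> emeasure vol (\<Union>x\<in>F. N x)"
    by (rule emeasure_mono[OF F(3)]) (use N in \<open>auto simp: sets_vol intro!: borel_open open_UN\<close>)
  also have "\<dots> \<le> (\<Sum>x\<in>F. emeasure vol (N x))"
    by (rule emeasure_subadditive_finite[OF F(2)]) (use N sets_vol in auto)
  also have "\<dots> < \<infinity>" using N F(2) by (simp add: less_top[symmetric])
  finally show ?thesis .
qed

text \<open>On a closed coordinate ball inside \<open>N\<close> the volume density attains a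
  positive minimum, and the ball has positive Lebesgue measure. Needed to conclude that a continuous
  function vanishing almost everywhere vanishes.\<close>

lemma emeasure_vol_open_pos:
  assumes "open N" "x \<in> N"
  shows "emeasure vol N \<noteq> 0"
proof -
  obtain U c where Uc: "(U, c) \<in> A" "x \<in> U" using charts_cover by blast
  let ?s = "\<lambda>y. sqrt (det (gram U c (inv_into U c y)))"
  have oU: "open U" using chart_open[OF Uc(1)] by simp
  have "open (c ` (U \<inter> N))" using open_chart_image[OF Uc(1)] oU assms by auto
  then obtain r where r: "0 < r" "cball (c x) r \<subseteq> c ` (U \<inter> N)"
    using open_contains_cball Uc assms(2) by blast
  then have sub: "cball (c x) r \<subseteq> c ` U" by auto
  have "continuous_on (cball (c x) r) ?s"
    by (rule continuous_on_subset[OF sqrt_det_gram_continuous[OF Uc(1)] sub])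
  from continuous_attains_inf[OF compact_cball _ this] r(1)
  obtain z where z: "z \<in> cball (c x) r" "\<forall>y\<in>cball (c x) r. ?s z \<le> ?s y" by auto
  have pos: "0 < ?s z"
    using gram_det_pos[OF Uc(1) chart_inv_in[OF Uc(1)]] z(1) sub by auto
  have "0 < emeasure lborel (cball (c x) r)"
    using content_cball_pos[OF r(1), of "c x"] emeasure_lborel_cball_finite[of "c x" r]
    by (simp add: measure_def zero_less_iff_neq_zero) (metis enn2real_0 less_irrefl)
  then have "0 < ennreal (?s z) * emeasure lborel (cball (c x) r)"
    using pos by (simp add: ennreal_zero_less_mult_iff)
  also have "\<dots> = (\<integral>\<^sup>+y. ennreal (?s z) * indicator (cball (c x) r) y \<partial>lborel)"
    by (simp add: nn_integral_cmult_indicator)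
  also have "\<dots> \<le> (\<integral>\<^sup>+y\<in>c ` (U \<inter> N). ennreal (?s y) \<partial>lborel)"
  proof (rule nn_integral_mono)
    fix y
    show "ennreal (?s z) * indicator (cball (c x) r) y \<le> ennreal (?s y) * indicator (c ` (U \<inter> N)) y"
    proof (cases "y \<in> cball (c x) r")
      case True
      moreover from this have "?s z \<le> ?s y" using z(2) by blast
      moreover have "y \<in> c ` (U \<inter> N)" using True r(2) by blast
      ultimately show ?thesis by (simp add: ennreal_leI)
    qed simp
  qed
  also have "\<dots> = emeasure vol (U \<inter> N)"
    by (rule emeasure_vol_gram[OF Uc(1), symmetric]) (use oU assms in auto)
  also have "\<dots> \<le> emeasure vol N"
    by (rule emeasure_mono) (use assms sets_vol in auto)
  finally show ?thesis by simp
qed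

lemma set_integrable_smooth_fun:
  assumes "smooth_fun f" "D \<in> sets borel" "compact (closure D)"
  shows "set_integrable vol D f"
proof -
  have c: "continuous_on UNIV f" by (rule smooth_fun_continuous[OF assms(1)])
  have "bounded (f ` closure D)"
    by (intro compact_imp_bounded compact_continuous_image continuous_on_subset[OF c] assms) simp
  then obtain C where C: "\<forall>z\<in>f ` closure D. norm z \<le> C" unfolding bounded_iff ..
  have "emeasure vol D \<le> emeasure vol (closure D)"
    by (rule emeasure_mono[OF closure_subset]) (simp add: sets_vol)
  also have "\<dots> < \<infinity>" by (rule emeasure_vol_compact[OF assms(3)])
  finally have fin: "emeasure vol D < \<infinity>" .
  have "f \<in> borel_measurable vol"
    using borel_measurable_continuous_onI[OF c] measurable_cong_sets[OF sets_vol refl] by blast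
  then show ?thesis unfolding set_integrable_def
    using assms(2) fin C closure_subset[of D]
    by (intro integrableI_bounded_set_indicator[where B = C]) (auto simp: sets_vol)
qed

text \<open>Dominated convergence for the difference quotients. The Lipschitz constant on the
  compact closure of \<open>D\<close> is the dominating function, integrable because
  \<open>D\<close> has finite volume.\<close>

lemma has_derivative_integral_family:
  assumes f: "smooth_family \<epsilon> f" and \<epsilon>: "0 < \<epsilon>" and D: "D \<in> sets borel" "compact (closure D)"
    and f': "\<And>x. ((\<lambda>t. f t x) has_real_derivative f' x) (at 0)"
  shows "((\<lambda>t. LINT x:D|vol. f t x) has_real_derivative (LINT x:D|vol. f' x)) (at 0)"
proof -
  obtain C where C: "\<forall>x\<in>closure D. \<forall>t. \<bar>t\<bar> \<le> \<epsilon> / 2 \<longrightarrow> \<bar>f t x - f 0 x\<bar> \<le> C * \<bar>t\<bar>"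
    using smooth_family_lipschitz[OF f _ D(2), of "\<epsilon> / 2"] \<epsilon> by auto
  have int: "set_integrable vol D (f t)" if "\<bar>t\<bar> \<le> \<epsilon> / 2" for t
    by (rule set_integrable_smooth_fun[OF smooth_family_slice[OF f] D]) (use that \<epsilon> in auto)
  let ?I = "\<lambda>t. LINT x:D|vol. f t x"
  have "((\<lambda>t. (?I t - ?I 0) / t) \<longlongrightarrow> (LINT x:D|vol. f' x)) (at 0)"
    unfolding tendsto_at_iff_sequentially
  proof (intro allI impI)
    fix X :: "nat \<Rightarrow> real" assume X0: "\<forall>i. X i \<in> UNIV - {0}" and X: "X \<longlonglongrightarrow> 0"
    obtain n where n: "\<forall>i\<ge>n. \<bar>X i\<bar> < \<epsilon> / 2"
      using LIMSEQ_D[OF X, of "\<epsilon> / 2"] \<epsilon> by auto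
    \<comment> \<open>Dropping the first \<open>n\<close> terms keeps all times within
      \<open>\<epsilon> / 2\<close>, the range in which the Lipschitz bound holds.\<close>
    define Y where "Y i = X (i + n)" for i
    have Y: "Y i \<noteq> 0" "\<bar>Y i\<bar> \<le> \<epsilon> / 2" for i
      using X0 n by (auto simp: Y_def less_imp_le)
    have "Y \<longlonglongrightarrow> 0" unfolding Y_def[abs_def] by (rule LIMSEQ_ignore_initial_segment[OF X])
    then have Yat: "filterlim Y (at 0) sequentially"
      using Y(1) by (simp add: filterlim_at)
    let ?q = "\<lambda>i x. (f (Y i) x - f 0 x) / Y i"
    have qint: "set_integrable vol D (?q i)" for i
      using int[of "Y i"] int[of 0] Y \<epsilon> by (intro set_integrable_divide set_integral_diff) auto
    have qeq: "(LINT x:D|vol. ?q i x) = (?I (Y i) - ?I 0) / Y i" for i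
      using int[of "Y i"] int[of 0] Y \<epsilon>
      by (simp add: set_integral_diff set_integral_divide_zero)
    have lim: "(\<lambda>i. ?q i x) \<longlonglongrightarrow> f' x" for x
      using filterlim_compose[OF f'[of x, unfolded DERIV_def] Yat] by simp
    have "(\<lambda>i. LINT x:D|vol. ?q i x) \<longlonglongrightarrow> (LINT x:D|vol. f' x)"
      unfolding set_lebesgue_integral_def
    proof (rule integral_dominated_convergence[where w = "\<lambda>x. indicator D x * C"])
      show "(\<lambda>x. indicat_real D x *\<^sub>R ?q i x) \<in> borel_measurable vol" for i
        using qint[of i] unfolding set_integrable_def by (rule borel_measurable_integrable)
      \<comment> \<open>Only the pointwise derivative is given, so \<open>f'\<close> gets its
        measurability as a limit of difference quotients.\<close>
      show "(\<lambda>x. indicat_real D x *\<^sub>R f' x) \<in> borel_measurable vol"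
        by (rule borel_measurable_LIMSEQ_real[OF tendsto_scaleR[OF tendsto_const lim]])
           (use qint in \<open>auto simp: set_integrable_def\<close>)
      show "integrable vol (\<lambda>x. indicat_real D x * C)"
        using set_integrable_smooth_fun[OF smooth_fun_const D] by (simp add: set_integrable_def)
      show "AE x in vol. (\<lambda>i. indicat_real D x *\<^sub>R ?q i x) \<longlonglongrightarrow> indicat_real D x *\<^sub>R f' x"
        by (intro AE_I2 tendsto_scaleR tendsto_const lim)
      show "AE x in vol. norm (indicat_real D x *\<^sub>R ?q i x) \<le> indicat_real D x * C" for i
      proof (rule AE_I2)
        fix x
        show "norm (indicat_real D x *\<^sub>R ?q i x) \<le> indicat_real D x * C"
        proof (cases "x \<in> D")
          case True
          then have "\<bar>f (Y i) x - f 0 x\<bar> \<le> C * \<bar>Y i\<bar>" using C Y closure_subset[of D] by blast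
          then show ?thesis using True Y(1)[of i] by (simp add: divide_le_eq)
        qed simp
      qed
    qed
    then have "(\<lambda>i. (?I (Y i) - ?I 0) / Y i) \<longlonglongrightarrow> (LINT x:D|vol. f' x)" unfolding qeq .
    then show "((\<lambda>t. (?I t - ?I 0) / t) \<circ> X) \<longlonglongrightarrow> (LINT x:D|vol. f' x)"
      unfolding Y_def comp_def by (rule LIMSEQ_offset)
  qed
  then show ?thesis by (simp add: DERIV_def)
qed

end

section \<open>Sections in local trivialisations\<close>

context oriented_vector_bundle
begin

abbreviation triv_inv :: "('a \<Rightarrow> 'v \<Rightarrow> real ^ 'n) \<Rightarrow> 'a \<Rightarrow> real ^ 'n \<Rightarrow> 'v" where
  "triv_inv \<phi> x \<equiv> inv_into (E x) (\<phi> x)"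

lemma fibre_0: "0 \<in> E x"
  and fibre_scale: "u \<in> E x \<Longrightarrow> a *\<^sub>R u \<in> E x"
  and fibre_add: "u \<in> E x \<Longrightarrow> w \<in> E x \<Longrightarrow> u + w \<in> E x"
  and fibre_sum: "(\<And>i. i \<in> I \<Longrightarrow> e i \<in> E x) \<Longrightarrow> (\<Sum>i\<in>I. e i) \<in> E x"
  using fibre_subspace[of x] by (auto intro: subspace_0 subspace_scale subspace_add subspace_sum)

lemma
  assumes "(V, \<phi>) \<in> B" "x \<in> V"
  shows triv_right: "\<phi> x (triv_inv \<phi> x z) = z"
    and triv_inv_in: "triv_inv \<phi> x z \<in> E x"
    and triv_left: "u \<in> E x \<Longrightarrow> triv_inv \<phi> x (\<phi> x u) = u"
  using trivialisation_bij[OF assms]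
  by (auto simp: bij_betw_def f_inv_into_f inv_into_into)

lemma
  assumes "(V, \<phi>) \<in> B" "x \<in> V"
  shows triv_0: "\<phi> x 0 = 0"
    and triv_scale: "u \<in> E x \<Longrightarrow> \<phi> x (a *\<^sub>R u) = a *\<^sub>R \<phi> x u"
    and triv_add: "u \<in> E x \<Longrightarrow> w \<in> E x \<Longrightarrow> \<phi> x (u + w) = \<phi> x u + \<phi> x w"
  using trivialisation_linear[OF assms fibre_0 fibre_0, of 0 0]
    trivialisation_linear[OF assms _ fibre_0, of u a 0] trivialisation_linear[OF assms, of u w 1 1]
  by simp_all

lemma triv_sum:
  assumes "(V, \<phi>) \<in> B" "x \<in> V" "finite I"
  shows "(\<And>i. i \<in> I \<Longrightarrow> e i \<in> E x) \<Longrightarrow> \<phi> x (\<Sum>i\<in>I. e i) = (\<Sum>i\<in>I. \<phi> x (e i))"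
  using assms(3) by (induction I) (simp_all add: triv_0[OF assms(1,2)] triv_add[OF assms(1,2)] fibre_sum)

lemma triv_expansion:
  assumes "(V, \<phi>) \<in> B" "x \<in> V" "u \<in> E x"
  shows "u = (\<Sum>a\<in>UNIV. (\<phi> x u $ a) *\<^sub>R triv_inv \<phi> x (axis a 1))"
proof -
  let ?s = "\<Sum>a\<in>UNIV. (\<phi> x u $ a) *\<^sub>R triv_inv \<phi> x (axis a 1)"
  note in_E = fibre_scale[OF triv_inv_in[OF assms(1,2)]]
  have "\<phi> x ?s = (\<Sum>a\<in>UNIV. (\<phi> x u $ a) *\<^sub>R axis a 1)"
    by (simp add: triv_sum[OF assms(1,2)] in_E triv_scale[OF assms(1,2)]
        triv_inv_in[OF assms(1,2)] triv_right[OF assms(1,2)])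
  also have "\<dots> = \<phi> x u"
    by (simp add: basis_expansion scalar_mult_eq_scaleR[symmetric])
  finally have "triv_inv \<phi> x (\<phi> x ?s) = triv_inv \<phi> x (\<phi> x u)" by simp
  moreover have "?s \<in> E x" by (rule fibre_sum) (rule in_E)
  ultimately show ?thesis using triv_left[OF assms(1,2)] assms(3) by metis
qed

section \<open>Smooth sections and their one-parameter families\<close>

lemma smooth_section_in: "smooth_section \<sigma> \<Longrightarrow> \<sigma> x \<in> E x"
  by (simp add: smooth_section_def)

lemma smooth_sectionD:
  "smooth_section \<sigma> \<Longrightarrow> (U, c) \<in> A \<Longrightarrow> (V, \<phi>) \<in> B \<Longrightarrow>
    smooth_on (c ` (U \<inter> V)) (\<lambda>y. \<phi> (inv_into U c y) (\<sigma> (inv_into U c y)))"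
  by (auto simp: smooth_section_def)

lemma smooth_sectionI:
  assumes "\<And>x. \<sigma> x \<in> E x"
    "\<And>U c V \<phi>. (U, c) \<in> A \<Longrightarrow> (V, \<phi>) \<in> B \<Longrightarrow> open (c ` (U \<inter> V)) \<Longrightarrow>
      smooth_on (c ` (U \<inter> V)) (\<lambda>y. \<phi> (inv_into U c y) (\<sigma> (inv_into U c y)))"
  shows "smooth_section \<sigma>"
proof -
  have "open (c ` (U \<inter> V))" if "(U, c) \<in> A" "(V, \<phi>) \<in> B" for U c V \<phi>
    using open_chart_image[OF that(1)] chart_open[OF that(1)] trivialisation_open[OF that(2)] by auto
  then show ?thesis unfolding smooth_section_def using assms by blast
qed

text \<open>What remains of \<open>variation\<close> without the initial section and the set
  \<open>K\<close>. This part survives multiplication by functions and a shrinking of the time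
  interval, both of which the polar form uses.\<close>

definition section_family :: "real \<Rightarrow> (real \<Rightarrow> 'a \<Rightarrow> 'v) \<Rightarrow> bool" where
  "section_family \<epsilon> \<Sigma> \<longleftrightarrow>
     (\<forall>t\<in>{-\<epsilon><..<\<epsilon>}. \<forall>x. \<Sigma> t x \<in> E x) \<and>
     (\<forall>(U, c)\<in>A. \<forall>(V, \<phi>)\<in>B.
        smooth_on ({-\<epsilon><..<\<epsilon>} \<times> c ` (U \<inter> V))
          (\<lambda>(t, y). \<phi> (inv_into U c y) (\<Sigma> t (inv_into U c y))))"

lemma variation_iff:
  "variation K \<epsilon> \<sigma> \<Sigma> \<longleftrightarrow> 0 < \<epsilon> \<and> \<Sigma> 0 = \<sigma> \<and> section_family \<epsilon> \<Sigma> \<and>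
     (\<forall>t\<in>{-\<epsilon><..<\<epsilon>}. \<forall>x. x \<notin> K \<longrightarrow> \<Sigma> t x = \<sigma> x)"
  unfolding variation_def section_family_def by blast

lemma section_family_in: "section_family \<epsilon> \<Sigma> \<Longrightarrow> \<bar>t\<bar> < \<epsilon> \<Longrightarrow> \<Sigma> t x \<in> E x"
  by (auto simp: section_family_def abs_less_iff)

lemma section_familyD:
  "section_family \<epsilon> \<Sigma> \<Longrightarrow> (U, c) \<in> A \<Longrightarrow> (V, \<phi>) \<in> B \<Longrightarrow>
    smooth_on ({-\<epsilon><..<\<epsilon>} \<times> c ` (U \<inter> V))
      (\<lambda>p. \<phi> (inv_into U c (snd p)) (\<Sigma> (fst p) (inv_into U c (snd p))))"
  by (force simp: section_family_def case_prod_beta')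

lemma open_time_overlap:
  assumes "(U, c) \<in> A" "(V, \<phi>) \<in> B"
  shows "open ({-\<epsilon><..<\<epsilon>::real} \<times> c ` (U \<inter> V))"
  using chart_open[OF assms(1)] trivialisation_open[OF assms(2)]
  by (intro open_time_chart[OF assms(1)] open_Int) auto

lemma section_familyI:
  assumes "\<And>t x. \<bar>t\<bar> < \<epsilon> \<Longrightarrow> \<Sigma> t x \<in> E x"
    "\<And>U c V \<phi>. (U, c) \<in> A \<Longrightarrow> (V, \<phi>) \<in> B \<Longrightarrow> open ({-\<epsilon><..<\<epsilon>} \<times> c ` (U \<inter> V)) \<Longrightarrow>
      smooth_on ({-\<epsilon><..<\<epsilon>} \<times> c ` (U \<inter> V))
        (\<lambda>p. \<phi> (inv_into U c (snd p)) (\<Sigma> (fst p) (inv_into U c (snd p))))"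
  shows "section_family \<epsilon> \<Sigma>"
  unfolding section_family_def
proof (intro conjI ballI allI, goal_cases)
  case (1 t x)
  then show ?case by (intro assms(1)) auto
next
  case (2 C)
  obtain U c where C: "C = (U, c)" by force
  show ?case unfolding C case_prod_conv
  proof
    fix T assume T: "T \<in> B"
    obtain V \<phi> where V: "T = (V, \<phi>)" by force
    show "case T of (V, \<phi>) \<Rightarrow> smooth_on ({-\<epsilon><..<\<epsilon>} \<times> c ` (U \<inter> V))
        (\<lambda>(t, y). \<phi> (inv_into U c y) (\<Sigma> t (inv_into U c y)))"
      using assms(2)[of U c V \<phi>] open_time_overlap[of U c V \<phi> \<epsilon>] 2 T
      by (simp add: C V case_prod_beta')
  qed
qed

lemma section_family_mono:
  assumes "section_family \<epsilon> \<Sigma>" "\<delta> \<le> \<epsilon>"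
  shows "section_family \<delta> \<Sigma>"
proof (rule section_familyI)
  show "\<Sigma> t x \<in> E x" if "\<bar>t\<bar> < \<delta>" for t x
    using section_family_in[OF assms(1)] that assms(2) by simp
  show "smooth_on ({-\<delta><..<\<delta>} \<times> c ` (U \<inter> V))
      (\<lambda>p. \<phi> (inv_into U c (snd p)) (\<Sigma> (fst p) (inv_into U c (snd p))))"
    if "(U, c) \<in> A" "(V, \<phi>) \<in> B" for U c V \<phi>
    using assms(2) by (intro smooth_on_subset[OF section_familyD[OF assms(1) that]]) auto
qed

lemma section_family_slice:
  assumes "section_family \<epsilon> \<Sigma>" "\<bar>t\<bar> < \<epsilon>"
  shows "smooth_section (\<Sigma> t)"
proof (rule smooth_sectionI)
  show "\<Sigma> t x \<in> E x" for x by (rule section_family_in[OF assms])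
  show "smooth_on (c ` (U \<inter> V)) (\<lambda>y. \<phi> (inv_into U c y) (\<Sigma> t (inv_into U c y)))"
    if "(U, c) \<in> A" "(V, \<phi>) \<in> B" "open (c ` (U \<inter> V))" for U c V \<phi>
    using smooth_on_slice[OF open_greaterThanLessThan that(3) section_familyD[OF assms(1) that(1,2)], of t]
      assms(2) by (simp add: abs_less_iff)
qed

lemma section_family_static:
  assumes "smooth_section \<sigma>"
  shows "section_family \<epsilon> (\<lambda>t. \<sigma>)"
proof (rule section_familyI)
  show "\<sigma> x \<in> E x" for x by (rule smooth_section_in[OF assms])
  fix U c V \<phi> assume *: "(U, c) \<in> A" "(V, \<phi>) \<in> B"
  have "open (c ` (U \<inter> V))"
    using open_chart_image[OF *(1)] chart_open[OF *(1)] trivialisation_open[OF *(2)] by auto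
  from smooth_on_snd[OF open_greaterThanLessThan this smooth_sectionD[OF assms *]]
  show "smooth_on ({-\<epsilon><..<\<epsilon>} \<times> c ` (U \<inter> V))
      (\<lambda>p. \<phi> (inv_into U c (snd p)) (\<sigma> (inv_into U c (snd p))))"
    by (simp add: case_prod_beta')
qed

lemma section_family_scale:
  assumes f: "smooth_family \<epsilon> f" and S: "section_family \<epsilon> \<Sigma>"
  shows "section_family \<epsilon> (\<lambda>t x. f t x *\<^sub>R \<Sigma> t x)"
proof (rule section_familyI)
  show "f t x *\<^sub>R \<Sigma> t x \<in> E x" if "\<bar>t\<bar> < \<epsilon>" for t x
    by (rule fibre_scale[OF section_family_in[OF S that]])
  fix U c V \<phi> assume *: "(U, c) \<in> A" "(V, \<phi>) \<in> B" and op: "open ({-\<epsilon><..<\<epsilon>} \<times> c ` (U \<inter> V))"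
  have "smooth_on ({-\<epsilon><..<\<epsilon>} \<times> c ` (U \<inter> V)) (\<lambda>p. f (fst p) (inv_into U c (snd p)))"
    by (rule smooth_on_subset[OF smooth_familyD'[OF f *(1)]]) auto
  from smooth_on_scaleR[OF op this section_familyD[OF S *]]
  show "smooth_on ({-\<epsilon><..<\<epsilon>} \<times> c ` (U \<inter> V)) (\<lambda>p. \<phi> (inv_into U c (snd p))
      (f (fst p) (inv_into U c (snd p)) *\<^sub>R \<Sigma> (fst p) (inv_into U c (snd p))))"
  proof (rule smooth_on_cong[OF op])
    fix p assume p: "p \<in> {-\<epsilon><..<\<epsilon>} \<times> c ` (U \<inter> V)"
    then have "inv_into U c (snd p) \<in> V" using chart_inv[OF *(1)] by auto
    from triv_scale[OF *(2) this section_family_in[OF S]] p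
    show "f (fst p) (inv_into U c (snd p)) *\<^sub>R \<phi> (inv_into U c (snd p)) (\<Sigma> (fst p) (inv_into U c (snd p)))
      = \<phi> (inv_into U c (snd p)) (f (fst p) (inv_into U c (snd p)) *\<^sub>R \<Sigma> (fst p) (inv_into U c (snd p)))"
      by (auto simp: abs_less_iff)
  qed
qed

lemma smooth_section_scale:
  "smooth_fun f \<Longrightarrow> smooth_section \<sigma> \<Longrightarrow> smooth_section (\<lambda>x. f x *\<^sub>R \<sigma> x)"
  using section_family_slice[OF section_family_scale[OF smooth_family_static section_family_static], of f \<sigma> 0 1]
  by simp

lemma smooth_section_add:
  assumes "smooth_section \<sigma>" "smooth_section \<tau>"
  shows "smooth_section (\<lambda>x. \<sigma> x + \<tau> x)"
proof (rule smooth_sectionI)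
  show "\<sigma> x + \<tau> x \<in> E x" for x by (intro fibre_add smooth_section_in assms)
  fix U c V \<phi> assume *: "(U, c) \<in> A" "(V, \<phi>) \<in> B" and op: "open (c ` (U \<inter> V))"
  from smooth_on_add[OF op smooth_sectionD[OF assms(1) *] smooth_sectionD[OF assms(2) *]]
  show "smooth_on (c ` (U \<inter> V)) (\<lambda>y. \<phi> (inv_into U c y) (\<sigma> (inv_into U c y) + \<tau> (inv_into U c y)))"
  proof (rule smooth_on_cong[OF op])
    fix y assume "y \<in> c ` (U \<inter> V)"
    then have "inv_into U c y \<in> V" using chart_inv[OF *(1)] by auto
    from triv_add[OF *(2) this smooth_section_in[OF assms(1)] smooth_section_in[OF assms(2)]]
    show "\<phi> (inv_into U c y) (\<sigma> (inv_into U c y)) + \<phi> (inv_into U c y) (\<tau> (inv_into U c y)) =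
        \<phi> (inv_into U c y) (\<sigma> (inv_into U c y) + \<tau> (inv_into U c y))" by simp
  qed
qed

lemma smooth_section_0: "smooth_section (\<lambda>x. 0)"
proof (rule smooth_sectionI)
  fix U c V \<phi> assume *: "(U, c) \<in> A" "(V, \<phi>) \<in> B" and op: "open (c ` (U \<inter> V))"
  show "smooth_on (c ` (U \<inter> V)) (\<lambda>y. \<phi> (inv_into U c y) 0)"
    by (rule smooth_on_cong[OF op smooth_on_const[of _ 0]])
       (use triv_0[OF *(2)] chart_inv[OF *(1)] in auto)
qed (rule fibre_0)

lemma smooth_section_sum:
  "finite I \<Longrightarrow> (\<And>i. i \<in> I \<Longrightarrow> smooth_section (s i)) \<Longrightarrow> smooth_section (\<lambda>x. \<Sum>i\<in>I. s i x)"
  by (induction I rule: finite_induct) (simp_all add: smooth_section_0 smooth_section_add)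

text \<open>On \<open>V\<close> smoothness comes from the transition between trivialisations, and
  off \<open>S\<close> the section is zero. The values of \<open>triv_inv\<close> outside
  \<open>V\<close> are harmless since \<open>\<rho>\<close> vanishes there.\<close>

lemma smooth_section_cutoff_frame:
  assumes V: "(V, \<phi>) \<in> B" and \<rho>: "smooth_fun \<rho>" and S: "closed S" "S \<subseteq> V" "\<And>x. x \<notin> S \<Longrightarrow> \<rho> x = 0"
  shows "smooth_section (\<lambda>x. \<rho> x *\<^sub>R triv_inv \<phi> x z)"
proof (rule smooth_sectionI)
  show "\<rho> x *\<^sub>R triv_inv \<phi> x z \<in> E x" for x
    using S fibre_0 fibre_scale[OF triv_inv_in[OF V]] by (cases "x \<in> S") auto
  fix U c W \<psi> assume Uc: "(U, c) \<in> A" and W: "(W, \<psi>) \<in> B"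
  let ?x = "inv_into U c" and ?\<tau> = "\<lambda>x. \<rho> x *\<^sub>R triv_inv \<phi> x z"
  have o: "open U" "open V" "open W"
    using chart_open[OF Uc] trivialisation_open[OF V] trivialisation_open[OF W] by auto
  show "smooth_on (c ` (U \<inter> W)) (\<lambda>y. \<psi> (?x y) (?\<tau> (?x y)))"
  proof (rule smooth_on_local)
    fix y assume "y \<in> c ` (U \<inter> W)"
    then obtain x where x: "y = c x" "x \<in> U" "x \<in> W" by auto
    show "\<exists>T. open T \<and> y \<in> T \<and> smooth_on T (\<lambda>y. \<psi> (?x y) (?\<tau> (?x y)))"
    proof (cases "x \<in> V")
      case True
      let ?T = "c ` (U \<inter> V \<inter> W)"
      have op: "open ?T" using o by (intro open_chart_image[OF Uc] open_Int) auto
      have "smooth_on ?T (\<lambda>y. \<rho> (?x y) *\<^sub>R \<psi> (?x y) (triv_inv \<phi> (?x y) z))"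
        using smooth_on_subset[OF smooth_funD[OF \<rho> Uc], of ?T]
        by (intro smooth_on_scaleR[OF op _ bundle_transition_smooth[OF V W Uc]]) (auto simp: comp_def)
      then have "smooth_on ?T (\<lambda>y. \<psi> (?x y) (?\<tau> (?x y)))"
      proof (rule smooth_on_cong[OF op])
        fix y assume "y \<in> ?T"
        then have "?x y \<in> V" "?x y \<in> W" using chart_inv[OF Uc] by auto
        then show "\<rho> (?x y) *\<^sub>R \<psi> (?x y) (triv_inv \<phi> (?x y) z) = \<psi> (?x y) (?\<tau> (?x y))"
          using triv_scale[OF W] triv_inv_in[OF V] by simp
      qed
      then show ?thesis using op x True by blast
    next
      case False
      let ?T = "c ` (U \<inter> W - S)"
      have op: "open ?T"
        using o S(1) by (intro open_chart_image[OF Uc] open_Diff open_Int) auto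
      have "smooth_on ?T (\<lambda>y. \<psi> (?x y) (?\<tau> (?x y)))"
        by (rule smooth_on_cong[OF op smooth_on_const[of _ 0]])
           (use triv_0[OF W] chart_inv[OF Uc] S(3) in auto)
      then show ?thesis using op x False S(2) by blast
    qed
  qed
qed

end

section \<open>The connection and the fibre metric on smooth families of sections\<close>

context riemannian_vector_bundle
begin

text \<open>With a bump function \<open>\<rho>\<close> supported in \<open>W\<close>, the products
  with \<open>\<sigma>\<close> and \<open>\<tau>\<close> are the same global section. The Leibniz
  rule is applied to both; the terms with \<open>\<xi> \<rho>\<close> agree because the sections
  agree at \<open>x\<close>, and \<open>\<rho>\<close> is 1 there.\<close>

lemma nab_local:
  assumes s: "smooth_section \<sigma>" "smooth_section \<tau>" and W: "open W" "x \<in> W"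
    and eq: "\<And>y. y \<in> W \<Longrightarrow> \<sigma> y = \<tau> y" and \<xi>: "\<xi> \<in> tangent_space x"
  shows "nab \<sigma> x \<xi> = nab \<tau> x \<xi>"
proof -
  obtain U c where Uc: "(U, c) \<in> A" "x \<in> U" using charts_cover by blast
  obtain \<rho> W' S D where \<rho>: "smooth_fun \<rho>" "x \<in> W'" "S \<subseteq> D" "D \<subseteq> U \<inter> W"
    "\<And>y. y \<in> W' \<Longrightarrow> \<rho> y = 1" "\<And>y. y \<notin> S \<Longrightarrow> \<rho> y = 0"
    using cutoff[OF Uc W(2,1)] by metis
  have "(\<lambda>y. \<rho> y *\<^sub>R \<sigma> y) = (\<lambda>y. \<rho> y *\<^sub>R \<tau> y)"
  proof
    fix y show "\<rho> y *\<^sub>R \<sigma> y = \<rho> y *\<^sub>R \<tau> y" using \<rho>(3,4,6) eq by (cases "y \<in> S") auto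
  qed
  then have "\<xi> \<rho> *\<^sub>R \<sigma> x + \<rho> x *\<^sub>R nab \<sigma> x \<xi> = \<xi> \<rho> *\<^sub>R \<tau> x + \<rho> x *\<^sub>R nab \<tau> x \<xi>"
    using nab_Leibniz[OF \<rho>(1) s(1) \<xi>] nab_Leibniz[OF \<rho>(1) s(2) \<xi>] by simp
  then show ?thesis using eq[OF W(2)] \<rho>(5)[OF \<rho>(2)] by simp
qed

lemma nab_0: "\<xi> \<in> tangent_space x \<Longrightarrow> nab (\<lambda>x. 0) x \<xi> = 0"
  using nab_Leibniz[OF smooth_fun_const[of 0] smooth_section_0] by (simp add: tangent_const)

lemma nab_sum:
  "finite I \<Longrightarrow> (\<And>i. i \<in> I \<Longrightarrow> smooth_section (s i)) \<Longrightarrow> \<xi> \<in> tangent_space x \<Longrightarrow>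
    nab (\<lambda>x. \<Sum>i\<in>I. s i x) x \<xi> = (\<Sum>i\<in>I. nab (s i) x \<xi>)"
  by (induction I rule: finite_induct) (simp_all add: nab_0 nab_add smooth_section_sum)

text \<open>The Christoffel symbols of the connection enter through the covariant derivatives of a local
  frame that has been cut off to global sections, since \<open>nab\<close> acts on global sections only.\<close>

lemma smooth_on_nab_family:
  assumes \<Sigma>: "section_family \<epsilon> \<Sigma>" and Uc: "(U, c) \<in> A" and V: "(V, \<phi>) \<in> B"
  shows "smooth_on ({-\<epsilon><..<\<epsilon>} \<times> c ` (U \<inter> V)) (\<lambda>p. \<phi> (inv_into U c (snd p))
    (nab (\<Sigma> (fst p)) (inv_into U c (snd p)) (coord_vec U c (inv_into U c (snd p)) v)))"
proof (rule smooth_on_local)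
  let ?x = "\<lambda>p. inv_into U c (snd p)" and ?I = "{-\<epsilon><..<\<epsilon>}"
  fix p0 assume "p0 \<in> ?I \<times> c ` (U \<inter> V)"
  then obtain t0 x0 where p0: "p0 = (t0, c x0)" "t0 \<in> ?I" "x0 \<in> U" "x0 \<in> V" by auto
  have o: "open U" "open V" using chart_open[OF Uc] trivialisation_open[OF V] by auto
  obtain \<rho> W S D where \<rho>: "smooth_fun \<rho>" "open W" "x0 \<in> W" "W \<subseteq> S" "compact S" "S \<subseteq> D"
    "D \<subseteq> U \<inter> V" "\<And>y. y \<in> W \<Longrightarrow> \<rho> y = 1" "\<And>y. y \<notin> S \<Longrightarrow> \<rho> y = 0"
    using cutoff[OF Uc p0(3,4) o(2)] by metis
  have cS: "closed S" using \<rho>(5) by (rule compact_imp_closed)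
  have WUV: "W \<subseteq> U \<inter> V" using \<rho> by blast
  define \<Phi> where "\<Phi> p = \<phi> (?x p) (\<Sigma> (fst p) (?x p))" for p
  define s where "s a x = \<rho> x *\<^sub>R triv_inv \<phi> x (axis a 1)" for a x
  \<comment> \<open>Coefficients and frame are both cut off, since the Leibniz rule needs a global
    function and a global section. Their products add up to \<open>\<Sigma> t\<close> only on
    \<open>W\<close>, where \<open>\<rho>\<close> is 1; locality of \<open>nab\<close> makes that
    enough.\<close>
  define u where "u a t x = \<rho> x * (\<phi> x (\<Sigma> t x) $ a)" for a t x
  let ?T = "?I \<times> c ` W"
  have op: "open ?T" "open (c ` W)"
    using open_time_chart[OF Uc \<rho>(2)] open_chart_image[OF Uc \<rho>(2)] WUV by auto
  have \<Phi>: "smooth_on ?T (\<lambda>p. \<Phi> p $ a)" for a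
    unfolding \<Phi>_def
    by (intro smooth_on_vec_nth[OF op(1)] smooth_on_subset[OF section_familyD[OF \<Sigma> Uc V]])
       (use WUV in auto)
  have s: "smooth_section (s a)" for a
    unfolding s_def[abs_def] using \<rho> by (intro smooth_section_cutoff_frame[OF V \<rho>(1) cS]) auto
  have u: "smooth_fun (u a t)" if "t \<in> ?I" for a t
    unfolding u_def[abs_def]
  proof (rule smooth_fun_mult_extend[OF Uc _ _ cS _ \<rho>(1)])
    have op': "open (c ` (U \<inter> V))" using open_chart_image[OF Uc, of "U \<inter> V"] o by auto
    have "smooth_section (\<Sigma> t)" by (rule section_family_slice[OF \<Sigma>]) (use that in auto)
    from smooth_on_vec_nth[OF op' smooth_sectionD[OF this Uc V], of a]
    show "smooth_on (c ` (U \<inter> V)) ((\<lambda>x. \<phi> x (\<Sigma> t x) $ a) \<circ> inv_into U c)"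
      by (simp add: comp_def)
  qed (use o \<rho> in auto)
  have u\<Phi>: "coord_vec U c x v (u a t) = frechet_derivative (\<lambda>p. \<Phi> p $ a) (at (t, c x)) (0, v)"
    if "t \<in> ?I" "x \<in> W" for a t x
  proof (rule coord_vec_joint[OF Uc \<rho>(2) _ that(2) _ \<Phi> u[OF that(1)]])
    show "u a t (inv_into U c y) = \<Phi> (t, y) $ a" if "y \<in> c ` W" for y
    proof -
      have "inv_into U c y \<in> W" using that chart_inv[OF Uc] WUV by auto
      then show ?thesis by (simp add: u_def \<Phi>_def \<rho>(8))
    qed
  qed (use that WUV in auto)
  have nab_eq: "nab (\<Sigma> t) x \<xi> = (\<Sum>a\<in>UNIV. \<xi> (u a t) *\<^sub>R s a x + u a t x *\<^sub>R nab (s a) x \<xi>)"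
    if t: "t \<in> ?I" and x: "x \<in> W" and \<xi>: "\<xi> \<in> tangent_space x" for t x \<xi>
  proof -
    have "smooth_section (\<Sigma> t)" by (rule section_family_slice[OF \<Sigma>]) (use t in auto)
    moreover have us: "smooth_section (\<lambda>x. u a t x *\<^sub>R s a x)" for a
      by (rule smooth_section_scale[OF u[OF t] s])
    ultimately have "nab (\<Sigma> t) x \<xi> = nab (\<lambda>x. \<Sum>a\<in>UNIV. u a t x *\<^sub>R s a x) x \<xi>"
    proof (intro nab_local[OF _ smooth_section_sum \<rho>(2) x _ \<xi>])
      fix y assume y: "y \<in> W"
      then have "y \<in> V" "\<Sigma> t y \<in> E y" using WUV section_family_in[OF \<Sigma>, of t y] t by auto
      from triv_expansion[OF V this]
      show "\<Sigma> t y = (\<Sum>a\<in>UNIV. u a t y *\<^sub>R s a y)"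
        by (simp add: u_def s_def \<rho>(8)[OF y])
    qed auto
    also have "\<dots> = (\<Sum>a\<in>UNIV. nab (\<lambda>x. u a t x *\<^sub>R s a x) x \<xi>)"
      by (rule nab_sum[OF _ us \<xi>]) simp
    also have "\<dots> = (\<Sum>a\<in>UNIV. \<xi> (u a t) *\<^sub>R s a x + u a t x *\<^sub>R nab (s a) x \<xi>)"
      by (simp add: nab_Leibniz[OF u[OF t] s \<xi>])
    finally show ?thesis .
  qed
  \<comment> \<open>The first term differentiates the coefficients. The second is the Christoffel
    term: it is smooth because the cut-off frame is independent of time and
    \<open>nab_smooth\<close> applies to it.\<close>
  let ?R = "\<lambda>p. \<Sum>a\<in>UNIV. frechet_derivative (\<lambda>p. \<Phi> p $ a) (at p) (0, v) *\<^sub>R axis a 1 +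
      (\<Phi> p $ a) *\<^sub>R \<phi> (?x p) (nab (s a) (?x p) (coord_vec U c (?x p) v))"
  have N: "smooth_on ?T (\<lambda>p. \<phi> (?x p) (nab (s a) (?x p) (coord_vec U c (?x p) v)))" for a
    using smooth_on_snd[OF open_greaterThanLessThan op(2)
        smooth_on_subset[OF nab_smooth[OF s Uc V] image_mono[OF WUV]]]
    by (simp add: case_prod_beta')
  have "smooth_on ?T ?R"
    by (intro smooth_on_sum[OF op(1)] smooth_on_add[OF op(1)] smooth_on_scaleR[OF op(1)]
        smooth_on_const smooth_on_frechet_derivative \<Phi> N)
  then have "smooth_on ?T (\<lambda>p. \<phi> (?x p) (nab (\<Sigma> (fst p)) (?x p) (coord_vec U c (?x p) v)))"
  proof (rule smooth_on_cong[OF op(1)])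
    fix p assume "p \<in> ?T"
    then obtain t x where p: "p = (t, c x)" "t \<in> ?I" "x \<in> W" by auto
    have xUV: "x \<in> U" "x \<in> V" using p WUV by auto
    have xp: "?x p = x" using p xUV chart_inv[OF Uc] by simp
    let ?\<xi> = "coord_vec U c x v"
    have \<xi>: "?\<xi> \<in> tangent_space x" by (rule coord_vec_tangent[OF Uc xUV(1)])
    note E = smooth_section_in[OF s] nab_in_fibre[OF s \<xi>]
    have "\<phi> x (nab (\<Sigma> t) x ?\<xi>) =
        (\<Sum>a\<in>UNIV. ?\<xi> (u a t) *\<^sub>R \<phi> x (s a x) + u a t x *\<^sub>R \<phi> x (nab (s a) x ?\<xi>))"
      by (simp add: nab_eq[OF p(2,3) \<xi>] triv_sum[OF V xUV(2)] triv_add[OF V xUV(2)]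
          triv_scale[OF V xUV(2)] fibre_add fibre_scale E)
    also have "\<dots> = ?R p"
      using u\<Phi>[OF p(2,3)] triv_right[OF V xUV(2)] xp
      by (simp add: p(1) s_def[of _ x] u_def[of _ t x] \<Phi>_def[of "(t, c x)"] \<rho>(8)[OF p(3)])
    finally show "?R p = \<phi> (?x p) (nab (\<Sigma> (fst p)) (?x p) (coord_vec U c (?x p) v))"
      using xp by (simp add: p(1))
  qed
  then show "\<exists>T. open T \<and> p0 \<in> T \<and>
      smooth_on T (\<lambda>p. \<phi> (?x p) (nab (\<Sigma> (fst p)) (?x p) (coord_vec U c (?x p) v)))"
    using op(1) p0 \<rho>(3) by blast
qed

section \<open>Smoothness of fibre products and of the squared norm of the covariant
  derivative\<close>

lemma h_scale_left: "e \<in> E x \<Longrightarrow> e' \<in> E x \<Longrightarrow> h x (a *\<^sub>R e) e' = a * h x e e'"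
  using h_linear[of e x e e' a 0] by simp

lemma h_scale_right: "e \<in> E x \<Longrightarrow> e' \<in> E x \<Longrightarrow> h x e (a *\<^sub>R e') = a * h x e e'"
  using h_scale_left[of e' x e a] h_symmetric fibre_scale by metis

lemma h_add_left: "e \<in> E x \<Longrightarrow> e' \<in> E x \<Longrightarrow> e'' \<in> E x \<Longrightarrow> h x (e + e') e'' = h x e e'' + h x e' e''"
  using h_linear[of e x e' e'' 1 1] by simp

lemma h_add_right: "e \<in> E x \<Longrightarrow> e' \<in> E x \<Longrightarrow> e'' \<in> E x \<Longrightarrow> h x e'' (e + e') = h x e'' e + h x e'' e'"
  using h_add_left h_symmetric fibre_add by metis

lemma h_0_left: "e \<in> E x \<Longrightarrow> h x 0 e = 0"
  using h_scale_left[of e x e 0] by simp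

lemma h_nonneg: "e \<in> E x \<Longrightarrow> 0 \<le> h x e e"
  using h_positive h_0_left[OF fibre_0] by (cases "e = 0") (auto simp: less_imp_le)

lemma h_sum_left:
  "finite I \<Longrightarrow> (\<And>i. i \<in> I \<Longrightarrow> e i \<in> E x) \<Longrightarrow> e' \<in> E x \<Longrightarrow> h x (\<Sum>i\<in>I. e i) e' = (\<Sum>i\<in>I. h x (e i) e')"
  by (induction I rule: finite_induct) (simp_all add: h_0_left h_add_left fibre_sum)

lemma h_sum_right:
  "finite I \<Longrightarrow> (\<And>i. i \<in> I \<Longrightarrow> e i \<in> E x) \<Longrightarrow> e' \<in> E x \<Longrightarrow> h x e' (\<Sum>i\<in>I. e i) = (\<Sum>i\<in>I. h x e' (e i))"
  using h_sum_left[of I e x e'] h_symmetric[of _ x e'] fibre_sum[of I e x] by simp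

lemma fibre_norm_sq: "e \<in> E x \<Longrightarrow> (fibre_norm x e)\<^sup>2 = h x e e"
  by (simp add: fibre_norm_def h_nonneg)

text \<open>In a local frame the product is a polynomial in the components and the matrix entries of
  \<open>h\<close>. The arguments are arbitrary maps into the fibres instead of families of
  sections, so that covariant derivatives along coordinate vectors are covered too.\<close>

lemma smooth_on_h:
  fixes e e' :: "real \<times> (real ^ 'm) \<Rightarrow> 'v"
  assumes Uc: "(U, c) \<in> A" and V: "(V, \<phi>) \<in> B"
    and in_E: "\<And>t x. \<bar>t\<bar> < \<epsilon> \<Longrightarrow> x \<in> U \<inter> V \<Longrightarrow> e (t, c x) \<in> E x"
      "\<And>t x. \<bar>t\<bar> < \<epsilon> \<Longrightarrow> x \<in> U \<inter> V \<Longrightarrow> e' (t, c x) \<in> E x"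
    and sm: "smooth_on ({-\<epsilon><..<\<epsilon>} \<times> c ` (U \<inter> V)) (\<lambda>p. \<phi> (inv_into U c (snd p)) (e p))"
      "smooth_on ({-\<epsilon><..<\<epsilon>} \<times> c ` (U \<inter> V)) (\<lambda>p. \<phi> (inv_into U c (snd p)) (e' p))"
  shows "smooth_on ({-\<epsilon><..<\<epsilon>} \<times> c ` (U \<inter> V)) (\<lambda>p. h (inv_into U c (snd p)) (e p) (e' p))"
proof -
  let ?x = "\<lambda>p. inv_into U c (snd p)" and ?T = "{-\<epsilon><..<\<epsilon>} \<times> c ` (U \<inter> V)"
  let ?s = "\<lambda>x a. triv_inv \<phi> x (axis a 1)"
  let ?R = "\<lambda>p. \<Sum>a\<in>UNIV. \<Sum>b\<in>UNIV. (\<phi> (?x p) (e p) $ a) * ((\<phi> (?x p) (e' p) $ b) *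
      h (?x p) (?s (?x p) a) (?s (?x p) b))"
  have op: "open ?T" "open (c ` (U \<inter> V))"
    using open_time_overlap[OF Uc V] open_chart_image[OF Uc, of "U \<inter> V"] chart_open[OF Uc]
      trivialisation_open[OF V] by auto
  have H: "smooth_on ?T (\<lambda>p. h (?x p) (?s (?x p) a) (?s (?x p) b))" for a b
    using smooth_on_snd[OF open_greaterThanLessThan op(2) h_smooth[OF V Uc]]
    by (simp add: case_prod_beta')
  have "smooth_on ?T ?R"
    by (intro smooth_on_sum[OF op(1)] smooth_on_mult[OF op(1)] smooth_on_vec_nth[OF op(1)] sm H)
  then show ?thesis
  proof (rule smooth_on_cong[OF op(1)])
    fix p assume "p \<in> ?T"
    then obtain t x where p: "p = (t, c x)" "\<bar>t\<bar> < \<epsilon>" "x \<in> U" "x \<in> V" by auto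
    have xp: "?x p = x" using p chart_inv[OF Uc] by simp
    have e: "e p \<in> E x" "e' p \<in> E x" using in_E p by auto
    note s = triv_inv_in[OF V p(4)]
    have "h x (e p) (e' p) = h x (\<Sum>a\<in>UNIV. (\<phi> x (e p) $ a) *\<^sub>R ?s x a) (\<Sum>b\<in>UNIV. (\<phi> x (e' p) $ b) *\<^sub>R ?s x b)"
      using triv_expansion[OF V p(4) e(1)] triv_expansion[OF V p(4) e(2)] by simp
    also have "\<dots> = (\<Sum>a\<in>UNIV. \<Sum>b\<in>UNIV. (\<phi> x (e p) $ a) * ((\<phi> x (e' p) $ b) * h x (?s x a) (?s x b)))"
      by (simp add: h_sum_left h_sum_right fibre_sum fibre_scale s h_scale_left h_scale_right
          sum_distrib_left) (subst sum.swap, simp add: mult.left_commute)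
    finally show "?R p = h (?x p) (e p) (e' p)" unfolding xp by (rule sym)
  qed
qed

lemma smooth_family_h:
  assumes \<Sigma>: "section_family \<epsilon> \<Sigma>" "section_family \<epsilon> T"
  shows "smooth_family \<epsilon> (\<lambda>t x. h x (\<Sigma> t x) (T t x))"
proof (rule smooth_familyI, rule smooth_on_local)
  fix U c p assume Uc: "(U, c) \<in> A" and "p \<in> {-\<epsilon><..<\<epsilon>} \<times> c ` U"
  then obtain t x where p: "p = (t, c x)" "t \<in> {-\<epsilon><..<\<epsilon>}" "x \<in> U" by auto
  obtain V \<phi> where V: "(V, \<phi>) \<in> B" "x \<in> V" using trivialisations_cover by blast
  let ?x = "\<lambda>p. inv_into U c (snd p)"
  have "smooth_on ({-\<epsilon><..<\<epsilon>} \<times> c ` (U \<inter> V)) (\<lambda>p. h (?x p) (\<Sigma> (fst p) (?x p)) (T (fst p) (?x p)))"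
    by (rule smooth_on_h[OF Uc V(1) _ _ section_familyD[OF \<Sigma>(1) Uc V(1)] section_familyD[OF \<Sigma>(2) Uc V(1)]])
       (use chart_inv[OF Uc] section_family_in[OF \<Sigma>(1)] section_family_in[OF \<Sigma>(2)] in auto)
  then show "\<exists>S. open S \<and> p \<in> S \<and> smooth_on S (\<lambda>p. h (?x p) (\<Sigma> (fst p) (?x p)) (T (fst p) (?x p)))"
    using open_time_overlap[OF Uc V(1)] p V(2) by blast
qed

text \<open>Membership in the tangent space is proved along with the formula, because
  \<open>nab_linear\<close> can be applied to a partial sum only once that sum is known to be
  tangent.\<close>

lemma nab_sum_tangent:
  assumes "smooth_section \<sigma>" "finite I"
  shows "(\<And>i. i \<in> I \<Longrightarrow> \<xi> i \<in> tangent_space x) \<Longrightarrow>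
    nab \<sigma> x (\<lambda>f. \<Sum>i\<in>I. a i * \<xi> i f) = (\<Sum>i\<in>I. a i *\<^sub>R nab \<sigma> x (\<xi> i)) \<and>
    (\<lambda>f. \<Sum>i\<in>I. a i * \<xi> i f) \<in> tangent_space x"
  using assms(2)
proof (induction I)
  case empty
  obtain U c where Uc: "(U, c) \<in> A" "x \<in> U" using charts_cover by blast
  have 0: "coord_vec U c x 0 = (\<lambda>f. 0)" using coord_vec_linear[OF Uc, of 0 0 0 0] by simp
  then have z: "(\<lambda>f. 0) \<in> tangent_space x" using coord_vec_tangent[OF Uc, of 0] by simp
  then show ?case using nab_linear[OF assms(1) z z, of 0 0] by simp
next
  case (insert i I)
  obtain U c where Uc: "(U, c) \<in> A" "x \<in> U" using charts_cover by blast
  let ?\<eta> = "\<lambda>f. \<Sum>i\<in>I. a i * \<xi> i f"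
  have IH: "nab \<sigma> x ?\<eta> = (\<Sum>i\<in>I. a i *\<^sub>R nab \<sigma> x (\<xi> i))" "?\<eta> \<in> tangent_space x"
    and \<xi>: "\<xi> i \<in> tangent_space x" using insert by auto
  obtain v where v: "\<xi> i = coord_vec U c x v" by (rule tangent_spaceE[OF \<xi> Uc])
  obtain w where w: "?\<eta> = coord_vec U c x w" by (rule tangent_spaceE[OF IH(2) Uc])
  have "(\<lambda>f. a i * \<xi> i f + 1 * ?\<eta> f) \<in> tangent_space x"
    using coord_vec_tangent[OF Uc, of "a i *\<^sub>R v + 1 *\<^sub>R w"]
    unfolding coord_vec_linear[OF Uc] v[symmetric] w[symmetric] .
  then show ?case
    using nab_linear[OF assms(1) \<xi> IH(2), of "a i" 1] IH(1) insert.hyps by simp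
qed

text \<open>The basis behind \<open>nab_norm_sq\<close> depends on the point alone. One basis thus
  serves all sections at once, which allows \<open>\<theta>\<close> and \<open>r \<theta>\<close> to
  be compared term by term.\<close>

lemma nab_norm_sq_basis:
  obtains b where "orthonormal_basis x b"
    "\<And>\<sigma>. smooth_section \<sigma> \<Longrightarrow> nab_norm_sq \<sigma> x = (\<Sum>i\<in>UNIV. h x (nab \<sigma> x (b i)) (nab \<sigma> x (b i)))"
proof
  let ?b = "SOME b. orthonormal_basis x b"
  show b: "orthonormal_basis x ?b" by (rule someI_ex[OF orthonormal_basis_exists])
  fix \<sigma> assume \<sigma>: "smooth_section \<sigma>"
  have "nab \<sigma> x (?b i) \<in> E x" for i
    by (rule nab_in_fibre[OF \<sigma> orthonormal_basis_tangent[OF b]])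
  then show "nab_norm_sq \<sigma> x = (\<Sum>i\<in>UNIV. h x (nab \<sigma> x (?b i)) (nab \<sigma> x (?b i)))"
    by (simp add: nab_norm_sq_def Let_def fibre_norm_sq)
qed

text \<open>Eliminates the chosen orthonormal basis in favour of coordinate vectors, which vary
  smoothly with the point.\<close>

lemma nab_norm_sq_coord:
  assumes \<sigma>: "smooth_section \<sigma>" and Uc: "(U, c) \<in> A" "x \<in> U"
  shows "nab_norm_sq \<sigma> x = (\<Sum>j\<in>UNIV. \<Sum>k\<in>UNIV. cramer_inv (gram U c x) $ j $ k *
    h x (nab \<sigma> x (coord_vec U c x (axis j 1))) (nab \<sigma> x (coord_vec U c x (axis k 1))))"
proof -
  let ?e = "\<lambda>j. coord_vec U c x (axis j 1)"
  obtain b where b: "orthonormal_basis x b"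
    "nab_norm_sq \<sigma> x = (\<Sum>i\<in>UNIV. h x (nab \<sigma> x (b i)) (nab \<sigma> x (b i)))"
    using nab_norm_sq_basis[of x] \<sigma> by metis
  have e: "?e j \<in> tangent_space x" for j by (rule coord_vec_tangent[OF Uc])
  note N = nab_in_fibre[OF \<sigma> e]
  have eq: "nab \<sigma> x (coord_vec U c x v) = (\<Sum>j\<in>UNIV. v $ j *\<^sub>R nab \<sigma> x (?e j))" for v
  proof -
    have "coord_vec U c x v = coord_vec U c x (\<Sum>j\<in>UNIV. v $ j *\<^sub>R axis j 1)"
      by (simp add: basis_expansion scalar_mult_eq_scaleR[symmetric])
    also have "\<dots> = (\<lambda>f. \<Sum>j\<in>UNIV. v $ j * ?e j f)" by (simp add: coord_vec_sum[OF Uc])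
    finally show ?thesis using nab_sum_tangent[OF \<sigma> finite, where \<xi> = ?e and a = "\<lambda>j. v $ j"] e by simp
  qed
  have "h x (nab \<sigma> x (coord_vec U c x v)) (nab \<sigma> x (coord_vec U c x v)) =
      (\<Sum>j\<in>UNIV. \<Sum>k\<in>UNIV. v $ j * v $ k * h x (nab \<sigma> x (?e j)) (nab \<sigma> x (?e k)))" for v
    unfolding eq[of v]
    by (simp add: h_sum_left h_sum_right fibre_sum fibre_scale N h_scale_left h_scale_right
        sum_distrib_left) (subst sum.swap, simp add: mult_ac)
  from orthonormal_basis_trace[OF b(1) Uc this] show ?thesis by (simp add: b(2))
qed

lemma smooth_family_nab_norm_sq:
  assumes \<Sigma>: "section_family \<epsilon> \<Sigma>"
  shows "smooth_family \<epsilon> (\<lambda>t. nab_norm_sq (\<Sigma> t))"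
proof (rule smooth_familyI, rule smooth_on_local)
  fix U c p0 assume Uc: "(U, c) \<in> A" and "p0 \<in> {-\<epsilon><..<\<epsilon>} \<times> c ` U"
  then obtain t0 x0 where p0: "p0 = (t0, c x0)" "t0 \<in> {-\<epsilon><..<\<epsilon>}" "x0 \<in> U" by auto
  obtain V \<phi> where V: "(V, \<phi>) \<in> B" "x0 \<in> V" using trivialisations_cover by blast
  let ?x = "\<lambda>p. inv_into U c (snd p)" and ?T = "{-\<epsilon><..<\<epsilon>} \<times> c ` (U \<inter> V)"
  let ?n = "\<lambda>j p. nab (\<Sigma> (fst p)) (?x p) (coord_vec U c (?x p) (axis j 1))"
  have op: "open ?T" "open (c ` (U \<inter> V))" "c ` (U \<inter> V) \<subseteq> c ` U"
    using open_time_overlap[OF Uc V(1)] open_chart_image[OF Uc, of "U \<inter> V"] chart_open[OF Uc]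
      trivialisation_open[OF V(1)] by auto
  have sl: "smooth_section (\<Sigma> t)" if "\<bar>t\<bar> < \<epsilon>" for t by (rule section_family_slice[OF \<Sigma> that])
  have H: "smooth_on ?T (\<lambda>p. h (?x p) (?n j p) (?n k p))" for j k
    by (rule smooth_on_h[OF Uc V(1) _ _ smooth_on_nab_family[OF \<Sigma> Uc V(1)]
          smooth_on_nab_family[OF \<Sigma> Uc V(1)]])
       (auto simp: chart_inv[OF Uc] intro!: nab_in_fibre sl coord_vec_tangent[OF Uc])
  have G: "smooth_on ?T (\<lambda>p. cramer_inv (gram U c (?x p)) $ j $ k)" for j k
    using smooth_on_snd[OF open_greaterThanLessThan op(2)
        smooth_on_subset[OF smooth_on_cramer_inv_gram[OF Uc] op(3)]] by (simp add: case_prod_beta')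
  have "smooth_on ?T (\<lambda>p. \<Sum>j\<in>UNIV. \<Sum>k\<in>UNIV.
      cramer_inv (gram U c (?x p)) $ j $ k * h (?x p) (?n j p) (?n k p))"
    by (intro smooth_on_sum[OF op(1)] smooth_on_mult[OF op(1)] G H)
  then have "smooth_on ?T (\<lambda>p. nab_norm_sq (\<Sigma> (fst p)) (?x p))"
  proof (rule smooth_on_cong[OF op(1)])
    fix p assume "p \<in> ?T"
    then have "\<bar>fst p\<bar> < \<epsilon>" "?x p \<in> U" using chart_inv[OF Uc] by auto
    then show "(\<Sum>j\<in>UNIV. \<Sum>k\<in>UNIV. cramer_inv (gram U c (?x p)) $ j $ k *
        h (?x p) (?n j p) (?n k p)) = nab_norm_sq (\<Sigma> (fst p)) (?x p)"
      by (intro nab_norm_sq_coord[OF sl Uc, symmetric])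
  qed
  then show "\<exists>S. open S \<and> p0 \<in> S \<and> smooth_on S (\<lambda>p. nab_norm_sq (\<Sigma> (fst p)) (?x p))"
    using op(1) p0 V(2) by blast
qed

end

section \<open>The energy density in polar coordinates\<close>

context riemannian_vector_bundle
begin

lemma grad_norm_sq_basis:
  "smooth_fun f \<Longrightarrow> orthonormal_basis x b \<Longrightarrow> grad_norm_sq f x = (\<Sum>i\<in>UNIV. (b i f)\<^sup>2)"
  by (simp add: grad_norm_sq_def gradient_norm_sq)

lemma grad_norm_sq_nonneg: "smooth_fun f \<Longrightarrow> 0 \<le> grad_norm_sq f x"
  using orthonormal_basis_exists[of x] by (auto simp: grad_norm_sq_basis sum_nonneg)

lemma grad_norm_sq_const: "grad_norm_sq (\<lambda>x. a) x = 0"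
proof -
  obtain b where b: "orthonormal_basis x b" using orthonormal_basis_exists by blast
  have "b i (\<lambda>x. a) = 0" for i by (rule tangent_const[OF orthonormal_basis_tangent[OF b]])
  then show ?thesis by (simp add: grad_norm_sq_basis[OF smooth_fun_const b])
qed

lemma smooth_family_grad_norm_sq:
  "smooth_family \<epsilon> f \<Longrightarrow> smooth_family \<epsilon> (\<lambda>t. grad_norm_sq (f t))"
  unfolding grad_norm_sq_def by (rule smooth_family_gradient_norm_sq)

lemma nab_norm_sq_nonneg:
  assumes "smooth_section \<sigma>"
  shows "0 \<le> nab_norm_sq \<sigma> x"
proof -
  obtain b where b: "orthonormal_basis x b"
    "nab_norm_sq \<sigma> x = (\<Sum>i\<in>UNIV. h x (nab \<sigma> x (b i)) (nab \<sigma> x (b i)))"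
    using nab_norm_sq_basis[of x] assms by metis
  show ?thesis unfolding b(2)
    by (intro sum_nonneg h_nonneg nab_in_fibre[OF assms] orthonormal_basis_tangent[OF b(1)])
qed

lemma half_norm_sq_eq: "smooth_section \<sigma> \<Longrightarrow> half_norm_sq \<sigma> x = h x (\<sigma> x) (\<sigma> x) / 2"
  by (simp add: half_norm_sq_def fibre_norm_sq smooth_section_in)

text \<open>Differentiating the constant function \<open>h x (\<theta> x) (\<theta> x)\<close> with
  the metric connection shows that the covariant derivative of \<open>\<theta>\<close> is orthogonal
  to \<open>\<theta>\<close>. The mixed terms of the Leibniz rule then vanish and the formula is
  Pythagoras.\<close>

lemma nab_norm_sq_scale:
  assumes \<theta>: "smooth_section \<theta>" "\<And>x. h x (\<theta> x) (\<theta> x) = K" and r: "smooth_fun r"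
  shows "nab_norm_sq (\<lambda>x. r x *\<^sub>R \<theta> x) x = (r x)\<^sup>2 * nab_norm_sq \<theta> x + K * grad_norm_sq r x"
proof -
  obtain b where b: "orthonormal_basis x b"
    "\<And>\<sigma>. smooth_section \<sigma> \<Longrightarrow> nab_norm_sq \<sigma> x = (\<Sum>i\<in>UNIV. h x (nab \<sigma> x (b i)) (nab \<sigma> x (b i)))"
    using nab_norm_sq_basis[of x] by blast
  let ?\<sigma> = "\<lambda>x. r x *\<^sub>R \<theta> x"
  have "h x (nab ?\<sigma> x \<xi>) (nab ?\<sigma> x \<xi>) = (r x)\<^sup>2 * h x (nab \<theta> x \<xi>) (nab \<theta> x \<xi>) + K * (\<xi> r)\<^sup>2"
    if \<xi>: "\<xi> \<in> tangent_space x" for \<xi>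
  proof -
    note E = smooth_section_in[OF \<theta>(1), of x] nab_in_fibre[OF \<theta>(1) \<xi>]
    have "h x (nab \<theta> x \<xi>) (\<theta> x) + h x (\<theta> x) (nab \<theta> x \<xi>) = 0"
      using nab_metric[OF \<theta>(1,1) \<xi>] tangent_const[OF \<xi>, of K] by (simp add: \<theta>(2))
    then have orth: "h x (nab \<theta> x \<xi>) (\<theta> x) = 0" "h x (\<theta> x) (nab \<theta> x \<xi>) = 0"
      using h_symmetric[of "\<theta> x" x "nab \<theta> x \<xi>"] E by auto
    show ?thesis
      by (simp add: nab_Leibniz[OF r \<theta>(1) \<xi>] h_add_left h_add_right h_scale_left h_scale_right
          fibre_scale fibre_add E orth \<theta>(2) power2_eq_square)
  qed
  then have "nab_norm_sq ?\<sigma> x =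
      (\<Sum>i\<in>UNIV. (r x)\<^sup>2 * h x (nab \<theta> x (b i)) (nab \<theta> x (b i)) + K * (b i r)\<^sup>2)"
    using b(1) by (simp add: b(2)[OF smooth_section_scale[OF r \<theta>(1)]] orthonormal_basis_def)
  then show ?thesis
    by (simp add: b(2)[OF \<theta>(1)] grad_norm_sq_basis[OF r b(1)] sum.distrib sum_distrib_left)
qed

text \<open>The half norm of \<open>r \<theta>\<close> is \<open>K * r\<^sup>2 / 2\<close>, whose
  differential is \<open>K * r\<close> times that of \<open>r\<close>.\<close>

lemma grad_half_norm_sq_scale:
  assumes \<theta>: "smooth_section \<theta>" "\<And>x. h x (\<theta> x) (\<theta> x) = K" and r: "smooth_fun r"
  shows "grad_norm_sq (half_norm_sq (\<lambda>x. r x *\<^sub>R \<theta> x)) x = K\<^sup>2 * (r x)\<^sup>2 * grad_norm_sq r x"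
proof -
  obtain b where b: "orthonormal_basis x b" using orthonormal_basis_exists by blast
  let ?f = "\<lambda>x. K / 2 * (r x * r x)"
  have "half_norm_sq (\<lambda>x. r x *\<^sub>R \<theta> x) = ?f"
    by (rule ext) (simp add: half_norm_sq_eq[OF smooth_section_scale[OF r \<theta>(1)]] h_scale_left
        h_scale_right fibre_scale smooth_section_in[OF \<theta>(1)] \<theta>(2))
  moreover have "b i ?f = K * r x * b i r" for i
  proof -
    note bi = orthonormal_basis_tangent[OF b, of i]
    show ?thesis
      using tangent_mult[OF bi smooth_fun_const smooth_fun_mult[OF r r], of "K / 2"]
        tangent_mult[OF bi r r] tangent_const[OF bi, of "K / 2"] by simp
  qed
  moreover have "smooth_fun ?f" by (intro smooth_fun_mult smooth_fun_const r)
  ultimately show ?thesis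
    by (simp add: grad_norm_sq_basis[OF _ b] r power_mult_distrib sum_distrib_left)
qed

definition energy_density :: "real \<Rightarrow> real \<Rightarrow> ('a \<Rightarrow> 'v) \<Rightarrow> 'a \<Rightarrow> real" where
  "energy_density p q \<sigma> x = 1 / (1 + (fibre_norm x (\<sigma> x))\<^sup>2) powr p *
     (nab_norm_sq \<sigma> x + q * grad_norm_sq (half_norm_sq \<sigma>) x)"

lemma energy_density_eq:
  "smooth_section \<sigma> \<Longrightarrow> energy_density p q \<sigma> x = (1 + h x (\<sigma> x) (\<sigma> x)) powr (- p) *
     (nab_norm_sq \<sigma> x + q * grad_norm_sq (half_norm_sq \<sigma>) x)"
  by (simp add: energy_density_def fibre_norm_sq smooth_section_in powr_minus_divide)

section \<open>The first variation of the energy density\<close>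

lemma smooth_family_half_norm_sq:
  assumes "section_family \<epsilon> \<Sigma>"
  shows "smooth_family \<epsilon> (\<lambda>t. half_norm_sq (\<Sigma> t))"
  by (rule smooth_family_cong[OF smooth_family_mult[OF smooth_family_const[of _ "1 / 2"]
        smooth_family_h[OF assms assms]]])
     (simp add: half_norm_sq_eq section_family_slice[OF assms])

lemma smooth_family_energy_weight:
  assumes "section_family \<epsilon> \<Sigma>"
  shows "smooth_family \<epsilon> (\<lambda>t x. (1 + h x (\<Sigma> t x) (\<Sigma> t x)) powr a)"
  by (intro smooth_family_powr smooth_family_add smooth_family_const smooth_family_h assms
      add_pos_nonneg h_nonneg section_family_in[OF assms]) simp_all

lemma smooth_family_energy_density:
  assumes "section_family \<epsilon> \<Sigma>"
  shows "smooth_family \<epsilon> (\<lambda>t. energy_density p q (\<Sigma> t))"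
proof (rule smooth_family_cong)
  show "smooth_family \<epsilon> (\<lambda>t x. (1 + h x (\<Sigma> t x) (\<Sigma> t x)) powr (- p) *
      (nab_norm_sq (\<Sigma> t) x + q * grad_norm_sq (half_norm_sq (\<Sigma> t)) x))"
    by (intro smooth_family_mult smooth_family_add smooth_family_const smooth_family_energy_weight
        smooth_family_nab_norm_sq smooth_family_grad_norm_sq smooth_family_half_norm_sq assms)
qed (simp add: energy_density_eq section_family_slice[OF assms])

lemma smooth_family_derivative_exists:
  assumes "smooth_family \<epsilon> f" "0 < \<epsilon>"
  obtains f' where "\<And>x. ((\<lambda>t. f t x) has_real_derivative f' x) (at 0)"
proof -
  have "\<exists>D. ((\<lambda>t. f t x) has_real_derivative D) (at 0)" for x
    using charts_cover[of x] smooth_family_has_derivative[OF assms(1), of 0] assms(2) by auto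
  then show ?thesis using that by metis
qed

lemma vertical_energy_derivative:
  assumes \<Sigma>: "section_family \<epsilon> \<Sigma>" "0 < \<epsilon>" and D: "variation_domain K D"
    and d: "\<And>x. ((\<lambda>t. energy_density p q (\<Sigma> t) x) has_real_derivative d x) (at 0)"
  shows "((\<lambda>t. vertical_energy p q D (\<Sigma> t)) has_real_derivative 1 / 2 * (LINT x:D|vol. d x)) (at 0)"
  unfolding vertical_energy_def energy_density_def[symmetric]
  by (intro DERIV_cmult has_derivative_integral_family[OF smooth_family_energy_density[OF \<Sigma>(1)] \<Sigma>(2)]
      variation_domainD[OF D] d)

lemma derivative_at_zero_minimum:
  fixes f :: "real \<Rightarrow> real"
  assumes "(f has_real_derivative D) (at 0)" "0 < \<epsilon>" "\<And>t. \<bar>t\<bar> < \<epsilon> \<Longrightarrow> 0 \<le> f t" "f 0 = 0"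
  shows "D = 0"
  using DERIV_local_min[OF assms(1,2)] assms(3,4) by simp

text \<open>Squared norms such as those of covariant derivatives and gradients are nonnegative, so
  where they vanish at time 0 their first variation vanishes without being computed.\<close>

lemma derivative_zero_of_minimum:
  assumes "smooth_family \<epsilon> f" "0 < \<epsilon>" "\<And>t. \<bar>t\<bar> < \<epsilon> \<Longrightarrow> 0 \<le> f t x" "f 0 x = 0"
  shows "((\<lambda>t. f t x) has_real_derivative 0) (at 0)"
proof -
  obtain f' where f': "\<And>x. ((\<lambda>t. f t x) has_real_derivative f' x) (at 0)"
    using smooth_family_derivative_exists[OF assms(1,2)] by metis
  have "f' x = 0" by (rule derivative_at_zero_minimum[OF f'[of x] assms(2)]) (use assms in auto)
  with f'[of x] show ?thesis by simp
qed

text \<open>The tangential speed \<open>a'\<close> and the radial speed \<open>r'\<close> enter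
  separately, the latter with the logarithmic derivative of the radial factor at
  \<open>r = 1\<close>. The parameter \<open>q\<close> multiplies a gradient term that vanishes to
  first order. The lemma is applied to a static \<open>\<theta>\<close> with a radial bump, and to
  the radial projection of an arbitrary variation.\<close>

lemma energy_density_polar_derivative:
  assumes r: "smooth_family \<epsilon> r" and \<theta>: "section_family \<epsilon> \<theta>" and \<epsilon>: "0 < \<epsilon>" and "0 \<le> K"
    and norm: "\<And>t x. \<bar>t\<bar> < \<epsilon> \<Longrightarrow> h x (\<theta> t x) (\<theta> t x) = K" and r0: "\<And>x. r 0 x = 1"
    and r': "((\<lambda>t. r t x) has_real_derivative r') (at 0)"
    and a': "((\<lambda>t. nab_norm_sq (\<theta> t) x) has_real_derivative a') (at 0)"
  shows "((\<lambda>t. energy_density p q (\<lambda>x. r t x *\<^sub>R \<theta> t x) x) has_real_derivative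
    (1 + K) powr (- p) * (a' + 2 * (1 - p * K / (1 + K)) * r' * nab_norm_sq (\<theta> 0) x)) (at 0)"
proof -
  let ?a = "\<lambda>t. nab_norm_sq (\<theta> t) x" and ?b = "\<lambda>t. grad_norm_sq (r t) x" and ?r = "\<lambda>t. r t x"
  have sm: "smooth_section (\<theta> t)" "smooth_fun (r t)" if "\<bar>t\<bar> < \<epsilon>" for t
    using section_family_slice[OF \<theta> that] smooth_family_slice[OF r that] by auto
  have "r 0 = (\<lambda>x. 1)" using r0 by auto
  then have b0: "?b 0 = 0" by (simp add: grad_norm_sq_const)
  have b': "(?b has_real_derivative 0) (at 0)"
    by (rule derivative_zero_of_minimum[OF smooth_family_grad_norm_sq[OF r] \<epsilon>])
       (auto intro: grad_norm_sq_nonneg sm b0)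
  let ?S = "\<lambda>t. (?r t)\<^sup>2 * ?a t + K * ?b t + q * (K\<^sup>2 * (?r t)\<^sup>2 * ?b t)"
  let ?P = "\<lambda>t. (1 + K * (?r t)\<^sup>2) powr (- p)"
  have S': "(?S has_real_derivative 2 * r' * ?a 0 + a') (at 0)"
    by (rule derivative_eq_intros r' a' b' refl)+ (simp add: r0 b0)
  have "((\<lambda>t. 1 + K * (?r t)\<^sup>2) has_real_derivative 2 * K * r') (at 0)"
    by (rule derivative_eq_intros r' refl)+ (simp add: r0)
  from DERIV_fun_powr[OF this, of "- p"] \<open>0 \<le> K\<close>
  have P': "(?P has_real_derivative - p * (1 + K) powr (- p - 1) * (2 * K * r')) (at 0)"
    by (simp add: r0)
  have "((\<lambda>t. ?P t * ?S t) has_real_derivative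
      (1 + K) powr (- p) * (a' + 2 * (1 - p * K / (1 + K)) * r' * ?a 0)) (at 0)"
  proof (rule DERIV_cong[OF DERIV_mult[OF P' S']])
    have "(1 + K) powr (- p - 1) = (1 + K) powr (- p) / (1 + K)"
      using \<open>0 \<le> K\<close> by (simp add: powr_diff)
    then show "- p * (1 + K) powr (- p - 1) * (2 * K * r') * ?S 0 + (2 * r' * ?a 0 + a') * ?P 0 =
      (1 + K) powr (- p) * (a' + 2 * (1 - p * K / (1 + K)) * r' * ?a 0)"
      by (simp add: r0 b0 algebra_simps)
  qed
  then show ?thesis
  proof (rule has_field_derivative_transform_within_open[of _ _ _ "{-\<epsilon><..<\<epsilon>}"])
    fix t assume "t \<in> {-\<epsilon><..<\<epsilon>}"
    then have t: "\<bar>t\<bar> < \<epsilon>" by auto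
    show "?P t * ?S t = energy_density p q (\<lambda>x. r t x *\<^sub>R \<theta> t x) x"
      using smooth_section_in[OF sm(1)[OF t]]
      by (simp add: energy_density_eq[OF smooth_section_scale[OF sm(2)[OF t] sm(1)[OF t]]]
          nab_norm_sq_scale[OF sm(1)[OF t] norm[OF t] sm(2)[OF t]]
          grad_half_norm_sq_scale[OF sm(1)[OF t] norm[OF t] sm(2)[OF t]]
          h_scale_left h_scale_right fibre_scale norm[OF t] power2_eq_square mult_ac)
  qed (use \<epsilon> in auto)
qed


section \<open>Harmonic sections of constant length\<close>

text \<open>Clearing denominators turns the left side into \<open>1 + K = p * K\<close>;
  \<open>K\<close> stands for \<open>k\<^sup>2\<close>.\<close>

lemma critical_exponent:
  fixes K p :: real
  assumes "0 < K"
  shows "1 - p * K / (1 + K) = 0 \<longleftrightarrow> p = 1 + 1 / K"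
proof -
  have "1 + K \<noteq> 0" "K \<noteq> 0" using assms by simp_all
  then show ?thesis by (auto simp: field_simps)
qed

text \<open>A vanishing sum of squares kills the covariant derivative on an orthonormal basis, and
  linearity in the tangent vector does the rest.\<close>

lemma parallel_iff: "smooth_section \<sigma> \<Longrightarrow> parallel \<sigma> \<longleftrightarrow> (\<forall>x. nab_norm_sq \<sigma> x = 0)"
proof (intro iffI allI)
  fix x assume \<sigma>: "smooth_section \<sigma>" "parallel \<sigma>"
  obtain b where b: "orthonormal_basis x b"
    "nab_norm_sq \<sigma> x = (\<Sum>i\<in>UNIV. h x (nab \<sigma> x (b i)) (nab \<sigma> x (b i)))"
    using nab_norm_sq_basis[of x] \<sigma>(1) by metis
  then show "nab_norm_sq \<sigma> x = 0"
    using \<sigma>(2) by (simp add: parallel_def orthonormal_basis_tangent h_0_left fibre_0)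
next
  assume \<sigma>: "smooth_section \<sigma>" and 0: "\<forall>x. nab_norm_sq \<sigma> x = 0"
  show "parallel \<sigma>"
    unfolding parallel_def
  proof (intro allI ballI)
    fix x \<xi> assume \<xi>: "\<xi> \<in> tangent_space x"
    obtain b where b: "orthonormal_basis x b"
      "\<And>\<sigma>. smooth_section \<sigma> \<Longrightarrow> nab_norm_sq \<sigma> x = (\<Sum>i\<in>UNIV. h x (nab \<sigma> x (b i)) (nab \<sigma> x (b i)))"
      using nab_norm_sq_basis[of x] by blast
    have bt: "b i \<in> tangent_space x" for i using b(1) by (simp add: orthonormal_basis_def)
    note N = nab_in_fibre[OF \<sigma> bt]
    have "h x (nab \<sigma> x (b i)) (nab \<sigma> x (b i)) = 0" for i
      using 0 b(2)[OF \<sigma>] by (simp add: sum_nonneg_eq_0_iff h_nonneg N)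
    then have "nab \<sigma> x (b i) = 0" for i using h_positive[OF N] by (metis less_irrefl)
    moreover obtain a where "\<xi> = (\<lambda>f. \<Sum>i\<in>UNIV. a i * b i f)"
      by (rule orthonormal_basis_expansion[OF b(1) \<xi>])
    ultimately show "nab \<sigma> x \<xi> = 0" using nab_sum_tangent[OF \<sigma> finite, where \<xi> = b] bt by simp
  qed
qed

context
  fixes \<sigma> :: "'a \<Rightarrow> 'v" and k :: real
  assumes \<sigma>: "smooth_section \<sigma>" and k: "0 < k" and norm: "\<And>x. fibre_norm x (\<sigma> x) = k"
begin

lemma h_constant: "h x (\<sigma> x) (\<sigma> x) = k\<^sup>2"
  using fibre_norm_sq[OF smooth_section_in[OF \<sigma>], of x] by (simp add: norm)

lemma parallel_imp_pq_harmonic: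
  assumes "parallel \<sigma>"
  shows "pq_harmonic_section p q \<sigma>"
  unfolding pq_harmonic_section_def
proof (intro conjI allI impI)
  fix K D \<epsilon> \<Sigma> assume D: "variation_domain K D" and "variation K \<epsilon> \<sigma> \<Sigma>"
  then have \<epsilon>: "0 < \<epsilon>" and \<Sigma>0: "\<Sigma> 0 = \<sigma>" and \<Sigma>: "section_family \<epsilon> \<Sigma>"
    unfolding variation_iff by blast+
  have "((\<lambda>t. energy_density p q (\<Sigma> t) x) has_real_derivative 0) (at 0)" for x
  proof -
    let ?w = "\<lambda>t x. (1 + h x (\<Sigma> t x) (\<Sigma> t x)) powr (- p)"
    let ?a = "\<lambda>t. nab_norm_sq (\<Sigma> t)" and ?b = "\<lambda>t. grad_norm_sq (half_norm_sq (\<Sigma> t))"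
    have sl: "smooth_section (\<Sigma> t)" if "\<bar>t\<bar> < \<epsilon>" for t by (rule section_family_slice[OF \<Sigma> that])
    have a0: "?a 0 x = 0" using assms parallel_iff[OF \<sigma>] by (simp add: \<Sigma>0)
    have "half_norm_sq \<sigma> = (\<lambda>x. k\<^sup>2 / 2)"
      by (rule ext) (simp add: half_norm_sq_def norm)
    then have b0: "?b 0 x = 0" by (simp add: \<Sigma>0 grad_norm_sq_const)
    note hs = smooth_family_half_norm_sq[OF \<Sigma>]
    have a': "((\<lambda>t. ?a t x) has_real_derivative 0) (at 0)"
      by (rule derivative_zero_of_minimum[OF smooth_family_nab_norm_sq[OF \<Sigma>] \<epsilon> _ a0])
         (rule nab_norm_sq_nonneg[OF sl])
    have b': "((\<lambda>t. ?b t x) has_real_derivative 0) (at 0)"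
      by (rule derivative_zero_of_minimum[OF smooth_family_grad_norm_sq[OF hs] \<epsilon> _ b0])
         (rule grad_norm_sq_nonneg[OF smooth_family_slice[OF hs]])
    obtain w' where w': "((\<lambda>t. ?w t x) has_real_derivative w' x) (at 0)"
      using smooth_family_derivative_exists[OF smooth_family_energy_weight[OF \<Sigma>] \<epsilon>] by metis
    \<comment> \<open>In the product rule the derivative of the weight is multiplied by the bracket,
      which is zero at time 0.\<close>
    have "((\<lambda>t. ?w t x * (?a t x + q * ?b t x)) has_real_derivative 0) (at 0)"
      using DERIV_mult[OF w' DERIV_add[OF a' DERIV_cmult[OF b']]] by (simp add: a0 b0)
    then show ?thesis
      by (rule has_field_derivative_transform_within_open[of _ _ _ "{-\<epsilon><..<\<epsilon>}"])
         (use \<epsilon> sl in \<open>auto simp: energy_density_eq\<close>)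
  qed
  from vertical_energy_derivative[OF \<Sigma> \<epsilon> D this]
  show "((\<lambda>t. vertical_energy p q D (\<Sigma> t)) has_real_derivative 0) (at 0)"
    by simp
qed (rule \<sigma>)

text \<open>For the radial variation given by a bump \<open>\<rho>\<close> at a point with nonzero
  covariant derivative, the first variation is a multiple of the integral of
  \<open>\<rho> x * ?n x\<close>. The factor is nonzero off the critical exponent, so a nonnegative
  function that is positive on a nonempty open set would have integral zero.\<close>

lemma pq_harmonic_imp_parallel:
  assumes harm: "pq_harmonic_section p q \<sigma>" and p: "p \<noteq> 1 + 1 / k\<^sup>2"
  shows "parallel \<sigma>"
  unfolding parallel_iff[OF \<sigma>]
proof (rule allI, rule ccontr)
  fix x0 assume x0: "nab_norm_sq \<sigma> x0 \<noteq> 0"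
  let ?n = "nab_norm_sq \<sigma>"
  note \<sigma>_family = section_family_static[OF \<sigma>]
  have n: "smooth_fun ?n"
    using smooth_family_slice[OF smooth_family_nab_norm_sq[OF \<sigma>_family[of 1]], of 0] by simp
  define N where "N = {x. 0 < ?n x}"
  have "open N" unfolding N_def
    by (intro open_Collect_less continuous_on_const smooth_fun_continuous[OF n])
  have "x0 \<in> N" using x0 nab_norm_sq_nonneg[OF \<sigma>, of x0] by (simp add: N_def)
  obtain U c where Uc: "(U, c) \<in> A" "x0 \<in> U" using charts_cover by blast
  obtain \<rho> W S D0 where \<rho>: "smooth_fun \<rho>" "open W" "x0 \<in> W" "W \<subseteq> S" "compact S" "S \<subseteq> D0"
    "open D0" "connected D0" "compact (closure D0)"
    "\<And>y. y \<in> W \<Longrightarrow> \<rho> y = 1" "\<And>y. y \<notin> S \<Longrightarrow> \<rho> y = 0" "\<And>y. 0 \<le> \<rho> y"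
    using cutoff[OF Uc \<open>x0 \<in> N\<close> \<open>open N\<close>] by metis
  \<comment> \<open>For a compact manifold \<open>variation_domain\<close> forces the whole space;
    otherwise the support of the bump and the larger ball around it are taken.\<close>
  define K where "K = (if compact (UNIV :: 'a set) then UNIV else S)"
  define D where "D = (if compact (UNIV :: 'a set) then UNIV else D0)"
  have D: "variation_domain K D" using \<rho> by (simp add: variation_domain_def K_def D_def)
  have SD: "S \<subseteq> D" and SK: "S \<subseteq> K" using \<rho>(6) by (auto simp: D_def K_def)
  have \<rho>K: "\<rho> x = 0" if "x \<notin> K" for x using \<rho>(11) SK that by blast
  define r where "r t x = 1 + t * \<rho> x" for t x
  have r: "smooth_family 1 r"
    unfolding r_def[abs_def]
    by (intro smooth_family_add smooth_family_mult smooth_family_const smooth_family_time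
        smooth_family_static \<rho>(1))
  define \<Sigma> where "\<Sigma> t x = r t x *\<^sub>R \<sigma> x" for t x
  have \<Sigma>: "section_family 1 \<Sigma>"
    unfolding \<Sigma>_def[abs_def] by (rule section_family_scale[OF r \<sigma>_family])
  have "variation K 1 \<sigma> \<Sigma>"
    unfolding variation_iff using \<Sigma> \<rho>K by (auto simp: \<Sigma>_def r_def fun_eq_iff)
  then have E0: "((\<lambda>t. vertical_energy p q D (\<Sigma> t)) has_real_derivative 0) (at 0)"
    using harm D unfolding pq_harmonic_section_def by blast
  \<comment> \<open>The coefficient of the radial speed in the polar first variation. The angular
    part is the fixed section \<open>\<sigma>\<close>, so there is no tangential term.\<close>
  define C where "C = (1 + k\<^sup>2) powr (- p) * (2 * (1 - p * k\<^sup>2 / (1 + k\<^sup>2)))"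
  have "((\<lambda>t. energy_density p q (\<Sigma> t) x) has_real_derivative C * (\<rho> x * ?n x)) (at 0)" for x
  proof -
    have "((\<lambda>t. r t x) has_real_derivative \<rho> x) (at 0)"
      unfolding r_def by (rule derivative_eq_intros refl)+ simp
    from energy_density_polar_derivative[OF r \<sigma>_family _ zero_le_power2 h_constant _ this DERIV_const]
    show ?thesis by (simp add: \<Sigma>_def[abs_def] C_def r_def mult_ac)
  qed
  from DERIV_unique[OF vertical_energy_derivative[OF \<Sigma> _ D this] E0]
  have "C * (LINT x:D|vol. \<rho> x * ?n x) = 0" by simp
  moreover have "C \<noteq> 0"
  proof -
    have "1 - p * k\<^sup>2 / (1 + k\<^sup>2) \<noteq> 0"
      using critical_exponent[of "k\<^sup>2" p] k p by (metis zero_less_power)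
    moreover have "(1 + k\<^sup>2) powr (- p) \<noteq> 0" by (simp add: add_nonneg_eq_0_iff)
    ultimately show ?thesis unfolding C_def by (metis mult_eq_0_iff zero_neq_numeral)
  qed
  ultimately have I0: "(LINT x|vol. indicator D x *\<^sub>R (\<rho> x * ?n x)) = 0"
    by (simp add: set_lebesgue_integral_def)
  have int: "integrable vol (\<lambda>x. indicator D x *\<^sub>R (\<rho> x * ?n x))"
    using set_integrable_smooth_fun[OF smooth_fun_mult[OF \<rho>(1) n] variation_domainD(1,2)[OF D]]
    by (simp add: set_integrable_def)
  have "AE x in vol. indicator D x *\<^sub>R (\<rho> x * ?n x) = 0"
    using I0 \<rho>(12) nab_norm_sq_nonneg[OF \<sigma>]
    by (subst integral_nonneg_eq_0_iff_AE[OF int, symmetric]) auto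
  \<comment> \<open>On \<open>W \<inter> N\<close> the integrand is positive: \<open>W\<close> lies
    in \<open>D\<close>, the bump is 1 on \<open>W\<close>, and \<open>N\<close> is the set where
    \<open>?n\<close> is positive.\<close>
  then have "AE x in vol. x \<notin> W \<inter> N"
  proof (rule eventually_mono)
    fix x assume "indicator D x *\<^sub>R (\<rho> x * ?n x) = 0"
    then show "x \<notin> W \<inter> N" using \<rho>(4,10) SD by (auto simp: N_def)
  qed
  then have "emeasure vol {x \<in> space vol. x \<in> W \<inter> N} = 0" by (rule emeasure_eq_0_AE)
  moreover have "space vol = UNIV" using sets_eq_imp_space_eq[OF sets_vol] by simp
  ultimately have "emeasure vol (W \<inter> N) = 0" by (simp add: Collect_conj_eq)
  then show False
    using emeasure_vol_open_pos[of "W \<inter> N" x0] \<rho>(2,3) \<open>open N\<close> \<open>x0 \<in> N\<close> by auto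
qed

text \<open>Variations through the sphere bundle are among those allowed for (p,q)-harmonicity.
  Along them the half norm is constant, so its gradient vanishes and the two energies differ by the
  constant weight. This direction holds for every exponent.\<close>

lemma pq_harmonic_imp_sphere_harmonic:
  assumes harm: "pq_harmonic_section p q \<sigma>"
  shows "sphere_harmonic_section k \<sigma>"
  unfolding sphere_harmonic_section_def
proof (intro conjI allI impI)
  show "sphere_section k \<sigma>" by (simp add: sphere_section_def norm smooth_section_in[OF \<sigma>])
  fix K D \<epsilon> \<Sigma>
  assume D: "variation_domain K D" and var: "variation K \<epsilon> \<sigma> \<Sigma>"
    and sphere: "\<forall>t\<in>{-\<epsilon><..<\<epsilon>}. sphere_section k (\<Sigma> t)"
  let ?w = "1 / (1 + k\<^sup>2) powr p"
  have w: "?w \<noteq> 0" by (simp add: add_nonneg_eq_0_iff)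
  have eq: "1 / ?w * vertical_energy p q D (\<Sigma> t) = dirichlet_energy D (\<Sigma> t)" if "t \<in> {-\<epsilon><..<\<epsilon>}" for t
  proof -
    have n: "fibre_norm x (\<Sigma> t x) = k" for x using sphere that by (simp add: sphere_section_def)
    then have "half_norm_sq (\<Sigma> t) = (\<lambda>x. k\<^sup>2 / 2)" by (simp add: half_norm_sq_def fun_eq_iff)
    then have "vertical_energy p q D (\<Sigma> t) = 1 / 2 * (LINT x:D|vol. ?w * nab_norm_sq (\<Sigma> t) x)"
      unfolding vertical_energy_def by (simp add: n grad_norm_sq_const)
    also have "\<dots> = ?w * dirichlet_energy D (\<Sigma> t)"
      unfolding dirichlet_energy_def set_integral_mult_right by simp
    finally show ?thesis using w by simp
  qed
  have "((\<lambda>t. vertical_energy p q D (\<Sigma> t)) has_real_derivative 0) (at 0)"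
    using harm D var unfolding pq_harmonic_section_def by blast
  from DERIV_cmult[OF this, of "1 / ?w"]
  have "((\<lambda>t. 1 / ?w * vertical_energy p q D (\<Sigma> t)) has_real_derivative 0) (at 0)" by simp
  then show "((\<lambda>t. dirichlet_energy D (\<Sigma> t)) has_real_derivative 0) (at 0)"
  proof (rule has_field_derivative_transform_within_open[of _ _ _ "{-\<epsilon><..<\<epsilon>}"])
    show "0 \<in> {-\<epsilon><..<\<epsilon>}" using var by (simp add: variation_iff)
  qed (simp_all only: eq open_greaterThanLessThan)
qed (rule \<sigma>)

text \<open>The given variation is projected radially to a variation \<open>\<theta>\<close> through
  the sphere bundle. At the critical exponent the derivatives of the two energy densities at time 0
  are proportional at each point. They need not vanish at any point; only their integral does, by
  harmonicity of \<open>\<sigma>\<close> in the sphere bundle.\<close>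

lemma sphere_harmonic_imp_pq_harmonic:
  assumes harm: "sphere_harmonic_section k \<sigma>" and p: "p = 1 + 1 / k\<^sup>2"
  shows "pq_harmonic_section p q \<sigma>"
  unfolding pq_harmonic_section_def
proof (intro conjI allI impI)
  fix K D \<epsilon> \<Sigma> assume D: "variation_domain K D" and "variation K \<epsilon> \<sigma> \<Sigma>"
  then have \<epsilon>: "0 < \<epsilon>" and \<Sigma>0: "\<Sigma> 0 = \<sigma>" and \<Sigma>: "section_family \<epsilon> \<Sigma>"
    and "\<forall>t\<in>{-\<epsilon><..<\<epsilon>}. \<forall>x. x \<notin> K \<longrightarrow> \<Sigma> t x = \<sigma> x"
    unfolding variation_iff by blast+
  then have off: "\<Sigma> t x = \<sigma> x" if "\<bar>t\<bar> < \<epsilon>" "x \<notin> K" for t x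
    using that by (simp add: abs_less_iff)
  define F where "F t x = h x (\<Sigma> t x) (\<Sigma> t x)" for t x
  have F: "smooth_family \<epsilon> F" unfolding F_def[abs_def] by (rule smooth_family_h[OF \<Sigma> \<Sigma>])
  have F0: "F 0 x = k\<^sup>2" for x by (simp add: F_def \<Sigma>0 h_constant)
  obtain C where C: "0 \<le> C" "\<forall>x\<in>K. \<forall>t. \<bar>t\<bar> \<le> \<epsilon> / 2 \<longrightarrow> \<bar>F t x - F 0 x\<bar> \<le> C * \<bar>t\<bar>"
    using smooth_family_lipschitz[OF F _ variation_domainD(3)[OF D], of "\<epsilon> / 2"] \<epsilon> by auto
  \<comment> \<open>For \<open>\<bar>t\<bar> < k\<^sup>2 / (C + 1)\<close> the squared length stays
    above \<open>k\<^sup>2 - C * \<bar>t\<bar> > 0\<close> on \<open>K\<close>. The summand 1 covers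
    the case \<open>C = 0\<close>, and \<open>\<epsilon> / 2\<close> keeps to the range of the
    Lipschitz bound.\<close>
  define \<delta> where "\<delta> = min (\<epsilon> / 2) (k\<^sup>2 / (C + 1))"
  have \<delta>: "0 < \<delta>" "\<delta> \<le> \<epsilon>" using \<epsilon> k C(1) by (auto simp: \<delta>_def)
  have Fpos: "0 < F t x" if t: "\<bar>t\<bar> < \<delta>" for t x
  proof (cases "x \<in> K")
    case True
    have "C * \<bar>t\<bar> \<le> (C + 1) * \<bar>t\<bar>" by (simp add: mult_right_mono)
    also have "\<dots> < k\<^sup>2" using t C(1) by (simp add: \<delta>_def pos_less_divide_eq mult.commute)
    finally have "C * \<bar>t\<bar> < k\<^sup>2" .
    moreover have "\<bar>F t x - F 0 x\<bar> \<le> C * \<bar>t\<bar>" using C(2) True t by (simp add: \<delta>_def)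
    ultimately show ?thesis by (simp add: F0)
  next
    case False
    then show ?thesis using off[of t x] t \<delta>(2) k by (simp add: F_def h_constant)
  qed
  \<comment> \<open>\<open>r\<close> is the length of \<open>\<Sigma>\<close> divided by
    \<open>k\<close>, and \<open>s\<close> below is its reciprocal. Both are powers of the positive
    smooth family \<open>F\<close>, hence smooth.\<close>
  define r where "r t x = 1 / k * F t x powr (1 / 2)" for t x
  define s where "s t x = k * F t x powr (- (1 / 2))" for t x
  define \<theta> where "\<theta> t x = s t x *\<^sub>R \<Sigma> t x" for t x
  have F\<delta>: "smooth_family \<delta> F" by (rule smooth_family_mono[OF F \<delta>(2)])
  have r: "smooth_family \<delta> r" and s: "smooth_family \<delta> s"
    unfolding r_def[abs_def] s_def[abs_def]
    by (intro smooth_family_mult smooth_family_const smooth_family_powr[OF F\<delta>] Fpos; assumption)+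
  have \<theta>: "section_family \<delta> \<theta>"
    unfolding \<theta>_def[abs_def] by (rule section_family_scale[OF s section_family_mono[OF \<Sigma> \<delta>(2)]])
  have kk: "(k\<^sup>2) powr (1 / 2) = k" using k by (simp add: powr_half_sqrt)
  have rs: "r t x * s t x = 1" if "\<bar>t\<bar> < \<delta>" for t x
    using Fpos[OF that, of x] k by (simp add: r_def s_def powr_minus)
  have r1: "r t x = 1" and s1: "s t x = 1" if "F t x = k\<^sup>2" for t x
    using that k by (simp_all add: r_def s_def powr_minus kk)
  have r\<theta>: "(\<lambda>x. r t x *\<^sub>R \<theta> t x) = \<Sigma> t" if "\<bar>t\<bar> < \<delta>" for t
    by (rule ext) (simp add: \<theta>_def rs[OF that])
  have in_E: "\<Sigma> t x \<in> E x" if "\<bar>t\<bar> < \<delta>" for t x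
    using section_family_in[OF \<Sigma>] that \<delta>(2) by simp
  have \<theta>norm: "h x (\<theta> t x) (\<theta> t x) = k\<^sup>2" if t: "\<bar>t\<bar> < \<delta>" for t x
  proof -
    have "F t x powr (- (1 / 2)) * F t x powr (- (1 / 2)) * F t x = 1"
      using Fpos[OF t, of x] powr_add[of "F t x" "- (1 / 2)" "- (1 / 2)"] powr_minus[of "F t x" 1]
      by simp
    then show ?thesis
      using in_E[OF t, of x]
      by (simp add: \<theta>_def h_scale_left h_scale_right fibre_scale s_def power2_eq_square mult_ac
          flip: F_def)
  qed
  \<comment> \<open>Where \<open>\<Sigma>\<close> still equals \<open>\<sigma>\<close> the squared
    length is \<open>k\<^sup>2\<close> and the projection changes nothing, so \<open>K\<close>
    remains admissible for \<open>\<theta>\<close>.\<close>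
  have \<theta>var: "variation K \<delta> \<sigma> \<theta>"
    unfolding variation_iff
  proof (intro conjI ballI allI impI)
    show "\<theta> 0 = \<sigma>" by (rule ext) (simp add: \<theta>_def s1[OF F0] \<Sigma>0)
    fix t x assume "t \<in> {-\<delta><..<\<delta>}" "x \<notin> K"
    then have "\<Sigma> t x = \<sigma> x" using off[of t x] \<delta>(2) by auto
    moreover from this have "F t x = k\<^sup>2" by (simp add: F_def h_constant)
    ultimately show "\<theta> t x = \<sigma> x" by (simp add: \<theta>_def s1)
  qed (use \<delta> \<theta> in auto)
  have "sphere_section k (\<theta> t)" if "t \<in> {-\<delta><..<\<delta>}" for t
  proof -
    have "\<bar>t\<bar> < \<delta>" using that by auto
    then show ?thesis
      using \<theta>norm section_family_in[OF \<theta>] k by (simp add: sphere_section_def fibre_norm_def)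
  qed
  then have D0: "((\<lambda>t. dirichlet_energy D (\<theta> t)) has_real_derivative 0) (at 0)"
    using harm D \<theta>var unfolding sphere_harmonic_section_def by blast
  obtain a' where a': "\<And>x. ((\<lambda>t. nab_norm_sq (\<theta> t) x) has_real_derivative a' x) (at 0)"
    using smooth_family_derivative_exists[OF smooth_family_nab_norm_sq[OF \<theta>] \<delta>(1)] by metis
  obtain r' where r': "\<And>x. ((\<lambda>t. r t x) has_real_derivative r' x) (at 0)"
    using smooth_family_derivative_exists[OF r \<delta>(1)] by metis
  have "((\<lambda>t. dirichlet_energy D (\<theta> t)) has_real_derivative 1 / 2 * (LINT x:D|vol. a' x)) (at 0)"
    unfolding dirichlet_energy_def
    by (intro DERIV_cmult has_derivative_integral_family[OF smooth_family_nab_norm_sq[OF \<theta>] \<delta>(1)]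
        variation_domainD[OF D] a')
  \<comment> \<open>The Dirichlet energy of the projected variation is differentiated in two ways:
    under the integral, and by harmonicity of \<open>\<sigma>\<close>.\<close>
  from DERIV_unique[OF this D0] have I0: "(LINT x:D|vol. a' x) = 0" by simp
  have crit: "1 - p * k\<^sup>2 / (1 + k\<^sup>2) = 0"
    by (rule critical_exponent[THEN iffD2]) (use k p in simp_all)
  have "((\<lambda>t. energy_density p q (\<lambda>x. r t x *\<^sub>R \<theta> t x) x) has_real_derivative
      (1 + k\<^sup>2) powr (- p) * a' x) (at 0)" for x
    using energy_density_polar_derivative[OF r \<theta> \<delta>(1) zero_le_power2 \<theta>norm r1[OF F0] r' a',
        where p = p and q = q]
    unfolding crit by simp
  from vertical_energy_derivative[OF section_family_scale[OF r \<theta>] \<delta>(1) D this]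
  have "((\<lambda>t. vertical_energy p q D (\<lambda>x. r t x *\<^sub>R \<theta> t x)) has_real_derivative 0) (at 0)"
    by (simp add: I0)
  \<comment> \<open>The polar form reproduces \<open>\<Sigma> t\<close> only for
    \<open>\<bar>t\<bar> < \<delta>\<close>, which suffices for a derivative at 0.\<close>
  then show "((\<lambda>t. vertical_energy p q D (\<Sigma> t)) has_real_derivative 0) (at 0)"
    by (rule has_field_derivative_transform_within_open[of _ _ _ "{-\<delta><..<\<delta>}"])
       (use \<delta>(1) r\<theta> in \<open>auto simp: abs_less_iff\<close>)
qed (rule \<sigma>)

end

end

theorem theoremA:
  fixes A :: "('a::{t2_space, second_countable_topology}, 'm::finite) chart set"
    and g :: "'a \<Rightarrow> 'a tangent \<Rightarrow> 'a tangent \<Rightarrow> real"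
    and vol :: "'a measure"
    and E :: "'a \<Rightarrow> 'v::real_vector set"
    and B :: "('a set \<times> ('a \<Rightarrow> 'v \<Rightarrow> real ^ 'n::finite)) set"
    and h :: "'a \<Rightarrow> 'v \<Rightarrow> 'v \<Rightarrow> real"
    and nab :: "('a \<Rightarrow> 'v) \<Rightarrow> 'a \<Rightarrow> 'a tangent \<Rightarrow> 'v"
    and \<sigma> :: "'a \<Rightarrow> 'v"
    and p q k :: real
  assumes setting: "riemannian_vector_bundle A g vol E B h nab"
    and smooth: "oriented_vector_bundle.smooth_section A E B \<sigma>"
    and "k > 0"
    and norm: "\<And>x. riemannian_vector_bundle.fibre_norm h x (\<sigma> x) = k"
  shows
    "(p \<noteq> 1 + 1 / k\<^sup>2 \<longrightarrow>
        (riemannian_vector_bundle.pq_harmonic_section A g vol E B h nab p q \<sigma> \<longleftrightarrow>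
         riemannian_vector_bundle.parallel A nab \<sigma>)) \<and>
     (p = 1 + 1 / k\<^sup>2 \<longrightarrow>
        (riemannian_vector_bundle.pq_harmonic_section A g vol E B h nab p q \<sigma> \<longleftrightarrow>
         riemannian_vector_bundle.sphere_harmonic_section A g vol E B h nab k \<sigma>))"
proof -
  interpret riemannian_vector_bundle A g vol E B h nab by (rule setting)
  note * = smooth \<open>k > 0\<close> norm
  show ?thesis
    using parallel_imp_pq_harmonic[OF *] pq_harmonic_imp_parallel[OF *]
      pq_harmonic_imp_sphere_harmonic[OF *] sphere_harmonic_imp_pq_harmonic[OF *] by blast
qed

end
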